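(* Let $m\ge r\ge 2$ be integers. Let $F$ be an $r$-graph that either has at most $m$ vertices, or has exactly $m+1$ vertices one of which has degree $1$. If $\mathcal{K}^F_{m+1}$ is $m$-stable, then there exists an integer $n_2$ such that for all $n\ge n_2$, $\mathrm{ex}(n,H^F_{m+1})=|T_r(n,m)|$.
   Context: An $r$-graph is a finite $r$-uniform hypergraph; $|G|$ denotes the number of edges and $n(G)$ the number of vertices of $G$. $F\subseteq G$ means $G$ contains a (not necessarily induced) copy of $F$ as a subgraph; $G$ is $F$-free if $F\not\subseteq G$, and is free of a family if it contains no member of the family. The Turán number $\mathrm{ex}(n,F)$ is the maximum number of edges in an $F$-free $r$-graph on $n$ vertices. The degree of a vertex is the number of edges containing it. $[m]_r=m(m-1)\cdots(m-r+1)$ is the falling factorial. $T_r(n,m)$ is the complete $m$-partite $r$-graph on $n$ vertices in which no two parts differ in size by more than one (its edges are all $r$-sets meeting each part in at most one vertex). A pair of vertices is covered in a hypergraph if some edge contains both vertices. For an $r$-graph $F$ and an integer $p\ge n(F)$, $\mathcal{K}^F_p$ is the family of all $r$-graphs $H$ that contain a set $C$ of $p$ vertices (called the core) such that the subgraph $H[C]$ induced by $C$ contains a copy of $F$ and every pair of vertices in $C$ is covered in $H$. $H^F_p$ is the following member of $\mathcal{K}^F_p$: label the vertices of $F$ as $v_1,\dots,v_{n(F)}$, add new vertices $v_{n(F)+1},\dots,v_p$, and for each pair $v_i,v_j$ ($1\le i<j\le p$) not covered in $F$ add a set $B_{i,j}$ of $r-2$ new vertices and the edge $\{v_i,v_j\}\cup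 B_{i,j}$, where the sets $B_{i,j}$ are pairwise disjoint. For an $r$-graph $G$ on $[t]=\{1,\dots,t\}$, let $p_G(x_1,\dots,x_t)=r!\sum_{e\in E(G)}\prod_{i\in e}x_i$. The Lagrangian of $G$ is $\lambda(G)=\max\{p_G(x): x_i\ge 0\ \forall i,\ \sum_i x_i=1\}$. The Lagrangian density of an $r$-graph $F$ is $\pi_\lambda(F)=\sup\{\lambda(G): G \text{ an } r\text{-graph with } F\not\subseteq G\}$. An $r$-graph is $m$-partite if its vertex set can be partitioned into $m$ parts (possibly empty) such that every edge contains at most one vertex of each part. For an $r$-graph $F$ on at most $m+1$ vertices with $\pi_\lambda(F)\le\frac{[m]_r}{m^r}$ (this inequality is part of the meaning of the term), the family $\mathcal{K}^F_{m+1}$ is called $m$-stable if for every real $\varepsilon>0$ there are a real $\delta_1>0$ and an integer $n_1$ such that every $\mathcal{K}^F_{m+1}$-free $r$-graph $G$ with $n\ge n_1$ vertices and more than $\left(\frac{[m]_r}{m^r}-\delta_1\right)\binom{n}{r}$ edges can be made $m$-partite by deleting at most $\varepsilon n$ vertices. *)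

theory Defs
  imports Complex_Main "HOL-Library.Disjoint_Sets"
begin

datatype 'a hypergraph = Hypergraph (verts: "'a set") (edges: "'a set set")

definition r_graph :: "nat \<Rightarrow> 'a hypergraph \<Rightarrow> bool" where
  "r_graph r G \<longleftrightarrow> finite (verts G) \<and> (\<forall>e\<in>edges G. e \<subseteq> verts G \<and> card e = r)"

definition num_verts :: "'a hypergraph \<Rightarrow> nat" where
  "num_verts G = card (verts G)"

definition num_edges :: "'a hypergraph \<Rightarrow> nat" where
  "num_edges G = card (edges G)"

definition vertex_degree :: "'a hypergraph \<Rightarrow> 'a \<Rightarrow> nat" where
  "vertex_degree G v = card {e \<in> edges G. v \<in> e}"

definition induced :: "'a hypergraph \<Rightarrow> 'a set \<Rightarrow> 'a hypergraph" where
  "induced G C = Hypergraph C {e \<in> edges G. e \<subseteq> C}"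

text \<open>Containment is up to isomorphism and non-induced, and the two hypergraphs may live on
  different vertex types; isolated vertices of \<open>F\<close> have to be embedded as well.\<close>

definition contains_copy :: "'a hypergraph \<Rightarrow> 'b hypergraph \<Rightarrow> bool" where
  "contains_copy G F \<longleftrightarrow>
     (\<exists>f. inj_on f (verts F) \<and> f ` verts F \<subseteq> verts G \<and> (\<forall>e\<in>edges F. f ` e \<in> edges G))"

definition free_of_family :: "'b hypergraph set \<Rightarrow> 'a hypergraph \<Rightarrow> bool" where
  "free_of_family \<F> G \<longleftrightarrow> (\<forall>F\<in>\<F>. \<not> contains_copy G F)"

text \<open>Every finite hypergraph is isomorphic to one whose vertices are natural numbers, so
  quantification over all \<open>r\<close>-graphs is quantification over \<open>r\<close>-graphs on \<open>nat\<close>.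
  The maximum is over a finite set of numbers, which is nonempty when \<open>F\<close> has an edge.\<close>

definition turan_number :: "nat \<Rightarrow> nat \<Rightarrow> 'a hypergraph \<Rightarrow> nat" where
  "turan_number r n F =
     Max {num_edges G | G :: nat hypergraph.
            r_graph r G \<and> num_verts G = n \<and> \<not> contains_copy G F}"

definition is_partition :: "'a set \<Rightarrow> nat \<Rightarrow> (nat \<Rightarrow> 'a set) \<Rightarrow> bool" where
  "is_partition V m P \<longleftrightarrow> (\<Union>i<m. P i) = V \<and> disjoint_family_on P {..<m}"

definition m_partite :: "nat \<Rightarrow> 'a hypergraph \<Rightarrow> bool" where
  "m_partite m G \<longleftrightarrow>
     (\<exists>P. is_partition (verts G) m P \<and> (\<forall>e\<in>edges G. \<forall>i<m. card (e \<inter> P i) \<le> 1))"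

definition complete_partite :: "nat \<Rightarrow> 'a set \<Rightarrow> nat \<Rightarrow> (nat \<Rightarrow> 'a set) \<Rightarrow> 'a hypergraph" where
  "complete_partite r V m P =
     Hypergraph V {e. e \<subseteq> V \<and> card e = r \<and> (\<forall>i<m. card (e \<inter> P i) \<le> 1)}"

definition turan_part :: "nat \<Rightarrow> nat \<Rightarrow> nat \<Rightarrow> nat set" where
  "turan_part n m i = {v. v < n \<and> v mod m = i}"

definition turan_graph :: "nat \<Rightarrow> nat \<Rightarrow> nat \<Rightarrow> nat hypergraph" where
  "turan_graph r n m = complete_partite r {..<n} m (turan_part n m)"

text \<open>The residue classes modulo \<open>m\<close> form a partition into \<open>m\<close> parts whose sizes differ by
  at most one, which determines the Turan graph up to isomorphism.\<close>

lemma is_partition_turan_part: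
  assumes "m > 0"
  shows "is_partition {..<n} m (turan_part n m)"
  using assms by (auto simp: is_partition_def turan_part_def disjoint_family_on_def)

lemma card_turan_part_bounds:
  assumes "i < m"
  shows "n div m \<le> card (turan_part n m i)" and "card (turan_part n m i) \<le> n div m + 1"
proof -
  have fin: "finite (turan_part n m i)"
    by (simp add: turan_part_def)
  have "(\<lambda>k. k * m + i) ` {..<n div m} \<subseteq> turan_part n m i"
  proof clarify
    fix k assume "k < n div m"
    then have "Suc k * m \<le> n div m * m" by (intro mult_le_mono1) simp
    also have "\<dots> \<le> n" by simp
    finally show "k * m + i \<in> turan_part n m i"
      using assms by (simp add: turan_part_def)
  qed
  moreover have "inj_on (\<lambda>k. k * m + i) {..<n div m}"
    using assms by (auto simp: inj_on_def)
  ultimately show "n div m \<le> card (turan_part n m i)"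
    using card_inj_on_le[OF _ _ fin] by fastforce
  have "inj_on (\<lambda>v. v div m) (turan_part n m i)"
  proof (rule inj_onI)
    fix v w assume "v \<in> turan_part n m i" "w \<in> turan_part n m i" "v div m = w div m"
    then show "v = w"
      using div_mult_mod_eq[of v m] div_mult_mod_eq[of w m] by (simp add: turan_part_def)
  qed
  moreover have "(\<lambda>v. v div m) ` turan_part n m i \<subseteq> {..n div m}"
    by (auto simp: turan_part_def intro: div_le_mono)
  ultimately show "card (turan_part n m i) \<le> n div m + 1"
    using card_inj_on_le[of _ "turan_part n m i" "{..n div m}"] by simp
qed

definition covered :: "'a hypergraph \<Rightarrow> 'a \<Rightarrow> 'a \<Rightarrow> bool" where
  "covered H u v \<longleftrightarrow> (\<exists>e\<in>edges H. u \<in> e \<and> v \<in> e)"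

definition K_family :: "nat \<Rightarrow> 'a hypergraph \<Rightarrow> nat \<Rightarrow> nat hypergraph set" where
  "K_family r F p =
     {H. r_graph r H \<and>
         (\<exists>C \<subseteq> verts H. card C = p \<and> contains_copy (induced H C) F \<and>
            (\<forall>u\<in>C. \<forall>v\<in>C. u \<noteq> v \<longrightarrow> covered H u v))}"

text \<open>A concrete model of \<open>H\<^sup>F\<^sub>p\<close>. The core consists of the vertices of \<open>F\<close> and of
  \<open>p - num_verts F\<close> further vertices; the set \<open>B\<^sub>i\<^sub>j\<close> of a pair \<open>P = {v\<^sub>i, v\<^sub>j}\<close> is
  \<open>Pad P ` {..<r - 2}\<close>, so these sets are disjoint by construction. Using unordered pairs
  instead of \<open>i < j\<close> makes a labelling of the vertices of \<open>F\<close> unnecessary.\<close>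

datatype 'a core_vertex = Orig 'a | Extra nat

datatype 'a H_vertex = Core "'a core_vertex" | Pad "'a core_vertex set" nat

definition H_core :: "'a hypergraph \<Rightarrow> nat \<Rightarrow> 'a core_vertex set" where
  "H_core F p = Orig ` verts F \<union> Extra ` {num_verts F + 1..p}"

definition uncovered_pairs :: "'a hypergraph \<Rightarrow> nat \<Rightarrow> 'a core_vertex set set" where
  "uncovered_pairs F p =
     {{u, v} | u v. u \<in> H_core F p \<and> v \<in> H_core F p \<and> u \<noteq> v \<and>
        \<not> (\<exists>a b. u = Orig a \<and> v = Orig b \<and> covered F a b)}"

definition H_graph :: "nat \<Rightarrow> 'a hypergraph \<Rightarrow> nat \<Rightarrow> 'a H_vertex hypergraph" where
  "H_graph r F p = Hypergraph
     (Core ` H_core F p \<union> (\<Union>P\<in>uncovered_pairs F p. Pad P ` {..<r - 2}))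
     ((\<lambda>e. Core ` Orig ` e) ` edges F \<union>
      (\<lambda>P. Core ` P \<union> Pad P ` {..<r - 2}) ` uncovered_pairs F p)"

definition lagrange_poly :: "nat \<Rightarrow> 'a hypergraph \<Rightarrow> ('a \<Rightarrow> real) \<Rightarrow> real" where
  "lagrange_poly r G x = fact r * (\<Sum>e\<in>edges G. \<Prod>i\<in>e. x i)"

text \<open>If \<open>verts G\<close> is nonempty, the supremum is a maximum, because the standard simplex is
  nonempty and compact.\<close>

definition lagrangian :: "nat \<Rightarrow> 'a hypergraph \<Rightarrow> real" where
  "lagrangian r G =
     Sup {lagrange_poly r G x | x. (\<forall>i\<in>verts G. 0 \<le> x i) \<and> (\<Sum>i\<in>verts G. x i) = 1}"

text \<open>The Lagrangian makes sense only for hypergraphs with at least one vertex. All Lagrangians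
  lie between 0 and 1, so inserting 0 matters only when no such hypergraph is \<open>F\<close>-free (i.e.
  \<open>num_verts F \<le> 1\<close> and \<open>F\<close> has no edge); it fixes the empty supremum to be 0.\<close>

definition lagrangian_density :: "nat \<Rightarrow> 'a hypergraph \<Rightarrow> real" where
  "lagrangian_density r F =
     Sup (insert 0 {lagrangian r G | G :: nat hypergraph.
            r_graph r G \<and> verts G \<noteq> {} \<and> \<not> contains_copy G F})"

definition falling :: "nat \<Rightarrow> nat \<Rightarrow> real" where
  "falling m r = (\<Prod>i<r. real m - real i)"

definition m_stable :: "nat \<Rightarrow> nat \<Rightarrow> 'a hypergraph \<Rightarrow> bool" where
  "m_stable r m F \<longleftrightarrow>
     num_verts F \<le> m + 1 \<and>
     lagrangian_density r F \<le> falling m r / real m ^ r \<and>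
     (\<forall>\<epsilon>::real. \<epsilon> > 0 \<longrightarrow>
        (\<exists>(\<delta>\<^sub>1::real) (n\<^sub>1::nat). \<delta>\<^sub>1 > 0 \<and>
           (\<forall>G :: nat hypergraph.
              r_graph r G \<and> num_verts G \<ge> n\<^sub>1 \<and>
              free_of_family (K_family r F (m + 1)) G \<and>
              real (num_edges G) >
                (falling m r / real m ^ r - \<delta>\<^sub>1) * real (num_verts G choose r) \<longrightarrow>
              (\<exists>S \<subseteq> verts G. real (card S) \<le> \<epsilon> * real (num_verts G) \<and>
                 m_partite m (induced G (verts G - S))))))"

end

theory Submission imports Defs begin

text \<open>Parts are encoded as colour classes of a colouring \<open>c\<close>, so an edge is transversal iff \<open>c\<close> is
  injective on it.

  Let \<open>G\<close> be \<open>H\<close>-free with more edges than the Turan graph. Deleting \<open>O(n\<^sup>r\<^sup>-\<^sup>1)\<close> edges makes every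
  covered pair covered many times disjointly outside itself, so that the rest is free of the
  \<open>K\<close>-family, and stability yields a colouring with \<open>o(n\<^sup>r)\<close> non-transversal (bad) edges. Choose one
  with the fewest bad edges. All classes are then of linear size, and fewer transversal sets are
  missing from \<open>G\<close> than there are bad edges.

  The core of \<open>H\<close> has a vertex \<open>x\<close> lying in at most one edge of \<open>F\<close>, hence also an uncovered pair
  \<open>{x, z}\<close>. If both ends of a monochromatic pair inside a bad edge were in few missing sets, a union
  bound would give a complete transversal structure to which the bad edge adds a copy of \<open>H\<close>, the
  pair playing \<open>{x, z}\<close>. So each bad edge meets the small set of vertices in many missing sets, and
  one such vertex \<open>v\<close> lies in many bad edges. By minimality of the colouring, its link then contains
  many transversal sets meeting each class, and the union bound embeds \<open>H\<close> with \<open>v\<close> in the role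
  of \<open>x\<close>.\<close>

section \<open>Elementary symmetric sums and transversal sets\<close>

text \<open>Bad edges outnumber missing transversal sets because \<open>G\<close> beats the Turan
  graph, and no colouring has more transversal sets than that graph has edges. So both numbers are
  small, and their common bound \<epsilon> n^r can be fixed after all other constants. Classes are
  linear because a class that is too small would cost the transversal count a positive density.

  The obstacle is a vertex \<open>w\<close> in many missing sets: no complete transversal structure
  may contain it, so only its link is known. The degree hypothesis on \<open>F\<close> is what makes
  the link enough. In the copy of \<open>H\<close>, the edges at \<open>x\<close> are the one edge
  of \<open>F\<close> through it, if there is one, and pad edges; they meet pairwise only in
  \<open>x\<close>. Such a sunflower needs nothing but disjoint link sets of \<open>w\<close>
  through prescribed colours. Bad edges at \<open>w\<close> supply link sets through its own class;
  moving \<open>w\<close> to another class may not lower the number of bad edges, so every class is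
  hit as often.

  Both embeddings rest on one count: a positive proportion of functions cannot be exhausted by the
  few that repeat a value or hit a forbidden set.\<close>

definition elem_sym :: "'i set \<Rightarrow> ('i \<Rightarrow> 'r::comm_semiring_1) \<Rightarrow> nat \<Rightarrow> 'r" where
  "elem_sym W a k = (\<Sum>T | T \<subseteq> W \<and> card T = k. \<Prod>t\<in>T. a t)"

definition rainbow :: "'v set \<Rightarrow> ('v \<Rightarrow> nat) \<Rightarrow> nat \<Rightarrow> 'v set set" where
  "rainbow V c k = {e. e \<subseteq> V \<and> card e = k \<and> inj_on c e}"

lemma elem_sym_cong: "(\<And>t. t \<in> W \<Longrightarrow> a t = b t) \<Longrightarrow> elem_sym W a k = elem_sym W b k"
  unfolding elem_sym_def by (intro sum.cong prod.cong) auto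

lemma elem_sym_0: "finite W \<Longrightarrow> elem_sym W a 0 = 1"
proof -
  assume "finite W"
  then have "{T. T \<subseteq> W \<and> card T = 0} = {{}}" by (auto dest: finite_subset)
  then show ?thesis by (simp add: elem_sym_def)
qed

lemma elem_sym_insert:
  assumes "finite W" "i \<notin> W"
  shows "elem_sym (insert i W) a (Suc k) = elem_sym W a (Suc k) + a i * elem_sym W a k"
proof -
  let ?A = "{T. T \<subseteq> W \<and> card T = Suc k}" and ?B = "{T. T \<subseteq> W \<and> card T = k}"
  have fin: "finite ?A" "finite ?B" using assms by auto
  have eq: "{T. T \<subseteq> insert i W \<and> card T = Suc k} = ?A \<union> insert i ` ?B" (is "?L = ?R")
  proof
    show "?L \<subseteq> ?R"
    proof
      fix T assume T: "T \<in> ?L"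
      then have fT: "finite T" using assms by (auto dest: finite_subset)
      show "T \<in> ?R"
      proof (cases "i \<in> T")
        case True
        then have "T = insert i (T - {i})" "T - {i} \<in> ?B" using T fT by auto
        then show ?thesis by blast
      next
        case False then show ?thesis using T by auto
      qed
    qed
    show "?R \<subseteq> ?L" using assms by (auto dest: finite_subset intro!: card_insert_disjoint)
  qed
  have inj: "inj_on (insert i) ?B"
    using assms(2) by (intro inj_onI) (metis (lifting) insert_ident mem_Collect_eq subsetD)
  have "(\<Sum>T\<in>insert i ` ?B. \<Prod>t\<in>T. a t) = (\<Sum>T\<in>?B. \<Prod>t\<in>insert i T. a t)"
    using inj by (simp add: sum.reindex)
  also have "\<dots> = (\<Sum>T\<in>?B. a i * (\<Prod>t\<in>T. a t))"
  proof (rule sum.cong[OF refl])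
    fix T assume "T \<in> ?B"
    then have "finite T" "i \<notin> T" using assms finite_subset by auto
    then show "(\<Prod>t\<in>insert i T. a t) = a i * (\<Prod>t\<in>T. a t)" by simp
  qed
  finally have B: "(\<Sum>T\<in>insert i ` ?B. \<Prod>t\<in>T. a t) = a i * elem_sym W a k"
    by (simp add: elem_sym_def sum_distrib_left)
  have "?A \<inter> insert i ` ?B = {}" using assms by auto
  then show ?thesis
    unfolding elem_sym_def[of "insert i W"] eq
    using fin B by (simp add: sum.union_disjoint elem_sym_def)
qed

lemma elem_sym_nonneg:
  fixes a :: "'i \<Rightarrow> 'r::linordered_idom"
  assumes "\<And>t. t \<in> W \<Longrightarrow> 0 \<le> a t"
  shows "0 \<le> elem_sym W a k"
  unfolding elem_sym_def
proof (rule sum_nonneg, rule prod_nonneg)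
  fix T t assume "T \<in> {T. T \<subseteq> W \<and> card T = k}" "t \<in> T"
  then show "0 \<le> a t" using assms[of t] by blast
qed

lemma elem_sym_const:
  "finite W \<Longrightarrow> elem_sym W (\<lambda>_. x) k = of_nat (card W choose k) * x ^ k"
  unfolding elem_sym_def by (simp add: n_subsets)

lemma elem_sym_mono:
  fixes a b :: "'i \<Rightarrow> 'r::linordered_idom"
  assumes "\<And>t. t \<in> W \<Longrightarrow> 0 \<le> a t \<and> a t \<le> b t"
  shows "elem_sym W a k \<le> elem_sym W b k"
  unfolding elem_sym_def
proof (rule sum_mono, rule prod_mono)
  fix T t assume "T \<in> {T. T \<subseteq> W \<and> card T = k}" "t \<in> T"
  then show "0 \<le> a t \<and> a t \<le> b t" using assms[of t] by blast
qed

text \<open>As a polynomial in \<open>a i\<close> and \<open>a j\<close> alone, an elementary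
  symmetric sum depends only on their sum and their product, with nonnegative coefficients. Moving
  \<open>d\<close> from the larger to the smaller entry keeps the sum and does not lower the
  product.\<close>

lemma elem_sym_shift:
  fixes a :: "'i \<Rightarrow> 'r::linordered_idom"
  assumes "finite W" "i \<in> W" "j \<in> W" "i \<noteq> j" and nn: "\<And>t. t \<in> W \<Longrightarrow> 0 \<le> a t"
    and d: "0 \<le> d" "a j + d \<le> a i"
  shows "elem_sym W a k \<le> elem_sym W (a(i := a i - d, j := a j + d)) k"
proof -
  let ?b = "a(i := a i - d, j := a j + d)"
  define U where "U = W - {i, j}"
  have W: "W = insert i (insert j U)" and U: "finite U" "i \<notin> insert j U" "j \<notin> U"
    using assms by (auto simp: U_def)
  have same: "elem_sym U ?b l = elem_sym U a l" for l
    using U by (intro elem_sym_cong) auto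
  have prod: "a i * a j \<le> (a i - d) * (a j + d)"
  proof -
    have "0 \<le> d * (a i - a j - d)" using d by (intro mult_nonneg_nonneg) auto
    then show ?thesis by (simp add: algebra_simps)
  qed
  have nnU: "0 \<le> elem_sym U a l" for l using nn W by (intro elem_sym_nonneg) auto
  consider "k = 0" | "k = 1" | l where "k = Suc (Suc l)"
    by (metis One_nat_def not0_implies_Suc)
  then show ?thesis
  proof cases
    case 1 then show ?thesis using assms(1) by (simp add: elem_sym_0)
  next
    case 2
    have e1: "elem_sym W f (Suc 0) = elem_sym U f (Suc 0) + f j + f i" for f :: "'i \<Rightarrow> 'r"
      unfolding W using U by (simp add: elem_sym_insert elem_sym_0 algebra_simps)
    show ?thesis using 2 \<open>i \<noteq> j\<close> e1[of a] e1[of ?b] same[of "Suc 0"] by simp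
  next
    case 3
    have e2: "elem_sym W f k = elem_sym U f k + (f i + f j) * elem_sym U f (Suc l)
        + (f i * f j) * elem_sym U f l" for f :: "'i \<Rightarrow> 'r"
      unfolding W 3 using U by (simp add: elem_sym_insert algebra_simps)
    have "(a i * a j) * elem_sym U a l \<le> ((a i - d) * (a j + d)) * elem_sym U a l"
      using prod nnU by (intro mult_right_mono) auto
    then show ?thesis using \<open>i \<noteq> j\<close> e2[of a] e2[of ?b] same by simp
  qed
qed

text \<open>The hypothesis on \<open>b\<close> is stated so that it covers both integer vectors whose entries differ
  by at most one and constant real vectors.\<close>

lemma elem_sym_le_balanced:
  fixes a b :: "'i \<Rightarrow> 'r::linordered_idom"
  assumes "finite W" and "\<And>t. t \<in> W \<Longrightarrow> 0 \<le> a t"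
    and "(\<Sum>t\<in>W. a t) = (\<Sum>t\<in>W. b t)"
    and b: "\<And>i j d. i \<in> W \<Longrightarrow> j \<in> W \<Longrightarrow> 0 < d \<Longrightarrow> b j \<le> b i + d"
    and bnn: "\<And>t. t \<in> W \<Longrightarrow> 0 \<le> b t"
  shows "elem_sym W a k \<le> elem_sym W b k"
  using assms(2,3)
proof (induction "card {t \<in> W. a t \<noteq> b t}" arbitrary: a rule: less_induct)
  case less
  show ?case
  proof (cases "\<forall>t\<in>W. a t = b t")
    case True then show ?thesis by (intro eq_refl elem_sym_cong) blast
  next
    case False
    have ex1: "\<exists>i\<in>W. b i < a i"
    proof (rule ccontr)
      assume "\<not> ?thesis"
      then have le: "\<And>t. t \<in> W \<Longrightarrow> a t \<le> b t" by force
      moreover obtain t where "t \<in> W" "a t < b t" using False le by (metis order_neq_le_trans)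
      ultimately have "sum a W < sum b W" using assms(1) by (intro sum_strict_mono_ex1) auto
      then show False using less.prems by simp
    qed
    have ex2: "\<exists>i\<in>W. a i < b i"
    proof (rule ccontr)
      assume "\<not> ?thesis"
      then have le: "\<And>t. t \<in> W \<Longrightarrow> b t \<le> a t" by force
      moreover obtain t where "t \<in> W" "b t < a t" using False le by (metis order_neq_le_trans)
      ultimately have "sum b W < sum a W" using assms(1) by (intro sum_strict_mono_ex1) auto
      then show False using less.prems by simp
    qed
    obtain i j where ij: "i \<in> W" "b i < a i" "j \<in> W" "a j < b j" using ex1 ex2 by auto
    then have "i \<noteq> j" by auto
    \<comment> \<open>The largest transfer that overshoots neither target: afterwards
      \<open>i\<close> or \<open>j\<close> agrees with \<open>b\<close>, so the number of
      disagreements drops. The shift is admissible because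
      \<open>a j + d \<le> b j \<le> b i + d \<le> a i\<close>, where the balance hypothesis is
      applied to this very \<open>d\<close>.\<close>
    define d where "d = min (a i - b i) (b j - a j)"
    have d: "0 < d" "d \<le> a i - b i" "d \<le> b j - a j" using ij by (auto simp: d_def)
    let ?a = "a(i := a i - d, j := a j + d)"
    have "a j + d \<le> a i" using b[OF ij(1,3) d(1)] d by linarith
    then have shift: "elem_sym W a k \<le> elem_sym W ?a k"
      using assms(1) ij \<open>i \<noteq> j\<close> less.prems d by (intro elem_sym_shift) auto
    have sum: "sum f W = f i + (f j + sum f (W - {i} - {j}))" for f :: "'i \<Rightarrow> 'r"
      using assms(1) ij \<open>i \<noteq> j\<close> by (simp add: sum.remove[of W i] sum.remove[of "W - {i}" j])
    have "sum ?a (W - {i} - {j}) = sum a (W - {i} - {j})" by (intro sum.cong) auto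
    then have sums: "sum ?a W = sum b W"
      using sum[of ?a] sum[of a] less.prems \<open>i \<noteq> j\<close> by simp
    have "a i - d = b i \<or> a j + d = b j" by (auto simp: d_def min_def)
    then obtain l where l: "l \<in> {i, j}" "?a l = b l" using \<open>i \<noteq> j\<close> by fastforce
    have "{t \<in> W. ?a t \<noteq> b t} \<subseteq> {t \<in> W. a t \<noteq> b t} - {l}"
    proof
      fix t assume t: "t \<in> {t \<in> W. ?a t \<noteq> b t}"
      then have "t \<noteq> l" using l by blast
      moreover have "a t \<noteq> b t"
      proof (cases "t = i \<or> t = j")
        case True
        then show ?thesis using ij by (metis less_irrefl)
      next
        case False
        then show ?thesis using t by simp
      qed
      ultimately show "t \<in> {t \<in> W. a t \<noteq> b t} - {l}" using t by blast
    qed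
    moreover have "l \<in> {t \<in> W. a t \<noteq> b t}" using l ij by force
    ultimately have "{t \<in> W. ?a t \<noteq> b t} \<subset> {t \<in> W. a t \<noteq> b t}" by blast
    then have "card {t \<in> W. ?a t \<noteq> b t} < card {t \<in> W. a t \<noteq> b t}"
      using assms(1) by (intro psubset_card_mono) auto
    moreover have "0 \<le> ?a t" if "t \<in> W" for t
    proof -
      have "0 \<le> a i - d" using d bnn[OF ij(1)] by linarith
      moreover have "0 \<le> a j + d" using d less.prems(1)[OF ij(3)] by linarith
      ultimately show ?thesis using less.prems(1)[OF that] by auto
    qed
    ultimately have "elem_sym W ?a k \<le> elem_sym W b k" using less.hyps sums by blast
    with shift show ?thesis by simp
  qed
qed

text \<open>The constant vector of the mean is balanced, so the previous lemma applies. Only a bound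
  \<open>s\<close> on the sum is assumed, since the inequality is used after one class has been left
  out.\<close>

lemma maclaurin_inequality:
  fixes a :: "'i \<Rightarrow> real"
  assumes "finite W" "W \<noteq> {}" and "\<And>t. t \<in> W \<Longrightarrow> 0 \<le> a t" and "sum a W \<le> s"
  shows "elem_sym W a k \<le> real (card W choose k) * (s / real (card W)) ^ k"
proof -
  let ?\<mu> = "sum a W / real (card W)"
  have s0: "0 \<le> sum a W" using assms by (intro sum_nonneg) auto
  have "elem_sym W a k \<le> elem_sym W (\<lambda>_. ?\<mu>) k"
    using assms s0 by (intro elem_sym_le_balanced) auto
  also have "\<dots> = real (card W choose k) * ?\<mu> ^ k" using assms by (simp add: elem_sym_const)
  also have "\<dots> \<le> real (card W choose k) * (s / real (card W)) ^ k"
    using assms s0 by (intro mult_left_mono power_mono divide_right_mono) auto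
  finally show ?thesis .
qed

section \<open>Counting transversal sets by class sizes, and comparison with the Turan graph\<close>

lemma bij_betw_transversals:
  "bij_betw (\<lambda>f. f ` T) (PiE T (\<lambda>t. {v \<in> V. c v = t})) {e. e \<subseteq> V \<and> inj_on c e \<and> c ` e = T}"
  (is "bij_betw ?F ?P ?E")
  unfolding bij_betw_def
proof
  show "inj_on ?F ?P"
  proof (rule inj_onI)
    fix f g assume f: "f \<in> ?P" and g: "g \<in> ?P" and eq: "f ` T = g ` T"
    show "f = g"
    proof (rule PiE_ext[OF f g])
      fix t assume t: "t \<in> T"
      then have "f t \<in> g ` T" using eq by blast
      then obtain s where s: "s \<in> T" "f t = g s" by auto
      then have "t = s" using f g t PiE_mem by fastforce
      then show "f t = g t" using s by simp
    qed
  qed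
  show "?F ` ?P = ?E"
  proof
    show "?E \<subseteq> ?F ` ?P"
    proof
      fix e assume "e \<in> ?E"
      then have e: "e \<subseteq> V" "inj_on c e" "c ` e = T" by auto
      let ?f = "restrict (inv_into e c) T"
      have "?f \<in> ?P"
        unfolding restrict_PiE_iff
      proof
        fix t assume "t \<in> T"
        then have "t \<in> c ` e" using e(3) by simp
        from inv_into_into[OF this] f_inv_into_f[OF this]
        show "inv_into e c t \<in> {v \<in> V. c v = t}" using e(1) by blast
      qed
      moreover have "?f ` T = e"
        using inv_into_image_cancel[OF e(2), of e] e(3) by (simp add: image_restrict_eq)
      ultimately show "e \<in> ?F ` ?P" by blast
    qed
    show "?F ` ?P \<subseteq> ?E"
    proof clarify
      fix f assume f: "f \<in> ?P"
      then have cf: "\<And>t. t \<in> T \<Longrightarrow> f t \<in> V \<and> c (f t) = t" by (auto dest: PiE_mem)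
      then have "inj_on c (f ` T)" by (intro inj_onI) (elim imageE, simp)
      moreover have "c ` f ` T = T" using cf by (simp add: image_image)
      ultimately show "f ` T \<subseteq> V \<and> inj_on c (f ` T) \<and> c ` f ` T = T" using cf by blast
    qed
  qed
qed

text \<open>Transversal sets are sorted by the set \<open>T\<close> of colours they use. Those with
  colour set \<open>T\<close> correspond to choice functions on \<open>T\<close>, so their number is
  a product of class sizes.\<close>

lemma card_rainbow:
  assumes "finite V" "c ` V \<subseteq> {..<m}"
  shows "card (rainbow V c k) = elem_sym {..<m} (\<lambda>t. card {v \<in> V. c v = t}) k"
proof -
  let ?\<T> = "{T. T \<subseteq> {..<m} \<and> card T = k}"
  define R where "R T = {e. e \<subseteq> V \<and> inj_on c e \<and> c ` e = T}" for T
  have fin: "finite (R T)" for T using assms by (simp add: R_def)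
  have Un: "rainbow V c k = (\<Union>T\<in>?\<T>. R T)"
    using assms(2) by (auto simp: rainbow_def R_def card_image) blast
  have "card (rainbow V c k) = (\<Sum>T\<in>?\<T>. card (R T))"
    unfolding Un using fin by (intro card_UN_disjoint) (auto simp: R_def)
  also have "\<dots> = (\<Sum>T\<in>?\<T>. \<Prod>t\<in>T. card {v \<in> V. c v = t})"
  proof (rule sum.cong[OF refl])
    fix T assume T: "T \<in> ?\<T>"
    then have finT: "finite T" using finite_subset by blast
    show "card (R T) = (\<Prod>t\<in>T. card {v \<in> V. c v = t})"
      unfolding R_def using bij_betw_same_card[OF bij_betw_transversals[of T V c]] finT
      by (simp add: card_PiE)
  qed
  finally show ?thesis by (simp add: elem_sym_def)
qed

lemma real_elem_sym_nat:
  "of_nat (elem_sym W a k) = (elem_sym W (\<lambda>t. of_nat (a t)) k :: 'r::comm_semiring_1)"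
  by (simp add: elem_sym_def)

lemma sum_card_classes:
  fixes c :: "'v \<Rightarrow> nat"
  assumes "finite V" "c ` V \<subseteq> {..<m}"
  shows "(\<Sum>t<m. card {v \<in> V. c v = t}) = card V"
proof -
  have "card V = card (\<Union>t<m. {v \<in> V. c v = t})"
    using assms by (intro arg_cong[where f = card]) auto
  also have "\<dots> = (\<Sum>t<m. card {v \<in> V. c v = t})"
    using assms(1) by (intro card_UN_disjoint) auto
  finally show ?thesis by simp
qed

lemma inj_on_iff_card_class_le_1:
  assumes "finite e" "c ` e \<subseteq> {..<m}"
  shows "inj_on c e \<longleftrightarrow> (\<forall>i<m. card {v \<in> e. c v = i} \<le> 1)"
proof -
  have "inj_on c e \<longleftrightarrow> (\<forall>i<m. \<forall>u\<in>{v \<in> e. c v = i}. \<forall>v\<in>{v \<in> e. c v = i}. u = v)"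
    using assms(2) unfolding inj_on_def by blast
  also have "\<dots> \<longleftrightarrow> (\<forall>i<m. card {v \<in> e. c v = i} \<le> 1)"
    using assms(1) by (subst One_nat_def, subst card_le_Suc0_iff_eq) auto
  finally show ?thesis .
qed

lemma edges_turan_graph:
  assumes "0 < m"
  shows "edges (turan_graph r n m) = rainbow {..<n} (\<lambda>v. v mod m) r"
proof -
  have "(\<forall>i<m. card (e \<inter> turan_part n m i) \<le> 1) \<longleftrightarrow> inj_on (\<lambda>v. v mod m) e"
    if "e \<subseteq> {..<n}" for e
  proof -
    have "e \<inter> turan_part n m i = {v \<in> e. v mod m = i}" for i
      using that by (auto simp: turan_part_def)
    then show ?thesis
      using that assms by (subst inj_on_iff_card_class_le_1[of _ _ m]) (auto dest: finite_subset)
  qed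
  then show ?thesis
    by (auto simp: turan_graph_def complete_partite_def rainbow_def)
qed

lemma turan_part_alt: "turan_part n m i = {v \<in> {..<n}. v mod m = i}"
  by (auto simp: turan_part_def)

lemma num_edges_turan_graph:
  assumes "0 < m"
  shows "num_edges (turan_graph r n m) = elem_sym {..<m} (\<lambda>t. card (turan_part n m t)) r"
  using assms unfolding num_edges_def edges_turan_graph[OF assms]
  by (subst card_rainbow[of _ _ m]) (auto simp: turan_part_alt)

text \<open>Class sizes are compared as integers: the balancing step subtracts, and an integer
  \<open>0 < d\<close> is at least 1, which is just the permitted difference between two Turan
  parts.\<close>

lemma card_rainbow_le_turan:
  assumes "finite V" "c ` V \<subseteq> {..<m}" "0 < m"
  shows "card (rainbow V c r) \<le> num_edges (turan_graph r (card V) m)"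
proof -
  let ?n = "card V"
  have sums: "(\<Sum>t<m. card (turan_part ?n m t)) = ?n"
    unfolding turan_part_alt
    using sum_card_classes[of "{..<?n}" "\<lambda>v. v mod m" m] assms(3) by fastforce
  have "elem_sym {..<m} (\<lambda>t. int (card {v \<in> V. c v = t})) r
      \<le> elem_sym {..<m} (\<lambda>t. int (card (turan_part ?n m t))) r"
  proof (rule elem_sym_le_balanced)
    show "(\<Sum>t<m. int (card {v \<in> V. c v = t})) = (\<Sum>t<m. int (card (turan_part ?n m t)))"
      using sum_card_classes[OF assms(1,2)] sums by (metis of_nat_sum)
    show "int (card (turan_part ?n m j)) \<le> int (card (turan_part ?n m i)) + d"
      if "i \<in> {..<m}" "j \<in> {..<m}" "0 < d" for i j d
      using that card_turan_part_bounds[of i m ?n] card_turan_part_bounds[of j m ?n] by simp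
  qed auto
  then have "int (card (rainbow V c r)) \<le> int (num_edges (turan_graph r ?n m))"
    using assms by (simp add: card_rainbow num_edges_turan_graph real_elem_sym_nat)
  then show ?thesis by simp
qed

text \<open>Every part has at least \<open>n div m \<ge> (n - m) / m\<close> vertices, and
  Bernoulli's inequality expands \<open>(1 - m / n) ^ r\<close>. For \<open>n < m\<close> the
  left-hand side is at most 0.\<close>

lemma num_edges_turan_graph_ge:
  assumes "0 < m" "0 < r"
  shows "real (m choose r) / real m ^ r * real n ^ r
      - real (m choose r) / real m ^ r * real r * real m * real n ^ (r - 1)
     \<le> real (num_edges (turan_graph r n m))"
proof (cases "n = 0")
  case True then have "real (m choose r) / real m ^ r * real n ^ r
      - real (m choose r) / real m ^ r * real r * real m * real n ^ (r - 1) \<le> 0"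
    using assms by (simp add: power_0_left)
  then show ?thesis using of_nat_0_le_iff order_trans by blast
next
  case False
  let ?D = "real (m choose r) / real m ^ r"
  have "elem_sym {..<m} (\<lambda>t. real (n div m)) r \<le> elem_sym {..<m} (\<lambda>t. real (card (turan_part n m t))) r"
    using card_turan_part_bounds(1) by (intro elem_sym_mono) auto
  then have 1: "real (m choose r) * real (n div m) ^ r \<le> real (num_edges (turan_graph r n m))"
    using assms by (simp add: elem_sym_const num_edges_turan_graph real_elem_sym_nat)
  have pow: "real n ^ r = real n * real n ^ (r - 1)" using assms by (cases r) auto
  show ?thesis
  proof (cases "m \<le> n")
    case True
    have "real n = real m * real (n div m) + real (n mod m)"
      by (metis of_nat_add of_nat_mult mult_div_mod_eq)
    moreover have "real (n mod m) \<le> real m" using assms by (simp add: less_imp_le)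
    ultimately have "(real n - real m) / real m \<le> real (n div m)"
      using assms by (simp add: field_simps)
    then have "((real n - real m) / real m) ^ r \<le> real (n div m) ^ r"
      using True assms by (intro power_mono) auto
    then have "real (m choose r) * ((real n - real m) / real m) ^ r \<le> real (m choose r) * real (n div m) ^ r"
      by (intro mult_left_mono) auto
    moreover have "real (m choose r) * ((real n - real m) / real m) ^ r = ?D * (real n - real m) ^ r"
      by (simp add: power_divide)
    moreover have "?D * (real n ^ r - real r * real m * real n ^ (r-1)) \<le> ?D * (real n - real m) ^ r"
    proof (rule mult_left_mono)
      have "1 + real r * (- (real m / real n)) \<le> (1 + (- (real m / real n))) ^ r"
        using True False by (intro Bernoulli_inequality) (auto simp: field_simps)
      then have "real n ^ r * (1 + real r * (- (real m / real n)))
          \<le> real n ^ r * (1 + (- (real m / real n))) ^ r" by (intro mult_left_mono) auto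
      also have "\<dots> = (real n - real m) ^ r"
        using False by (simp add: power_mult_distrib[symmetric] field_simps)
      finally show "real n ^ r - real r * real m * real n ^ (r-1) \<le> (real n - real m) ^ r"
        using False pow by (simp add: algebra_simps)
    qed simp
    ultimately show ?thesis using 1 by (simp add: algebra_simps)
  next
    case False
    have "real n * real n ^ (r-1) \<le> real r * real m * real n ^ (r-1)"
    proof (rule mult_right_mono)
      have "real n \<le> 1 * real m" using False by simp
      also have "\<dots> \<le> real r * real m" using assms by (intro mult_right_mono) auto
      finally show "real n \<le> real r * real m" .
    qed simp
    then have "?D * real n ^ r \<le> ?D * (real r * real m * real n ^ (r-1))"
      unfolding pow by (intro mult_left_mono) auto
    then have "?D * real n ^ r - ?D * real r * real m * real n ^ (r - 1) \<le> 0"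
      by (simp add: algebra_simps)
    then show ?thesis using of_nat_0_le_iff order_trans by blast
  qed
qed

section \<open>The density lost when a colour class is small\<close>

lemma Bernoulli_strict:
  fixes q :: real
  assumes "0 < q" "q < 1" "2 \<le> r"
  shows "1 - real r * q < (1 - q) ^ r"
  using assms(3)
proof (induction r rule: dec_induct)
  case base
  have "0 < q * q" using assms by simp
  then show ?case by (simp add: power2_eq_square algebra_simps)
next
  case (step k)
  have "(1 - real k * q) * (1 - q) < (1 - q) ^ k * (1 - q)"
    using step assms by (intro mult_strict_right_mono) auto
  moreover have "1 - real (Suc k) * q \<le> (1 - real k * q) * (1 - q)"
    using assms by (simp add: algebra_simps)
  ultimately show ?case by (simp add: mult.commute)
qed

text \<open>Passing from \<open>m\<close> to \<open>m - 1\<close> parts multiplies the numerator by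
  \<open>1 - r / m\<close> and the denominator by \<open>(1 - 1 / m) ^ r\<close>, which is strictly
  larger by Bernoulli. This gap is the source of the density \<open>\<xi>\<close> below.\<close>

lemma turan_density_strict_mono:
  assumes "2 \<le> r" "r \<le> m"
  shows "real (m - 1 choose r) / real (m - 1) ^ r < real (m choose r) / real m ^ r"
proof -
  have m: "0 < real m" "0 < real (m - 1)" "real (m - 1) = real m - 1" using assms by auto
  have "real m * real (m - 1 choose r) = (real m - real r) * real (m choose r)"
  proof (cases "r = m")
    case True
    then show ?thesis using assms by (simp add: binomial_eq_0)
  next
    case False
    then have "r \<le> m - 1" using assms by simp
    then have "m * (m - 1 choose r) = (m - r) * (m choose r)"
      using binomial_absorb_comp[of m r] by simp
    then show ?thesis using assms by (metis of_nat_diff of_nat_mult)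
  qed
  then have eq: "real (m - 1 choose r) = (1 - real r * (1 / real m)) * real (m choose r)"
    using m by (simp add: field_simps)
  have ch: "0 < real (m choose r)" using assms by simp
  have "1 - real r * (1 / real m) < (1 - 1 / real m) ^ r"
    using assms by (intro Bernoulli_strict) auto
  also have "\<dots> = real (m - 1) ^ r / real m ^ r"
    using m by (simp add: field_simps flip: power_divide)
  finally have "real (m - 1 choose r) < real (m - 1) ^ r / real m ^ r * real (m choose r)"
    unfolding eq using ch by (rule mult_strict_right_mono)
  then show ?thesis using m by (simp add: field_simps)
qed

text \<open>A transversal set either avoids class \<open>j\<close>, and then lives on
  \<open>m - 1\<close> classes with their smaller density, or spends one vertex in it, which
  accounts for at most \<open>\<eta> * Q * n ^ r\<close> sets. The choice of \<open>\<eta>\<close>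
  lets the second kind use up at most half of the gap \<open>D - D'\<close>; the other half is
  \<open>\<xi>\<close>.\<close>

lemma rainbow_small_class:
  assumes "2 \<le> r" "r \<le> m"
  obtains \<eta> \<xi> :: real where "0 < \<eta>" "0 < \<xi>"
    "\<And>(V :: 'v set) c j. finite V \<Longrightarrow> c ` V \<subseteq> {..<m} \<Longrightarrow> j < m \<Longrightarrow>
       real (card {v \<in> V. c v = j}) < \<eta> * real (card V) \<Longrightarrow>
       real (card (rainbow V c r)) \<le> (real (m choose r) / real m ^ r - \<xi>) * real (card V) ^ r"
proof -
  define D where "D = real (m choose r) / real m ^ r"
  define D' where "D' = real (m - 1 choose r) / real (m - 1) ^ r"
  define Q where "Q = real (m - 1 choose (r - 1)) / real (m - 1) ^ (r - 1)"
  have DD: "0 < D - D'" unfolding D_def D'_def using turan_density_strict_mono[OF assms] by simp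
  have Q: "0 \<le> Q" by (simp add: Q_def)
  define \<eta> where "\<eta> = (D - D') / (2 * (Q + 1))"
  define \<xi> where "\<xi> = (D - D') / 2"
  have \<eta>: "0 < \<eta>" "\<eta> * Q \<le> (D - D') / 2"
  proof -
    show "0 < \<eta>" using DD Q by (simp add: \<eta>_def)
    have "\<eta> * Q \<le> ((D - D') / (2 * (Q + 1))) * (Q + 1)"
      using DD Q by (intro mult_mono) (auto simp: \<eta>_def)
    also have "\<dots> = (D - D') / 2" using Q by (simp add: divide_simps)
    finally show "\<eta> * Q \<le> (D - D') / 2" .
  qed
  have main: "real (card (rainbow V c r)) \<le> (D - \<xi>) * real (card V) ^ r"
    if V: "finite V" "c ` V \<subseteq> {..<m}" "j < m"
      and sm: "real (card {v \<in> V. c v = j}) < \<eta> * real (card V)" for V :: "'v set" and c j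
  proof -
    let ?n = "real (card V)"
    let ?a = "\<lambda>t. real (card {v \<in> V. c v = t})"
    define W where "W = {..<m} - {j}"
    have ins: "{..<m} = insert j W" and W: "finite W" "j \<notin> W" "card W = m - 1"
      using that by (auto simp: W_def)
    have W0: "W \<noteq> {}" using W assms by auto
    have "(\<Sum>t<m. ?a t) = ?n" using sum_card_classes[OF V(1,2)] by (metis of_nat_sum)
    then have sumW: "sum ?a W \<le> ?n" unfolding ins using W by simp
    have r: "r = Suc (r - 1)" using assms by simp
    have "real (card (rainbow V c r)) = elem_sym {..<m} ?a r"
      using V by (simp add: card_rainbow real_elem_sym_nat)
    also have "\<dots> = elem_sym W ?a r + ?a j * elem_sym W ?a (r - 1)"
      unfolding ins using elem_sym_insert[OF W(1,2), of ?a "r - 1"] r by simp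
    also have "\<dots> \<le> real (card W choose r) * (?n / real (card W)) ^ r
        + (\<eta> * ?n) * (real (card W choose (r - 1)) * (?n / real (card W)) ^ (r - 1))"
      using sm W W0 sumW \<eta> by (intro add_mono mult_mono maclaurin_inequality elem_sym_nonneg) auto
    also have "\<dots> = D' * ?n ^ r + \<eta> * Q * (?n * ?n ^ (r - 1))"
      unfolding W by (simp add: D'_def Q_def power_divide)
    also have "?n * ?n ^ (r - 1) = ?n ^ r" using r by (metis power_Suc)
    also have "D' * ?n ^ r + \<eta> * Q * ?n ^ r \<le> D' * ?n ^ r + (D - D') / 2 * ?n ^ r"
      using \<eta> by (intro add_left_mono mult_right_mono) auto
    also have "\<dots> = (D - \<xi>) * ?n ^ r" by (simp add: \<xi>_def field_simps)
    finally show ?thesis .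
  qed
  show thesis
  proof (rule that)
    show "0 < \<eta>" by (fact \<eta>)
    show "0 < \<xi>" using DD by (simp add: \<xi>_def)
  qed (use main in \<open>simp add: D_def\<close>)
qed

section \<open>A union bound for transversal configurations\<close>

text \<open>At most \<open>k ^ 2\<close> pairs of indices may collide, each spoiling at most
  \<open>n ^ (k - 1)\<close> functions; \<open>large\<close> turns this into
  \<open>\<epsilon> * n ^ k\<close>. At most \<open>2 ^ k\<close> index sets \<open>J\<close> may
  land on a forbidden set: with \<open>s = card J\<close>, each of the at most
  \<open>\<epsilon> * n ^ s\<close> sets of size \<open>s\<close> spoils at most
  \<open>s ^ s * n ^ (k - s)\<close> functions. The powers of \<open>n\<close> combine to
  \<open>n ^ k\<close> for every \<open>s\<close>, which is why forbidden sets are bounded size by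
  size.\<close>

lemma union_bound:
  fixes V :: "'v set" and I :: "'i set" and \<epsilon> c :: real
  defines "n \<equiv> real (card V)" and "k \<equiv> card I"
  assumes V: "finite V" and I: "finite I" and \<Omega>: "\<Omega> \<subseteq> I \<rightarrow>\<^sub>E V"
    and \<M>: "\<And>S. S \<in> \<M> \<Longrightarrow> S \<subseteq> V \<and> S \<noteq> {}"
    and few: "\<And>s. 0 < s \<Longrightarrow> real (card {S \<in> \<M>. card S = s}) \<le> \<epsilon> * n ^ s"
    and large: "1 \<le> \<epsilon> * n"
    and c: "(2 ^ k * real k ^ k + real k ^ 2) * \<epsilon> < c" and card\<Omega>: "c * n ^ k \<le> real (card \<Omega>)"
  obtains h where "h \<in> \<Omega>" "inj_on h I" "\<And>J. J \<subseteq> I \<Longrightarrow> h ` J \<notin> \<M>"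
proof -
  have n: "0 < n" using large by (cases "n = 0") (auto simp: n_def)
  have \<epsilon>: "0 < \<epsilon>" using large n by (smt (verit) mult_nonpos_nonneg)
  have "finite \<M>" using \<M> V by (intro finite_subset[of \<M> "Pow V"]) auto
  define N where "N p = {h \<in> I \<rightarrow>\<^sub>E V. h (fst p) = h (snd p)}" for p
  \<comment> \<open>These functions map \<open>J\<close> into \<open>S\<close>, not necessarily onto
    it; the overcount is harmless and makes the cardinality a plain product.\<close>
  define A where "A J S = PiE I (\<lambda>i. if i \<in> J then S else V)" for J S
  define Q where "Q = {p \<in> I \<times> I. fst p \<noteq> snd p}"
  have finPiE: "finite (I \<rightarrow>\<^sub>E V)" using V I by (intro finite_PiE) auto
  have cardN: "real (card (N p)) \<le> \<epsilon> * n ^ k" if "p \<in> Q" for p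
  proof -
    obtain i j where p: "p = (i, j)" "i \<in> I" "j \<in> I" "i \<noteq> j"
      using \<open>p \<in> Q\<close> unfolding Q_def by force
    have k0: "0 < k" using I p(2) unfolding k_def card_gt_0_iff by blast
    let ?\<phi> = "\<lambda>h. restrict h (I - {i})"
    have "inj_on ?\<phi> (N p)"
    proof (rule inj_onI)
      fix g h assume g: "g \<in> N p" and h: "h \<in> N p" and eq: "?\<phi> g = ?\<phi> h"
      have "g \<in> I \<rightarrow>\<^sub>E V" "h \<in> I \<rightarrow>\<^sub>E V" using g h by (auto simp: N_def)
      then show "g = h"
      proof (rule PiE_ext)
        fix x assume "x \<in> I"
        have other: "g y = h y" if "y \<in> I" "y \<noteq> i" for y
          using fun_cong[OF eq, of y] that by simp
        show "g x = h x"
        proof (cases "x = i")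
          case True
          then show ?thesis using other[of j] p g h by (simp add: N_def)
        qed (use other \<open>x \<in> I\<close> in auto)
      qed
    qed
    moreover have "?\<phi> ` N p \<subseteq> (I - {i}) \<rightarrow>\<^sub>E V" unfolding N_def
      by (intro image_subsetI restrict_PiE_iff[THEN iffD2]) (auto dest: PiE_mem)
    ultimately have "card (N p) \<le> card ((I - {i}) \<rightarrow>\<^sub>E V)"
      using V I by (intro card_inj_on_le) (auto intro: finite_PiE)
    also have "\<dots> = card V ^ (k - 1)" using I p by (simp add: card_PiE k_def)
    finally have "real (card (N p)) \<le> n ^ (k - 1)" by (simp add: n_def flip: of_nat_power)
    also have "\<dots> \<le> (\<epsilon> * n) * n ^ (k - 1)" using large n by (simp add: mult_right_mono)
    also have "\<dots> = \<epsilon> * n ^ Suc (k - 1)" by simp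
    also have "Suc (k - 1) = k" using k0 by simp
    finally show ?thesis .
  qed
  have cardA: "real (card (\<Union>S\<in>{S \<in> \<M>. card S = card J}. A J S)) \<le> real k ^ k * \<epsilon> * n ^ k"
    if "J \<in> Pow I - {{}}" for J
  proof -
    let ?s = "card J"
    have J: "J \<subseteq> I" "finite J" "0 < ?s" "?s \<le> k"
      using that I finite_subset[of J I] card_mono[of I J] unfolding k_def
      by (auto simp: card_gt_0_iff)
    then have "1 \<le> k" by linarith
    have one: "card (A J S) = ?s ^ ?s * card V ^ (k - ?s)" if "S \<in> {S \<in> \<M>. card S = ?s}" for S
    proof -
      have "card (A J S) = (\<Prod>i\<in>I. if i \<in> J then card S else card V)"
        using I unfolding A_def by (subst card_PiE) (auto intro!: prod.cong)
      also have "\<dots> = card S ^ card J * card V ^ card (I - J)"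
        using I J by (simp add: prod.If_cases Int_absorb1 Diff_eq)
      also have "card (I - J) = k - ?s" using J by (simp add: card_Diff_subset k_def)
      finally show ?thesis using that by simp
    qed
    have "card (\<Union>S\<in>{S \<in> \<M>. card S = ?s}. A J S) \<le> (\<Sum>S\<in>{S \<in> \<M>. card S = ?s}. card (A J S))"
      using \<open>finite \<M>\<close> by (intro card_UN_le) auto
    also have "\<dots> = card {S \<in> \<M>. card S = ?s} * (?s ^ ?s * card V ^ (k - ?s))"
      using one by simp
    finally have "real (card (\<Union>S\<in>{S \<in> \<M>. card S = ?s}. A J S))
        \<le> real (card {S \<in> \<M>. card S = ?s} * (?s ^ ?s * card V ^ (k - ?s)))" by (rule of_nat_mono)
    also have "\<dots> = real (card {S \<in> \<M>. card S = ?s}) * (real ?s ^ ?s * n ^ (k - ?s))"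
      by (simp add: n_def)
    also have "\<dots> \<le> (\<epsilon> * n ^ ?s) * (real k ^ k * n ^ (k - ?s))"
    proof (intro mult_mono few)
      have "real ?s ^ ?s \<le> real k ^ ?s" using J by (intro power_mono) auto
      also have "\<dots> \<le> real k ^ k" using J \<open>1 \<le> k\<close> by (intro power_increasing) auto
      finally show "real ?s ^ ?s \<le> real k ^ k" .
    qed (use J n \<epsilon> in auto)
    also have "\<dots> = real k ^ k * \<epsilon> * (n ^ ?s * n ^ (k - ?s))" by simp
    also have "n ^ ?s * n ^ (k - ?s) = n ^ k" using J by (simp flip: power_add)
    finally show ?thesis .
  qed
  have "\<exists>h\<in>\<Omega>. inj_on h I \<and> (\<forall>J\<subseteq>I. h ` J \<notin> \<M>)"
  proof (rule ccontr)
    assume no: "\<not> ?thesis"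
    have "\<Omega> \<subseteq> (\<Union>p\<in>Q. N p) \<union> (\<Union>J\<in>Pow I - {{}}. \<Union>S\<in>{S \<in> \<M>. card S = card J}. A J S)"
      (is "_ \<subseteq> ?U \<union> ?W")
    proof
      fix h assume h: "h \<in> \<Omega>"
      show "h \<in> ?U \<union> ?W"
      proof (cases "inj_on h I")
        case True
        then obtain J where J: "J \<subseteq> I" "h ` J \<in> \<M>" using no h by blast
        have "J \<noteq> {}" using J \<M> by blast
        moreover have "card (h ` J) = card J" using True J by (meson card_image inj_on_subset)
        moreover have "h \<in> A J (h ` J)" using h \<Omega> J by (auto simp: A_def PiE_iff)
        ultimately show ?thesis using J by blast
      next
        case False
        then obtain i j where "i \<in> I" "j \<in> I" "i \<noteq> j" "h i = h j" by (auto simp: inj_on_def)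
        then have "(i, j) \<in> Q" "h \<in> N (i, j)" using h \<Omega> by (auto simp: Q_def N_def)
        then show ?thesis by blast
      qed
    qed
    moreover have "?U \<subseteq> I \<rightarrow>\<^sub>E V" by (auto simp: N_def)
    moreover have "?W \<subseteq> I \<rightarrow>\<^sub>E V" 
    proof (intro UN_least)
      fix J :: "'i set" and S assume "S \<in> {S \<in> \<M>. card S = card J}"
      then have "S \<subseteq> V" using \<M> by blast
      then show "A J S \<subseteq> I \<rightarrow>\<^sub>E V" unfolding A_def by (intro PiE_mono) simp
    qed
    ultimately have "card \<Omega> \<le> card (?U \<union> ?W)"
      using finPiE by (intro card_mono) (auto intro: finite_subset)
    also have "\<dots> \<le> card ?U + card ?W" by (rule card_Un_le)
    finally have "real (card \<Omega>) \<le> real (card ?U) + real (card ?W)" by linarith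
    moreover have "real (card ?U) \<le> real k ^ 2 * (\<epsilon> * n ^ k)"
    proof -
      have finQ: "finite Q" using I by (simp add: Q_def)
      have "card Q \<le> k ^ 2"
        using card_mono[of "I \<times> I" Q] I by (auto simp: Q_def k_def card_cartesian_product power2_eq_square)
      have "real (card ?U) \<le> (\<Sum>p\<in>Q. real (card (N p)))"
        using of_nat_mono[OF card_UN_le[OF finQ, of N]] by simp
      also have "\<dots> \<le> real (card Q) * (\<epsilon> * n ^ k)" using cardN by (intro sum_bounded_above) auto
      also have "\<dots> \<le> real (k ^ 2) * (\<epsilon> * n ^ k)"
        using \<open>card Q \<le> k ^ 2\<close> \<epsilon> n by (intro mult_right_mono) auto
      finally show ?thesis by simp
    qed
    moreover have "real (card ?W) \<le> 2 ^ k * (real k ^ k * \<epsilon> * n ^ k)"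
    proof -
      let ?P = "Pow I - {{}}"
      have finP: "finite ?P" using I by simp
      have "card ?P \<le> 2 ^ k" using card_mono[of "Pow I" ?P] I by (auto simp: card_Pow k_def)
      then have cP: "real (card ?P) \<le> 2 ^ k" using of_nat_mono[of "card ?P" "2 ^ k"] by simp
      have "real (card ?W) \<le> (\<Sum>J\<in>?P. real (card (\<Union>S\<in>{S \<in> \<M>. card S = card J}. A J S)))"
        using of_nat_mono[OF card_UN_le[OF finP]] by simp
      also have "\<dots> \<le> real (card ?P) * (real k ^ k * \<epsilon> * n ^ k)"
        using cardA by (intro sum_bounded_above) auto
      also have "\<dots> \<le> 2 ^ k * (real k ^ k * \<epsilon> * n ^ k)"
        using cP \<epsilon> n by (intro mult_right_mono) auto
      finally show ?thesis .
    qed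
    ultimately have "real (card \<Omega>) \<le> ((2 ^ k * real k ^ k + real k ^ 2) * \<epsilon>) * n ^ k"
      by (simp add: algebra_simps)
    also have "\<dots> < c * n ^ k" using c n by (intro mult_strict_right_mono) auto
    finally show False using card\<Omega> by simp
  qed
  then show thesis using that by blast
qed

text \<open>Rows are partial or full transversals to be chosen simultaneously, each from its own
  family of proportion \<open>\<gamma>\<close>. They are flattened into one function on pairs of a
  row and a colour, and the proportions multiply to \<open>\<gamma> ^ card R\<close>. The constant
  is stated with \<open>K\<close>, an upper bound for the number of pairs, so that it is fixed
  before the colour sets \<open>T\<close> are known.\<close>

lemma union_bound_rows:
  fixes V :: "'v set" and R :: "'r set" and T :: "'r \<Rightarrow> nat set" and \<epsilon> \<gamma> :: real and m :: nat
  defines "n \<equiv> real (card V)" and "K \<equiv> card R * m"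
  assumes V: "finite V" and R: "finite R" and T: "\<And>\<rho>. \<rho> \<in> R \<Longrightarrow> T \<rho> \<subseteq> {..<m}"
    and \<Omega>: "\<And>\<rho>. \<rho> \<in> R \<Longrightarrow> \<Omega> \<rho> \<subseteq> T \<rho> \<rightarrow>\<^sub>E V"
    and card\<Omega>: "\<And>\<rho>. \<rho> \<in> R \<Longrightarrow> \<gamma> * n ^ card (T \<rho>) \<le> real (card (\<Omega> \<rho>))"
    and \<M>: "\<And>S. S \<in> \<M> \<Longrightarrow> S \<subseteq> V \<and> S \<noteq> {}"
    and few: "\<And>s. 0 < s \<Longrightarrow> real (card {S \<in> \<M>. card S = s}) \<le> \<epsilon> * n ^ s"
    and large: "1 \<le> \<epsilon> * n" and \<gamma>: "0 < \<gamma>"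
    and c: "(2 ^ K * real K ^ K + real K ^ 2) * \<epsilon> < \<gamma> ^ card R"
  obtains h where "\<And>\<rho>. \<rho> \<in> R \<Longrightarrow> h \<rho> \<in> \<Omega> \<rho>" "inj_on (\<lambda>(\<rho>, t). h \<rho> t) (Sigma R T)"
    "\<And>J. J \<subseteq> Sigma R T \<Longrightarrow> (\<lambda>(\<rho>, t). h \<rho> t) ` J \<notin> \<M>"
proof -
  have n: "0 < n" using large by (cases "n = 0") (auto simp: n_def)
  have \<epsilon>: "0 < \<epsilon>" using large n by (smt (verit) mult_nonpos_nonneg)
  let ?I = "Sigma R T"
  define u where "u h = restrict (\<lambda>(\<rho>, t). h \<rho> t) ?I" for h :: "'r \<Rightarrow> nat \<Rightarrow> 'v"
  have finT: "finite (T \<rho>)" if "\<rho> \<in> R" for \<rho> using T[OF that] finite_subset by blast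
  have finI: "finite ?I" using R finT by auto
  have inj: "inj_on u (PiE R \<Omega>)"
  proof (rule inj_onI)
    fix g h assume g: "g \<in> PiE R \<Omega>" and h: "h \<in> PiE R \<Omega>" and eq: "u g = u h"
    show "g = h"
    proof (rule PiE_ext[OF g h])
      fix \<rho> assume \<rho>: "\<rho> \<in> R"
      have "g \<rho> \<in> T \<rho> \<rightarrow>\<^sub>E V" "h \<rho> \<in> T \<rho> \<rightarrow>\<^sub>E V" using PiE_mem[OF g \<rho>] PiE_mem[OF h \<rho>] \<Omega>[OF \<rho>] by auto
      then show "g \<rho> = h \<rho>"
      proof (rule PiE_ext)
        fix t assume "t \<in> T \<rho>"
        then show "g \<rho> t = h \<rho> t" using fun_cong[OF eq, of "(\<rho>, t)"] \<rho> by (simp add: u_def)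
      qed
    qed
  qed
  have sub: "u ` PiE R \<Omega> \<subseteq> ?I \<rightarrow>\<^sub>E V"
  proof clarify
    fix h assume h: "h \<in> PiE R \<Omega>"
    show "u h \<in> ?I \<rightarrow>\<^sub>E V" unfolding u_def using PiE_mem[OF h] \<Omega> by (intro restrict_PiE_iff[THEN iffD2]) (fastforce dest: PiE_mem)
  qed
  have cardI: "card ?I = (\<Sum>\<rho>\<in>R. card (T \<rho>))" using R finT by simp
  have "\<gamma> ^ card R * n ^ card ?I = (\<Prod>\<rho>\<in>R. \<gamma> * n ^ card (T \<rho>))"
    unfolding cardI by (simp add: prod.distrib power_sum)
  also have "\<dots> \<le> (\<Prod>\<rho>\<in>R. real (card (\<Omega> \<rho>)))" using card\<Omega> \<gamma> n by (intro prod_mono) auto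
  also have "\<dots> = real (card (u ` PiE R \<Omega>))" using inj R by (simp add: card_image card_PiE)
  finally have big: "\<gamma> ^ card R * n ^ card ?I \<le> real (card (u ` PiE R \<Omega>))" .
  have kK: "card ?I \<le> K"
  proof -
    have "card ?I \<le> (\<Sum>\<rho>\<in>R. m)" unfolding cardI
      using T by (intro sum_mono) (metis card_lessThan card_mono finite_lessThan)
    then show ?thesis by (simp add: K_def)
  qed
  have "(2 ^ card ?I * real (card ?I) ^ card ?I + real (card ?I) ^ 2) * \<epsilon>
      \<le> (2 ^ K * real K ^ K + real K ^ 2) * \<epsilon>"
  proof (intro mult_right_mono add_mono mult_mono)
    have "card ?I ^ card ?I \<le> K ^ K"
    proof (cases "K = 0")
      case False
      have "card ?I ^ card ?I \<le> K ^ card ?I" using kK by (intro power_mono) auto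
      also have "\<dots> \<le> K ^ K" using kK False by (intro power_increasing) auto
      finally show ?thesis .
    qed (use kK in simp)
    then show "real (card ?I) ^ card ?I \<le> real K ^ K" using of_nat_mono by fastforce
  qed (use kK \<epsilon> in \<open>auto intro: power_mono power_increasing\<close>)
  then have c': "(2 ^ card ?I * real (card ?I) ^ card ?I + real (card ?I) ^ 2) * \<epsilon> < \<gamma> ^ card R"
    using c by linarith
  obtain h' where h': "h' \<in> u ` PiE R \<Omega>" "inj_on h' ?I" "\<And>J. J \<subseteq> ?I \<Longrightarrow> h' ` J \<notin> \<M>"
    using union_bound[OF V finI sub \<M> few[unfolded n_def] large[unfolded n_def] c' big[unfolded n_def]]
    by blast
  then obtain h where h: "h \<in> PiE R \<Omega>" "h' = u h" by auto
  have img: "h' ` J = (\<lambda>(\<rho>, t). h \<rho> t) ` J" if "J \<subseteq> ?I" for J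
    using that by (auto simp: h u_def image_iff) 
  have inj': "inj_on (\<lambda>(\<rho>, t). h \<rho> t) ?I"
    using h'(2) by (rule iffD1[OF inj_on_cong, rotated]) (auto simp: h u_def)
  show thesis
    by (rule that[of h]) (use h h'(3) img inj' in \<open>auto dest: PiE_mem\<close>)
qed

section \<open>Embedding the expanded hypergraph\<close>

lemma finite_H_core: "finite (verts F) \<Longrightarrow> finite (H_core F p)"
  by (simp add: H_core_def)

lemma card_H_core:
  assumes "finite (verts F)" "num_verts F \<le> p"
  shows "card (H_core F p) = p"
proof -
  have "card (H_core F p) = card (Orig ` verts F) + card ((Extra :: nat \<Rightarrow> 'a core_vertex) ` {num_verts F + 1..p})"
    unfolding H_core_def using assms(1) by (intro card_Un_disjoint) auto
  also have "\<dots> = num_verts F + (p - num_verts F)"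
    by (simp add: card_image inj_on_def num_verts_def)
  finally show ?thesis using assms(2) by simp
qed

lemma Orig_image_subset_H_core:
  assumes "r_graph r F" "e \<in> edges F"
  shows "Orig ` e \<subseteq> H_core F p"
  using assms unfolding r_graph_def H_core_def by (intro le_supI1 image_mono) simp

lemma uncovered_pairs_iff:
  "P \<in> uncovered_pairs F p \<longleftrightarrow>
     (\<exists>u\<in>H_core F p. \<exists>v\<in>H_core F p. u \<noteq> v \<and> P = {u, v} \<and> (\<forall>e\<in>edges F. \<not> P \<subseteq> Orig ` e))"
proof -
  have "(\<exists>a b. u = Orig a \<and> v = Orig b \<and> covered F a b) \<longleftrightarrow> (\<exists>e\<in>edges F. {u, v} \<subseteq> Orig ` e)"
    for u v :: "'a core_vertex"
    by (auto simp: covered_def)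
  then show ?thesis unfolding uncovered_pairs_def by (simp only: mem_Collect_eq) blast
qed

lemma uncovered_pairs_subset:
  assumes "P \<in> uncovered_pairs F p"
  shows "P \<subseteq> H_core F p" "card P = 2"
proof -
  obtain u v where uv: "u \<in> H_core F p" "v \<in> H_core F p" "u \<noteq> v" "P = {u, v}"
    using assms unfolding uncovered_pairs_iff by blast
  show "P \<subseteq> H_core F p" using uv(1,2,4) by simp
  show "card P = 2" using uv(3,4) by simp
qed

lemma finite_uncovered_pairs: "finite (verts F) \<Longrightarrow> finite (uncovered_pairs F p)"
  using uncovered_pairs_subset(1) finite_H_core
  by (metis Pow_iff finite_Pow_iff finite_subset subsetI)

lemma H_graph_covers_core:
  assumes "u \<in> H_core F p" "v \<in> H_core F p" "u \<noteq> v"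
  shows "\<exists>e\<in>edges (H_graph r F p). Core u \<in> e \<and> Core v \<in> e"
proof (cases "{u, v} \<in> uncovered_pairs F p")
  case True
  then have "Core ` {u, v} \<union> Pad {u, v} ` {..<r - 2} \<in> edges (H_graph r F p)"
    unfolding H_graph_def hypergraph.sel by (intro UnI2 imageI)
  then show ?thesis by (rule bexI[rotated]) simp
next
  case False
  then have "\<not> (\<forall>e\<in>edges F. \<not> {u, v} \<subseteq> Orig ` e)"
    using assms uncovered_pairs_iff by blast
  then obtain e where e: "e \<in> edges F" "u \<in> Orig ` e" "v \<in> Orig ` e" by blast
  have "Core ` Orig ` e \<in> edges (H_graph r F p)" using e(1) by (simp add: H_graph_def)
  moreover have "Core u \<in> Core ` Orig ` e" "Core v \<in> Core ` Orig ` e" using e(2,3) by auto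
  ultimately show ?thesis by (intro bexI conjI)
qed

text \<open>Bounds the number of vertices in use by a partial copy of \<open>H_graph\<close>: the
  core, and all \<open>r\<close> vertices of each pad edge. Core vertices may be counted repeatedly,
  which does no harm.\<close>

definition pad_bound :: "nat \<Rightarrow> 'a hypergraph \<Rightarrow> nat \<Rightarrow> nat" where
  "pad_bound r F p = p + r * card (uncovered_pairs F p)"

text \<open>Greedy choice. The edges for the pairs in \<open>U0\<close> are prescribed; the others
  are added one at a time, each avoiding outside its pair the set \<open>Z\<close> of everything in
  use, whose size never exceeds \<open>pad_bound\<close>.\<close>

lemma extend_pad_edges:
  fixes G :: "'b hypergraph"
  assumes F: "finite (verts F)" "num_verts F \<le> p" and G: "r_graph r G"
    and U0: "U0 \<subseteq> uncovered_pairs F p"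
    and e0: "\<And>P. P \<in> U0 \<Longrightarrow> e0 P \<in> edges G \<and> \<phi> ` P \<subseteq> e0 P \<and> (e0 P - \<phi> ` P) \<inter> \<phi> ` H_core F p = {}"
    and disj0: "\<And>P Q. P \<in> U0 \<Longrightarrow> Q \<in> U0 \<Longrightarrow> P \<noteq> Q \<Longrightarrow> (e0 P - \<phi> ` P) \<inter> (e0 Q - \<phi> ` Q) = {}"
    and rich: "\<And>P Z. P \<in> uncovered_pairs F p - U0 \<Longrightarrow> finite Z \<Longrightarrow> card Z \<le> pad_bound r F p
                \<Longrightarrow> \<exists>e\<in>edges G. \<phi> ` P \<subseteq> e \<and> (e - \<phi> ` P) \<inter> Z = {}"
  obtains \<epsilon> where
    "\<And>P. P \<in> uncovered_pairs F p \<Longrightarrow> \<epsilon> P \<in> edges G \<and> \<phi> ` P \<subseteq> \<epsilon> P \<and> (\<epsilon> P - \<phi> ` P) \<inter> \<phi> ` H_core F p = {}"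
    "\<And>P Q. P \<in> uncovered_pairs F p \<Longrightarrow> Q \<in> uncovered_pairs F p \<Longrightarrow> P \<noteq> Q
       \<Longrightarrow> (\<epsilon> P - \<phi> ` P) \<inter> (\<epsilon> Q - \<phi> ` Q) = {}"
proof -
  let ?U = "uncovered_pairs F p"
  let ?ok = "\<lambda>U \<epsilon>. (\<forall>P\<in>U. \<epsilon> P \<in> edges G \<and> \<phi> ` P \<subseteq> \<epsilon> P \<and> (\<epsilon> P - \<phi> ` P) \<inter> \<phi> ` H_core F p = {})
      \<and> (\<forall>P\<in>U. \<forall>Q\<in>U. P \<noteq> Q \<longrightarrow> (\<epsilon> P - \<phi> ` P) \<inter> (\<epsilon> Q - \<phi> ` Q) = {})"
  have finU: "finite ?U" using finite_uncovered_pairs F by blast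
  have "\<exists>\<epsilon>. ?ok (U0 \<union> D) \<epsilon>" if "finite D" "D \<subseteq> ?U - U0" for D
    using that
  proof (induction D rule: finite_induct)
    case empty
    show ?case using e0 disj0 by (intro exI[of _ e0]) auto
  next
    case (insert P D)
    then obtain \<epsilon> where \<epsilon>: "?ok (U0 \<union> D) \<epsilon>" by auto
    define Z where "Z = \<phi> ` H_core F p \<union> (\<Union>Q\<in>U0 \<union> D. \<epsilon> Q)"
    have edge: "finite (\<epsilon> Q) \<and> card (\<epsilon> Q) = r" if "Q \<in> U0 \<union> D" for Q
      using \<epsilon> that G by (meson finite_subset r_graph_def)
    have finUD: "finite (U0 \<union> D)" using U0 finU insert finite_subset by auto
    have "finite Z" unfolding Z_def using finite_H_core F edge finUD by blast
    moreover have "card Z \<le> pad_bound r F p"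
    proof -
      have "card Z \<le> card (\<phi> ` H_core F p) + card (\<Union>Q\<in>U0 \<union> D. \<epsilon> Q)"
        unfolding Z_def by (rule card_Un_le)
      also have "card (\<phi> ` H_core F p) \<le> p"
        using card_image_le[OF finite_H_core] card_H_core F by metis
      also have "card (\<Union>Q\<in>U0 \<union> D. \<epsilon> Q) \<le> (\<Sum>Q\<in>U0 \<union> D. card (\<epsilon> Q))"
        using finUD by (rule card_UN_le)
      also have "\<dots> = r * card (U0 \<union> D)" using edge by simp
      also have "card (U0 \<union> D) \<le> card ?U"
        using insert.prems U0 by (intro card_mono finU) auto
      finally show ?thesis unfolding pad_bound_def by simp
    qed
    ultimately obtain e where e: "e \<in> edges G" "\<phi> ` P \<subseteq> e" "(e - \<phi> ` P) \<inter> Z = {}"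
      using rich[of P Z] insert.prems by blast
    have P: "P \<notin> U0 \<union> D" using insert by auto
    have disj: "(e - \<phi> ` P) \<inter> (\<epsilon> Q - \<phi> ` Q) = {}" if "Q \<in> U0 \<union> D" for Q
      using e(3) that unfolding Z_def by blast
    have core: "(e - \<phi> ` P) \<inter> \<phi> ` H_core F p = {}" using e(3) unfolding Z_def by blast
    have "?ok (insert P (U0 \<union> D)) (\<epsilon>(P := e))"
      using \<epsilon> P e(1,2) disj core by (simp add: Int_commute)
    then show ?case by (intro exI[of _ "\<epsilon>(P := e)"]) simp
  qed
  from this[of "?U - U0"] obtain \<epsilon> where "?ok (U0 \<union> (?U - U0)) \<epsilon>" using finU by auto
  moreover have "U0 \<union> (?U - U0) = ?U" using U0 by blast
  ultimately show thesis using that by metis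
qed

text \<open>The criterion behind every embedding below asks only for images of the core and for
  edges of \<open>G\<close> over uncovered pairs. The pad vertices follow, since an edge over a pair
  has exactly \<open>r - 2\<close> further vertices and these may be named in any order.
  \<open>U0\<close> holds the pairs that need a particular edge.\<close>

lemma contains_H_graphI:
  fixes G :: "'b hypergraph"
  assumes r: "2 \<le> r" and F: "r_graph r F" "num_verts F \<le> p" and G: "r_graph r G"
    and \<phi>: "inj_on \<phi> (H_core F p)" "\<phi> ` H_core F p \<subseteq> verts G"
    and F_edges: "\<And>e. e \<in> edges F \<Longrightarrow> \<phi> ` Orig ` e \<in> edges G"
    and U0: "U0 \<subseteq> uncovered_pairs F p"
    and e0: "\<And>P. P \<in> U0 \<Longrightarrow> e0 P \<in> edges G \<and> \<phi> ` P \<subseteq> e0 P \<and> (e0 P - \<phi> ` P) \<inter> \<phi> ` H_core F p = {}"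
    and disj0: "\<And>P Q. P \<in> U0 \<Longrightarrow> Q \<in> U0 \<Longrightarrow> P \<noteq> Q \<Longrightarrow> (e0 P - \<phi> ` P) \<inter> (e0 Q - \<phi> ` Q) = {}"
    and rich: "\<And>P Z. P \<in> uncovered_pairs F p - U0 \<Longrightarrow> finite Z \<Longrightarrow> card Z \<le> pad_bound r F p
                \<Longrightarrow> \<exists>e\<in>edges G. \<phi> ` P \<subseteq> e \<and> (e - \<phi> ` P) \<inter> Z = {}"
  shows "contains_copy G (H_graph r F p)"
proof -
  let ?U = "uncovered_pairs F p"
  have finF: "finite (verts F)" using F by (simp add: r_graph_def)
  obtain \<epsilon> where
    \<epsilon>: "\<And>P. P \<in> ?U \<Longrightarrow> \<epsilon> P \<in> edges G \<and> \<phi> ` P \<subseteq> \<epsilon> P \<and> (\<epsilon> P - \<phi> ` P) \<inter> \<phi> ` H_core F p = {}"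
    and disj: "\<And>P Q. P \<in> ?U \<Longrightarrow> Q \<in> ?U \<Longrightarrow> P \<noteq> Q \<Longrightarrow> (\<epsilon> P - \<phi> ` P) \<inter> (\<epsilon> Q - \<phi> ` Q) = {}"
    using extend_pad_edges[OF finF F(2) G U0 e0 disj0 rich] by blast
  have "\<exists>b. bij_betw b {..<r - 2} (\<epsilon> P - \<phi> ` P)" if P: "P \<in> ?U" for P
  proof -
    have edge: "finite (\<epsilon> P)" "card (\<epsilon> P) = r" "\<epsilon> P \<subseteq> verts G"
      using \<epsilon>[OF P] G by (auto simp: r_graph_def intro: finite_subset)
    have "card (\<phi> ` P) = 2"
      using uncovered_pairs_subset[OF P] \<phi>(1) by (metis card_image inj_on_subset)
    then have "card (\<epsilon> P - \<phi> ` P) = r - 2"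
      using \<epsilon>[OF P] edge by (metis card_Diff_subset finite_subset)
    then show ?thesis using edge
      by (metis card_lessThan finite_Diff finite_lessThan finite_same_card_bij)
  qed
  then obtain b where b: "\<And>P. P \<in> ?U \<Longrightarrow> bij_betw (b P) {..<r - 2} (\<epsilon> P - \<phi> ` P)" by metis
  have bmem: "b P k \<in> \<epsilon> P - \<phi> ` P" if "P \<in> ?U" "k < r - 2" for P k
    using b[OF that(1)] that(2) by (auto simp: bij_betw_def)
  define f where "f x = (case x of Core y \<Rightarrow> \<phi> y | Pad P k \<Rightarrow> b P k)" for x
  have f_simps: "f (Core y) = \<phi> y" "f (Pad P k) = b P k" for y P k by (auto simp: f_def)
  have verts: "verts (H_graph r F p) = Core ` H_core F p \<union> (\<Union>P\<in>?U. Pad P ` {..<r - 2})"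
    by (simp add: H_graph_def)
  have "inj_on f (verts (H_graph r F p))"
  proof (rule inj_onI)
    fix x y assume xy: "x \<in> verts (H_graph r F p)" "y \<in> verts (H_graph r F p)" and eq: "f x = f y"
    have cp: "\<phi> w \<noteq> b P k" if "w \<in> H_core F p" "P \<in> ?U" "k < r - 2" for w P k
      using bmem[OF that(2,3)] \<epsilon>[OF that(2)] imageI[OF that(1), of \<phi>] by (metis disjoint_iff)
    have pp: "P = Q \<and> k = l" if "P \<in> ?U" "Q \<in> ?U" "k < r - 2" "l < r - 2" "b P k = b Q l" for P Q k l
    proof -
      have "P = Q" using disj[OF that(1,2)] bmem[OF that(1,3)] bmem[OF that(2,4)] that(5) by (metis disjoint_iff)
      moreover have "inj_on (b P) {..<r - 2}" using b that(1) by (auto simp: bij_betw_def)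
      ultimately show ?thesis using that by (auto simp: inj_on_def)
    qed
    consider u v where "x = Core u" "y = Core v" "u \<in> H_core F p" "v \<in> H_core F p"
      | u Q l where "x = Core u" "y = Pad Q l" "u \<in> H_core F p" "Q \<in> ?U" "l < r - 2"
      | P k v where "x = Pad P k" "y = Core v" "v \<in> H_core F p" "P \<in> ?U" "k < r - 2"
      | P k Q l where "x = Pad P k" "y = Pad Q l" "P \<in> ?U" "k < r - 2" "Q \<in> ?U" "l < r - 2"
      using xy unfolding verts by blast
    then show "x = y"
    proof cases
      case 1 then show ?thesis using eq \<phi>(1) by (auto simp: f_simps inj_on_def)
    next
      case 2 then show ?thesis using eq cp by (metis f_simps)
    next
      case 3 then show ?thesis using eq cp by (metis f_simps)
    next
      case 4 then show ?thesis using eq pp by (metis f_simps(2))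
    qed
  qed
  moreover have "f ` verts (H_graph r F p) \<subseteq> verts G"
  proof -
    have "b P k \<in> verts G" if "P \<in> ?U" "k < r - 2" for P k
      using bmem[OF that] \<epsilon>[OF that(1)] G by (auto simp: r_graph_def)
    then show ?thesis using \<phi>(2) unfolding verts by (auto simp: f_simps)
  qed
  moreover have "f ` e \<in> edges G" if e: "e \<in> edges (H_graph r F p)" for e
  proof -
    consider d where "d \<in> edges F" "e = Core ` Orig ` d"
      | P where "P \<in> ?U" "e = Core ` P \<union> Pad P ` {..<r - 2}"
      using e by (auto simp: H_graph_def)
    then show ?thesis
    proof cases
      case 1
      then have "f ` e = \<phi> ` Orig ` d" by (simp add: image_image f_simps)
      then show ?thesis using F_edges 1 by simp
    next
      case 2
      have "f ` e = \<phi> ` P \<union> b P ` {..<r - 2}" unfolding 2 by (simp add: image_Un image_image f_simps)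
      also have "\<dots> = \<epsilon> P" using b[OF 2(1)] \<epsilon>[OF 2(1)] by (auto simp: bij_betw_def)
      finally show ?thesis using \<epsilon>[OF 2(1)] by simp
    qed
  qed
  ultimately show ?thesis unfolding contains_copy_def by blast
qed

text \<open>Unifies the two hypotheses on \<open>F\<close>. If \<open>F\<close> has at most
  \<open>m\<close> vertices, the core contains the extra vertex \<open>m + 1\<close>, which lies in
  no edge of \<open>F\<close>, and \<open>f = {x}\<close> is a placeholder; otherwise
  \<open>x\<close> is the vertex of degree 1 and \<open>f\<close> its only edge.\<close>

lemma H_core_low_degree_vertex:
  assumes "r \<le> m" "r_graph r F"
    and "num_verts F \<le> m \<or> (num_verts F = m + 1 \<and> (\<exists>v\<in>verts F. vertex_degree F v = 1))"
  obtains x f where "x \<in> H_core F (m + 1)" "x \<in> f"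
    "f = {x} \<or> f \<in> (`) Orig ` edges F"
    "\<And>e. e \<in> edges F \<Longrightarrow> x \<in> Orig ` e \<Longrightarrow> Orig ` e = f"
proof (cases "num_verts F \<le> m")
  case True
  show thesis by (rule that[of "Extra (m + 1)" "{Extra (m + 1)}"]) (use True in \<open>auto simp: H_core_def\<close>)
next
  case False
  then obtain v where v: "v \<in> verts F" "vertex_degree F v = 1" using assms by auto
  then obtain d where d: "{e \<in> edges F. v \<in> e} = {d}"
    unfolding vertex_degree_def by (meson card_1_singletonE)
  show thesis
  proof (rule that[of "Orig v" "Orig ` d"])
    show "Orig v \<in> H_core F (m + 1)" using v by (simp add: H_core_def)
    show "Orig ` e = Orig ` d" if "e \<in> edges F" "Orig v \<in> Orig ` e" for e
      using that d by blast
  qed (use d in blast)+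
qed

section \<open>Complete transversal structures and the two embeddings of
  \<open>H_graph\<close>\<close>

definition complete_on :: "'v set set \<Rightarrow> ('v \<Rightarrow> nat) \<Rightarrow> nat \<Rightarrow> 'v set \<Rightarrow> bool" where
  "complete_on E c r A \<longleftrightarrow> (\<forall>S\<subseteq>A. card S = r \<longrightarrow> inj_on c S \<longrightarrow> S \<in> E)"

text \<open>The consequence of having more than \<open>z\<close> disjoint transversals inside
  \<open>W\<close> that the embeddings rely on, in the form that suits the greedy choice of
  pads.\<close>

definition robustly_transversal :: "nat \<Rightarrow> ('v \<Rightarrow> nat) \<Rightarrow> nat \<Rightarrow> 'v set \<Rightarrow> bool" where
  "robustly_transversal z c m W \<longleftrightarrow>
     (\<forall>Z. finite Z \<longrightarrow> card Z \<le> z \<longrightarrow> (\<exists>a. \<forall>t<m. a t \<in> W - Z \<and> c (a t) = t))"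

text \<open>The two vertices are completed by \<open>r - 2\<close> vertices of other colours from a
  transversal that avoids \<open>Z\<close>; completeness makes the result an edge. This is the
  abundance of edges that the greedy choice asks for.\<close>

lemma robustly_transversal_edge:
  assumes r: "2 \<le> r" "r \<le> m" and A: "complete_on E c r A" "W \<subseteq> A" "p \<in> A" "q \<in> A"
    and W: "robustly_transversal z c m W"
    and pq: "c p \<noteq> c q" "c p < m" "c q < m" and Z: "finite Z" "card Z \<le> z"
  shows "\<exists>e\<in>E. {p, q} \<subseteq> e \<and> (e - {p, q}) \<inter> Z = {}"
proof -
  obtain a where a: "\<And>t. t < m \<Longrightarrow> a t \<in> W - Z \<and> c (a t) = t"
    using W Z unfolding robustly_transversal_def by blast
  have "r - 2 \<le> card ({..<m} - {c p, c q})" using pq r by simp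
  then obtain T where T: "T \<subseteq> {..<m} - {c p, c q}" "card T = r - 2" "finite T"
    by (meson obtain_subset_with_card_n)
  have cT: "c (a t) = t" "a t \<in> W - Z" "t \<noteq> c p" "t \<noteq> c q" if "t \<in> T" for t
    using a[of t] T that by auto
  have inja: "inj_on a T" using cT(1) by (metis inj_onI)
  have notin: "p \<notin> a ` T" "q \<notin> a ` T" using cT(1,3,4) by (metis imageE)+
  have "p \<noteq> q" using pq by auto
  let ?e = "insert p (insert q (a ` T))"
  have "card ?e = r"
    using T notin \<open>p \<noteq> q\<close> r by (simp add: card_image[OF inja])
  moreover have "inj_on c ?e"
  proof -
    have "inj_on c (a ` T)" using cT(1) by (auto simp: inj_on_def)
    moreover have "c ` a ` T = T" using cT(1) by (simp add: image_image)
    then have "c p \<notin> c ` a ` T" "c q \<notin> c ` a ` T" using cT(3,4) by auto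
    then have "c p \<notin> c ` (insert q (a ` T) - {p})" "c q \<notin> c ` (a ` T - {q})" using pq(1) by blast+
    ultimately show ?thesis by (simp add: inj_on_insert)
  qed
  moreover have "?e \<subseteq> A" using A cT(2) by auto
  ultimately have "?e \<in> E" using A(1) by (simp add: complete_on_def)
  moreover have "(?e - {p, q}) \<inter> Z = {}" using cT(2) by auto
  ultimately show ?thesis by (intro bexI[of _ ?e]) auto
qed

text \<open>The core has one vertex more than there are colours, and the bad edge pays for the
  collision: \<open>x\<close> and \<open>z\<close> take its two vertices of equal colour, the rest
  of the core takes one vertex of each other colour. Every edge of \<open>F\<close>, and every
  uncovered pair other than \<open>{x, z}\<close>, misses \<open>x\<close> or \<open>z\<close> and
  so lands in \<open>insert v W\<close> or \<open>insert u W\<close>, where transversal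
  \<open>r\<close>-sets are edges. The pair \<open>{x, z}\<close> is served by the bad edge
  itself.\<close>

lemma embed_bad_edge:
  fixes F :: "'a hypergraph" and G :: "'b hypergraph"
  assumes r: "2 \<le> r" "r \<le> m" and F: "r_graph r F" "num_verts F \<le> m + 1"
    and x: "x \<in> H_core F (m + 1)" "x \<in> f" "f = {x} \<or> f \<in> (`) Orig ` edges F"
    and only: "\<And>e. e \<in> edges F \<Longrightarrow> x \<in> Orig ` e \<Longrightarrow> Orig ` e = f"
    and G: "r_graph r G"
    and e: "e \<in> edges G" "u \<in> e" "v \<in> e" "u \<noteq> v" "c u = c v" "c u < m"
    and W: "W \<subseteq> verts G" "W \<inter> e = {}" "robustly_transversal (pad_bound r F (m + 1)) c m W"
    and cu: "complete_on (edges G) c r (insert u W)" and cv: "complete_on (edges G) c r (insert v W)"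
  shows "contains_copy G (H_graph r F (m + 1))"
proof -
  let ?C = "H_core F (m + 1)"
  have finF: "finite (verts F)" using F by (simp add: r_graph_def)
  have C: "finite ?C" "card ?C = m + 1" using finite_H_core[OF finF] card_H_core[OF finF F(2)] by auto
  have cardf: "card f \<le> r" and finf: "finite f"
  proof -
    have "card (Orig ` d) = r \<and> finite (Orig ` d)" if "d \<in> edges F" for d
      using that F by (auto simp: r_graph_def card_image inj_on_def intro: finite_subset)
    then show "card f \<le> r" "finite f" using x(3) r by auto
  qed
  \<comment> \<open>The core has \<open>m + 1 > r \<ge> card f\<close> vertices, so some
    \<open>z\<close> lies outside \<open>f\<close>. The pair \<open>{x, z}\<close> is then
    uncovered, since no edge of \<open>F\<close> through \<open>x\<close> differs from
    \<open>f\<close>.\<close>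
  have "\<not> ?C \<subseteq> f" using card_mono[OF finf, of ?C] C cardf r by auto
  then obtain z where z: "z \<in> ?C" "z \<notin> f" by auto
  then have "x \<noteq> z" using x by auto
  have "card (?C - {x, z}) = card ({..<m} - {c u})" using x z \<open>x \<noteq> z\<close> C e by simp
  then obtain \<sigma> where \<sigma>: "bij_betw \<sigma> (?C - {x, z}) ({..<m} - {c u})"
    using finite_same_card_bij C by (metis finite_Diff finite_lessThan)
  have \<sigma>m: "\<sigma> y < m" "\<sigma> y \<noteq> c u" if "y \<in> ?C" "y \<noteq> x" "y \<noteq> z" for y
    using bij_betwE[OF \<sigma>] that by auto
  have inj\<sigma>: "inj_on \<sigma> (?C - {x, z})" using \<sigma> by (simp add: bij_betw_def)
  have "\<exists>a. \<forall>t<m. a t \<in> W - {} \<and> c (a t) = t"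
    using W(3) unfolding robustly_transversal_def by (metis card.empty finite.emptyI zero_le)
  then obtain a where a: "\<And>t. t < m \<Longrightarrow> a t \<in> W" "\<And>t. t < m \<Longrightarrow> c (a t) = t" by blast
  define \<phi> where "\<phi> y = (if y = x then u else if y = z then v else a (\<sigma> y))" for y
  have \<phi>x: "\<phi> x = u" and \<phi>z: "\<phi> z = v" using \<open>x \<noteq> z\<close> by (auto simp: \<phi>_def)
  have \<phi>W: "\<phi> y \<in> W" "c (\<phi> y) = \<sigma> y" if "y \<in> ?C" "y \<noteq> x" "y \<noteq> z" for y
    using \<sigma>m[OF that] a that by (auto simp: \<phi>_def)
  have uvW: "u \<notin> W" "v \<notin> W" using W(2) e by auto
  have c\<phi>: "c (\<phi> y) < m" if "y \<in> ?C" for y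
    using that \<phi>W \<sigma>m e \<phi>x \<phi>z by (cases "y = x \<or> y = z") auto
  have c\<phi>_inj: "c (\<phi> y) \<noteq> c (\<phi> y')" if "y \<in> ?C" "y' \<in> ?C" "y \<noteq> y'" "{y, y'} \<noteq> {x, z}" for y y'
  proof -
    have same: "c (\<phi> w) = c u" if "w \<in> {x, z}" for w using that \<phi>x \<phi>z e(5) by auto
    have other: "c (\<phi> w) = \<sigma> w \<and> \<sigma> w \<noteq> c u" if "w \<in> ?C" "w \<notin> {x, z}" for w
      using \<phi>W(2)[of w] \<sigma>m(2)[of w] that by simp
    consider "y \<in> {x, z}" "y' \<in> {x, z}" | "y \<in> {x, z}" "y' \<notin> {x, z}"
      | "y \<notin> {x, z}" "y' \<in> {x, z}" | "y \<notin> {x, z}" "y' \<notin> {x, z}" by blast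
    then show ?thesis
    proof cases
      case 1
      then have "{y, y'} = {x, z}" using that(3) by auto
      then show ?thesis using that(4) by simp
    next
      case 2 then show ?thesis using same other that(2) by metis
    next
      case 3 then show ?thesis using same other that(1) by metis
    next
      case 4
      then have "\<sigma> y \<noteq> \<sigma> y'" using inj_on_contraD[OF inj\<sigma> that(3)] that(1,2) by blast
      then show ?thesis using 4 other that(1,2) by metis
    qed
  qed
  have inj\<phi>: "inj_on \<phi> ?C"
  proof (rule inj_onI, rule ccontr)
    fix y y' assume y: "y \<in> ?C" "y' \<in> ?C" "\<phi> y = \<phi> y'" "y \<noteq> y'"
    have "c (\<phi> y) = c (\<phi> y')" using y(3) by simp
    then have "{y, y'} = {x, z}" using c\<phi>_inj[OF y(1,2,4)] by blast
    then have "y = x \<and> y' = z \<or> y = z \<and> y' = x" by (simp only: doubleton_eq_iff)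
    then show False using y(3) \<phi>x \<phi>z e(4) by metis
  qed
  have one_of: "\<exists>A. complete_on (edges G) c r A \<and> W \<subseteq> A \<and> \<phi> ` D \<subseteq> A"
    if "D \<subseteq> ?C" "\<not> {x, z} \<subseteq> D" for D
  proof (cases "x \<in> D")
    case True
    then have "z \<notin> D" using that by simp
    then have "\<phi> ` D \<subseteq> insert u W" using that(1) \<phi>x by (intro image_subsetI) (metis \<phi>W(1) insert_iff subsetD)
    then show ?thesis using cu by blast
  next
    case False
    then have "\<phi> ` D \<subseteq> insert v W" using that(1) \<phi>z by (intro image_subsetI) (metis \<phi>W(1) insert_iff subsetD)
    then show ?thesis using cv by blast
  qed
  have xz: "{x, z} \<in> uncovered_pairs F (m + 1)"
  proof -
    have "\<forall>d\<in>edges F. \<not> {x, z} \<subseteq> Orig ` d"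
    proof (intro ballI notI)
      fix d assume d: "d \<in> edges F" "{x, z} \<subseteq> Orig ` d"
      then have "Orig ` d = f" using only by simp
      then show False using d z by simp
    qed
    then show ?thesis using x(1) z(1) \<open>x \<noteq> z\<close> unfolding uncovered_pairs_iff by blast
  qed
  have coreW: "\<phi> ` ?C \<subseteq> insert u (insert v W)"
  proof
    fix w assume "w \<in> \<phi> ` ?C"
    then obtain y where "y \<in> ?C" "w = \<phi> y" by blast
    then show "w \<in> insert u (insert v W)" using \<phi>W(1)[of y] \<phi>x \<phi>z by (metis insertCI)
  qed
  show ?thesis
  proof (rule contains_H_graphI[OF r(1) F G inj\<phi>, of "{{x, z}}" "\<lambda>_. e"])
    have "e \<subseteq> verts G" using e(1) G unfolding r_graph_def by blast
    then have "insert u (insert v W) \<subseteq> verts G" using W(1) e(2,3) by blast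
    then show "\<phi> ` ?C \<subseteq> verts G" using coreW by (rule order_trans[rotated])
    show "\<phi> ` Orig ` d \<in> edges G" if d: "d \<in> edges F" for d
    proof -
      have D: "Orig ` d \<subseteq> ?C" by (rule Orig_image_subset_H_core[OF F(1) d])
      have nxz: "\<not> {x, z} \<subseteq> Orig ` d"
      proof
        assume "{x, z} \<subseteq> Orig ` d"
        moreover from this have "Orig ` d = f" using only[OF d] by simp
        ultimately show False using z(2) by simp
      qed
      obtain A where A: "complete_on (edges G) c r A" "\<phi> ` Orig ` d \<subseteq> A" using one_of[OF D nxz] by blast
      have "card (\<phi> ` Orig ` d) = card (Orig ` d)" by (intro card_image inj_on_subset[OF inj\<phi> D])
      also have "\<dots> = r" using F(1) d by (simp add: card_image inj_on_def r_graph_def)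
      finally have "card (\<phi> ` Orig ` d) = r" .
      moreover have "inj_on c (\<phi> ` Orig ` d)"
      proof (rule inj_onI, rule ccontr)
        fix w w' assume w: "w \<in> \<phi> ` Orig ` d" "w' \<in> \<phi> ` Orig ` d" "c w = c w'" "w \<noteq> w'"
        obtain y where y: "y \<in> Orig ` d" "w = \<phi> y" using w(1) by (rule imageE)
        obtain y' where y': "y' \<in> Orig ` d" "w' = \<phi> y'" using w(2) by (rule imageE)
        have yy: "y \<in> ?C" "y' \<in> ?C" "y \<noteq> y'" using D y y' w(4) by auto
        have "c (\<phi> y) = c (\<phi> y')" using y(2) y'(2) w(3) by simp
        then have "{y, y'} = {x, z}" using c\<phi>_inj[OF yy] by blast
        then have "{x, z} \<subseteq> Orig ` d" using y(1) y'(1) by (metis empty_subsetI insert_subset)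
        then show False using nxz by simp
      qed
      ultimately show ?thesis using A by (simp add: complete_on_def)
    qed
    show "{{x, z}} \<subseteq> uncovered_pairs F (m + 1)" using xz by simp
    show "e \<in> edges G \<and> \<phi> ` P \<subseteq> e \<and> (e - \<phi> ` P) \<inter> \<phi> ` ?C = {}" if "P \<in> {{x, z}}" for P
    proof -
      have P: "\<phi> ` P = {u, v}" using that \<phi>x \<phi>z by simp
      have "(e - {u, v}) \<inter> \<phi> ` ?C = {}" using coreW W(2) by blast
      then show ?thesis unfolding P using e(1-3) by simp
    qed
    show "\<exists>d\<in>edges G. \<phi> ` P \<subseteq> d \<and> (d - \<phi> ` P) \<inter> Z = {}"
      if P: "P \<in> uncovered_pairs F (m + 1) - {{x, z}}" and Z: "finite Z" "card Z \<le> pad_bound r F (m + 1)" for P Z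
    proof -
      have "P \<in> uncovered_pairs F (m + 1)" using P by simp
      then obtain y y' where y: "y \<in> ?C" "y' \<in> ?C" "y \<noteq> y'" "P = {y, y'}"
        unfolding uncovered_pairs_iff by blast
      have ne: "{y, y'} \<noteq> {x, z}" using P y(4) by simp
      have "\<not> {x, z} \<subseteq> {y, y'}"
      proof
        assume "{x, z} \<subseteq> {y, y'}"
        then have "{x, z} = {y, y'}" using \<open>x \<noteq> z\<close> by auto
        then show False using ne by simp
      qed
      moreover have "{y, y'} \<subseteq> ?C" using y by simp
      ultimately obtain A where A: "complete_on (edges G) c r A" "W \<subseteq> A" "\<phi> ` {y, y'} \<subseteq> A"
        using one_of[of "{y, y'}"] by blast
      have "\<exists>d\<in>edges G. {\<phi> y, \<phi> y'} \<subseteq> d \<and> (d - {\<phi> y, \<phi> y'}) \<inter> Z = {}"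
      proof (rule robustly_transversal_edge[OF r A(1,2) _ _ W(3) _ _ _ Z])
        show "\<phi> y \<in> A" "\<phi> y' \<in> A" using A(3) by simp_all
        show "c (\<phi> y) < m" "c (\<phi> y') < m" using c\<phi> y(1,2) by simp_all
      qed (rule c\<phi>_inj[OF y(1-3) ne])
      then show ?thesis using y(4) by simp
    qed
  qed auto
qed

text \<open>All that is known about edges at \<open>w\<close> is that \<open>m\<close> disjoint link
  sets of \<open>w\<close> lie in \<open>W\<close>, the \<open>i\<close>-th one using colour
  \<open>i\<close>. With \<open>w\<close> as the image of \<open>x\<close>, link set 0 realises
  \<open>f\<close> when that is an edge, and link set \<open>i\<close> gives the pad edge for
  \<open>x\<close> and the core vertex of colour \<open>i\<close> outside \<open>f\<close>. All
  other edges stay inside the complete set \<open>W\<close>.\<close>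

lemma embed_link:
  fixes F :: "'a hypergraph" and G :: "'b hypergraph"
  assumes r: "2 \<le> r" "r \<le> m" and F: "r_graph r F" "num_verts F \<le> m + 1"
    and x: "x \<in> H_core F (m + 1)" "x \<in> f" "f = {x} \<or> f \<in> (`) Orig ` edges F"
    and only: "\<And>e. e \<in> edges F \<Longrightarrow> x \<in> Orig ` e \<Longrightarrow> Orig ` e = f"
    and G: "r_graph r G"
    and W: "W \<subseteq> verts G" "complete_on (edges G) c r W" "robustly_transversal (pad_bound r F (m + 1)) c m W"
    and w: "w \<in> verts G" "w \<notin> W"
    and T: "\<And>i. i < m \<Longrightarrow> T i \<subseteq> {..<m} \<and> card (T i) = r - 1 \<and> i \<in> T i"
    and g: "\<And>i t. i < m \<Longrightarrow> t \<in> T i \<Longrightarrow> g i t \<in> W \<and> c (g i t) = t"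
    and link: "\<And>i. i < m \<Longrightarrow> insert w (g i ` T i) \<in> edges G"
    and disj: "\<And>i j. i < m \<Longrightarrow> j < m \<Longrightarrow> i \<noteq> j \<Longrightarrow> g i ` T i \<inter> g j ` T j = {}"
  shows "contains_copy G (H_graph r F (m + 1))"
proof -
  let ?C = "H_core F (m + 1)"
  let ?U = "uncovered_pairs F (m + 1)"
  have finF: "finite (verts F)" using F by (simp add: r_graph_def)
  have C: "finite ?C" "card ?C = m + 1" using finite_H_core[OF finF] card_H_core[OF finF F(2)] by auto
  have m0: "0 < m" using r by simp
  \<comment> \<open>The colours reserved for \<open>f - {x}\<close>: none if \<open>f\<close> is the
    placeholder \<open>{x}\<close>, else those of link set 0.\<close>
  define T' where "T' = (if f = {x} then {} else T 0)"
  have T': "T' \<subseteq> {..<m}" "finite T'" using T[OF m0] by (auto simp: T'_def intro: finite_subset)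
  have f: "f \<subseteq> ?C" "card (f - {x}) = card T'"
  proof -
    have "Orig ` d \<subseteq> ?C \<and> card (Orig ` d) = r \<and> finite (Orig ` d)" if "d \<in> edges F" for d
    proof -
      have "d \<subseteq> verts F" "card d = r" using that F by (auto simp: r_graph_def)
      moreover have "finite d" using \<open>d \<subseteq> verts F\<close> finF by (rule finite_subset)
      ultimately show ?thesis
        using Orig_image_subset_H_core[OF F(1) that] by (simp add: card_image inj_on_def)
    qed
    then show "f \<subseteq> ?C" "card (f - {x}) = card T'"
      using x T[OF m0] by (auto simp: T'_def)
  qed
  have finf: "finite f" using f(1) C finite_subset by blast
  have "card (?C - f) = card ({..<m} - T')"
  proof -
    have "card (?C - f) = card ?C - card f" using f finf by (simp add: card_Diff_subset)
    also have "card f = Suc (card (f - {x}))" by (rule card.remove[OF finf x(2)])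
    finally show ?thesis using T' f C by (simp add: card_Diff_subset)
  qed
  then obtain \<sigma>2 where \<sigma>2: "bij_betw \<sigma>2 (?C - f) ({..<m} - T')"
    using finite_same_card_bij[of "?C - f" "{..<m} - T'"] C by auto
  obtain \<sigma>1 where \<sigma>1: "bij_betw \<sigma>1 (f - {x}) T'"
    using finite_same_card_bij[of "f - {x}" T'] f(2) finf T' by auto
  define \<sigma> where "\<sigma> y = (if y \<in> f then \<sigma>1 y else \<sigma>2 y)" for y
  have "bij_betw \<sigma> ((f - {x}) \<union> (?C - f)) (T' \<union> ({..<m} - T'))"
  proof (rule bij_betw_combine)
    show "bij_betw \<sigma> (f - {x}) T'" using \<sigma>1 by (rule iffD1[OF bij_betw_cong, rotated]) (simp add: \<sigma>_def)
    show "bij_betw \<sigma> (?C - f) ({..<m} - T')" using \<sigma>2 by (rule iffD1[OF bij_betw_cong, rotated]) (simp add: \<sigma>_def)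
  qed auto
  moreover have "(f - {x}) \<union> (?C - f) = ?C - {x}" "T' \<union> ({..<m} - T') = {..<m}"
    using f x T' by auto
  ultimately have \<sigma>: "bij_betw \<sigma> (?C - {x}) {..<m}" by simp
  have \<sigma>m: "\<sigma> y < m" if "y \<in> ?C" "y \<noteq> x" for y using bij_betwE[OF \<sigma>] that by auto
  have \<sigma>inj: "y = y'" if "y \<in> ?C" "y \<noteq> x" "y' \<in> ?C" "y' \<noteq> x" "\<sigma> y = \<sigma> y'" for y y'
    using inj_onD[OF bij_betw_imp_inj_on[OF \<sigma>] that(5)] that(1-4) by simp
  have \<sigma>f: "\<sigma> y \<in> T 0 \<and> f \<noteq> {x}" if "y \<in> f" "y \<noteq> x" for y
  proof -
    have "\<sigma> y \<in> T'" using bij_betwE[OF \<sigma>1] that by (simp add: \<sigma>_def)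
    then show ?thesis unfolding T'_def by (cases "f = {x}") simp_all
  qed
  \<comment> \<open>Colour 0 belongs to \<open>T 0\<close>. So once \<open>f\<close> occupies link
    set 0, no core vertex outside \<open>f\<close> has colour 0, and that link set is not claimed
    again for a pad edge.\<close>
  have \<sigma>nf: "\<sigma> y \<noteq> 0" if "y \<in> ?C" "y \<notin> f" "y' \<in> f" "y' \<noteq> x" for y y'
  proof -
    have "T' = T 0" using \<sigma>f[OF that(3,4)] by (simp add: T'_def)
    moreover have "\<sigma> y \<notin> T'" using bij_betwE[OF \<sigma>2] that(1,2) by (simp add: \<sigma>_def)
    ultimately show ?thesis using T[OF m0] by metis
  qed
  \<comment> \<open>The link set from which \<open>y\<close> takes its vertex: set 0 on
    \<open>f\<close>, and the set of its own colour elsewhere, so that the pad edge over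
    \<open>{x, y}\<close> passes through the image of \<open>y\<close>.\<close>
  define \<iota> where "\<iota> y = (if y \<in> f then 0 else \<sigma> y)" for y
  have \<iota>: "\<iota> y < m" "\<sigma> y \<in> T (\<iota> y)" if "y \<in> ?C" "y \<noteq> x" for y
  proof -
    show "\<iota> y < m" using \<sigma>m[OF that] m0 by (simp add: \<iota>_def)
    show "\<sigma> y \<in> T (\<iota> y)" using \<sigma>f[of y] T[OF \<sigma>m[OF that]] that by (auto simp: \<iota>_def)
  qed
  define \<phi> where "\<phi> y = (if y = x then w else g (\<iota> y) (\<sigma> y))" for y
  have \<phi>x: "\<phi> x = w" by (simp add: \<phi>_def)
  have \<phi>W: "\<phi> y \<in> W" "c (\<phi> y) = \<sigma> y" "\<phi> y \<in> g (\<iota> y) ` T (\<iota> y)" if "y \<in> ?C" "y \<noteq> x" for y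
    using g[OF \<iota>[OF that]] \<iota>[OF that] that by (auto simp: \<phi>_def)
  have c\<phi>_inj: "c (\<phi> y) \<noteq> c (\<phi> y')" if "y \<in> ?C" "y' \<in> ?C" "y \<noteq> y'" "y \<noteq> x" "y' \<noteq> x" for y y'
    using \<phi>W(2) \<sigma>inj that by metis
  have inj\<phi>: "inj_on \<phi> ?C"
  proof (rule inj_onI, rule ccontr)
    fix y y' assume y: "y \<in> ?C" "y' \<in> ?C" "\<phi> y = \<phi> y'" "y \<noteq> y'"
    show False
    proof (cases "y = x \<or> y' = x")
      case True
      then show False using y \<phi>x \<phi>W(1)[of y] \<phi>W(1)[of y'] w(2) by auto
    next
      case False
      then show False using c\<phi>_inj[of y y'] y by auto
    qed
  qed
  have coreW: "\<phi> ` ?C \<subseteq> insert w W"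
  proof
    fix v assume "v \<in> \<phi> ` ?C"
    then obtain y where "y \<in> ?C" "v = \<phi> y" by blast
    then show "v \<in> insert w W" using \<phi>W(1)[of y] \<phi>x by (metis insertCI)
  qed
  define U0 where "U0 = {P \<in> ?U. x \<in> P}"
  define e0 where "e0 P = insert w (\<Union>y\<in>P - {x}. g (\<sigma> y) ` T (\<sigma> y))" for P
  have U0: "\<exists>y. y \<in> ?C \<and> y \<noteq> x \<and> y \<notin> f \<and> P = {x, y}" if P: "P \<in> U0" for P
  proof -
    have "P \<in> ?U" "x \<in> P" using P by (auto simp: U0_def)
    then obtain a b where ab: "a \<in> ?C" "b \<in> ?C" "a \<noteq> b" "P = {a, b}"
      and unc: "\<forall>e\<in>edges F. \<not> P \<subseteq> Orig ` e" unfolding uncovered_pairs_iff by blast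
    define y where "y = (if a = x then b else a)"
    have y: "y \<in> ?C" "y \<noteq> x" "P = {x, y}" using ab \<open>x \<in> P\<close> by (auto simp: y_def)
    moreover have "y \<notin> f"
    proof
      assume "y \<in> f"
      then have "f \<in> (`) Orig ` edges F" using x(3) y(2) by auto
      then obtain d where "d \<in> edges F" "f = Orig ` d" by blast
      moreover have "P \<subseteq> f" using y(3) x(2) \<open>y \<in> f\<close> by simp
      ultimately show False using unc by blast
    qed
    ultimately show ?thesis by blast
  qed
  have e0: "e0 {x, y} = insert w (g (\<sigma> y) ` T (\<sigma> y))" if "y \<noteq> x" for y
    using that by (auto simp: e0_def)
  have \<phi>_own: "\<phi> y = g (\<sigma> y) (\<sigma> y)" if "y \<notin> f" for y using that x(2) by (auto simp: \<phi>_def \<iota>_def)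
  show ?thesis
  proof (rule contains_H_graphI[OF r(1) F G inj\<phi>, of U0 e0])
    show "\<phi> ` ?C \<subseteq> verts G" using coreW W(1) w by auto
    show "U0 \<subseteq> ?U" by (auto simp: U0_def)
    show "\<phi> ` Orig ` d \<in> edges G" if d: "d \<in> edges F" for d
    proof (cases "x \<in> Orig ` d")
      case True
      then have df: "Orig ` d = f" using only d by simp
      have "f \<noteq> {x}"
      proof
        assume "f = {x}"
        then have "card (Orig ` d) = 1" using df by simp
        then show False using F(1) d r by (simp add: card_image inj_on_def r_graph_def)
      qed
      then have "T' = T 0" by (simp add: T'_def)
      have "\<phi> ` f = insert w (\<phi> ` (f - {x}))" using x(2) \<phi>x by (metis image_insert insert_Diff)
      also have "\<phi> ` (f - {x}) = (\<lambda>y. g 0 (\<sigma> y)) ` (f - {x})"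
        by (intro image_cong) (auto simp: \<phi>_def \<iota>_def)
      also have "\<dots> = g 0 ` \<sigma> ` (f - {x})" by (simp add: image_image)
      also have "\<sigma> ` (f - {x}) = \<sigma>1 ` (f - {x})" by (intro image_cong) (auto simp: \<sigma>_def)
      also have "\<dots> = T 0" using \<sigma>1 \<open>T' = T 0\<close> by (simp add: bij_betw_def)
      finally show ?thesis using link[OF m0] df by simp
    next
      case False
      have D: "Orig ` d \<subseteq> ?C" by (rule Orig_image_subset_H_core[OF F(1) d])
      have "card (\<phi> ` Orig ` d) = card (Orig ` d)" by (intro card_image inj_on_subset[OF inj\<phi> D])
      also have "\<dots> = r" using F(1) d by (simp add: card_image inj_on_def r_graph_def)
      finally have "card (\<phi> ` Orig ` d) = r" .
      moreover have "inj_on c (\<phi> ` Orig ` d)"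
      proof (rule inj_onI, rule ccontr)
        fix a b assume ab: "a \<in> \<phi> ` Orig ` d" "b \<in> \<phi> ` Orig ` d" "c a = c b" "a \<noteq> b"
        obtain y where y: "y \<in> Orig ` d" "a = \<phi> y" using ab(1) by (rule imageE)
        obtain y' where y': "y' \<in> Orig ` d" "b = \<phi> y'" using ab(2) by (rule imageE)
        have "y \<noteq> x" "y' \<noteq> x" "y \<in> ?C" "y' \<in> ?C" "y \<noteq> y'" using y y' False D ab by auto
        then show False using c\<phi>_inj[of y y'] y(2) y'(2) ab(3) by metis
      qed
      moreover have "\<phi> ` Orig ` d \<subseteq> W"
      proof
        fix a assume "a \<in> \<phi> ` Orig ` d"
        then obtain y where y: "y \<in> Orig ` d" "a = \<phi> y" by (rule imageE)
        then have "y \<noteq> x" "y \<in> ?C" using False D by auto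
        then show "a \<in> W" using \<phi>W(1) y by simp
      qed
      ultimately show ?thesis using W(2) by (simp add: complete_on_def)
    qed
    show "e0 P \<in> edges G \<and> \<phi> ` P \<subseteq> e0 P \<and> (e0 P - \<phi> ` P) \<inter> \<phi> ` ?C = {}" if P: "P \<in> U0" for P
    proof -
      obtain y where y: "y \<in> ?C" "y \<noteq> x" "y \<notin> f" "P = {x, y}" using U0[OF P] by blast
      have e0P: "e0 P = insert w (g (\<sigma> y) ` T (\<sigma> y))" using e0 y by simp
      have \<sigma>y: "\<sigma> y < m" using \<sigma>m y by simp
      have \<phi>y: "\<phi> y \<in> g (\<sigma> y) ` T (\<sigma> y)" using \<phi>_own[OF y(3)] T[OF \<sigma>y] by simp
      have "\<phi> y' \<notin> g (\<sigma> y) ` T (\<sigma> y)" if y': "y' \<in> ?C" "y' \<noteq> x" "y' \<noteq> y" for y'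
      proof -
        have "\<iota> y' \<noteq> \<sigma> y" using \<sigma>nf[OF y(1,3)] \<sigma>inj y y' by (auto simp: \<iota>_def)
        then show ?thesis using disj[OF \<iota>(1)[OF y'(1,2)] \<sigma>y] \<phi>W(3)[OF y'(1,2)] by blast
      qed
      then have "(e0 P - \<phi> ` P) \<inter> \<phi> ` ?C = {}" unfolding y(4) e0[OF y(2)] using \<phi>x by auto
      moreover have "\<phi> ` P \<subseteq> e0 P" unfolding y(4) e0[OF y(2)] using \<phi>y \<phi>x by simp
      moreover have "e0 P \<in> edges G" unfolding e0P by (rule link[OF \<sigma>y])
      ultimately show ?thesis by simp
    qed
    show "(e0 P - \<phi> ` P) \<inter> (e0 Q - \<phi> ` Q) = {}" if PQ: "P \<in> U0" "Q \<in> U0" "P \<noteq> Q" for P Q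
    proof -
      obtain y where y: "y \<in> ?C" "y \<noteq> x" "P = {x, y}" using U0[OF PQ(1)] by blast
      obtain y' where y': "y' \<in> ?C" "y' \<noteq> x" "Q = {x, y'}" using U0[OF PQ(2)] by blast
      have "\<sigma> y \<noteq> \<sigma> y'" using \<sigma>inj y y' PQ(3) by auto
      then have "g (\<sigma> y) ` T (\<sigma> y) \<inter> g (\<sigma> y') ` T (\<sigma> y') = {}" using disj \<sigma>m y y' by simp
      then show ?thesis using e0[OF y(2)] e0[OF y'(2)] y y' \<phi>x by auto
    qed
    show "\<exists>d\<in>edges G. \<phi> ` P \<subseteq> d \<and> (d - \<phi> ` P) \<inter> Z = {}"
      if P: "P \<in> ?U - U0" and Z: "finite Z" "card Z \<le> pad_bound r F (m + 1)" for P Z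
    proof -
      have "P \<in> ?U" "x \<notin> P" using P by (auto simp: U0_def)
      then obtain y y' where y: "y \<in> ?C" "y' \<in> ?C" "y \<noteq> y'" "P = {y, y'}"
        unfolding uncovered_pairs_iff by blast
      have yx: "y \<noteq> x" "y' \<noteq> x" using y \<open>x \<notin> P\<close> by auto
      have "\<exists>d\<in>edges G. {\<phi> y, \<phi> y'} \<subseteq> d \<and> (d - {\<phi> y, \<phi> y'}) \<inter> Z = {}"
      proof (rule robustly_transversal_edge[OF r W(2) subset_refl _ _ W(3) _ _ _ Z])
        show "\<phi> y \<in> W" "\<phi> y' \<in> W" using \<phi>W(1) y(1,2) yx by simp_all
        show "c (\<phi> y) < m" "c (\<phi> y') < m" using \<phi>W(2) \<sigma>m y(1,2) yx by simp_all
      qed (rule c\<phi>_inj[OF y(1-3) yx])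
      then show ?thesis using y(4) by simp
    qed
  qed
qed

section \<open>Colourings from stability\<close>

lemma card_supersets_le:
  assumes V: "finite V" and "S \<subseteq> V"
  shows "card {e. e \<subseteq> V \<and> card e = r \<and> S \<subseteq> e} \<le> card V ^ (r - card S)"
proof -
  let ?A = "{e. e \<subseteq> V \<and> card e = r \<and> S \<subseteq> e}" and ?B = "{B. B \<subseteq> V \<and> card B = r - card S}"
  have fS: "finite S" using assms finite_subset by blast
  have "inj_on (\<lambda>e. e - S) ?A" by (auto simp: inj_on_def)
  moreover have "(\<lambda>e. e - S) ` ?A \<subseteq> ?B"
    using fS by (auto simp: card_Diff_subset)
  moreover have "finite ?B" using V by simp
  ultimately have "card ?A \<le> card ?B" by (rule card_inj_on_le)
  also have "\<dots> = card V choose (r - card S)" by (rule n_subsets[OF V])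
  also have "\<dots> \<le> card V ^ (r - card S)"
    by (metis binomial_eq_0 binomial_le_pow linorder_not_le zero_le)
  finally show ?thesis .
qed

lemma card_meeting_le:
  assumes V: "finite V" and "S \<subseteq> V"
  shows "card {e. e \<subseteq> V \<and> card e = r \<and> e \<inter> S \<noteq> {}} \<le> card S * card V ^ (r - 1)"
proof -
  have fS: "finite S" using assms finite_subset by blast
  have "{e. e \<subseteq> V \<and> card e = r \<and> e \<inter> S \<noteq> {}} = (\<Union>s\<in>S. {e. e \<subseteq> V \<and> card e = r \<and> {s} \<subseteq> e})"
    by auto
  then have "card {e. e \<subseteq> V \<and> card e = r \<and> e \<inter> S \<noteq> {}}
      \<le> (\<Sum>s\<in>S. card {e. e \<subseteq> V \<and> card e = r \<and> {s} \<subseteq> e})"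
    using card_UN_le[OF fS, of "\<lambda>s. {e. e \<subseteq> V \<and> card e = r \<and> {s} \<subseteq> e}"] by simp
  also have "\<dots> \<le> (\<Sum>s\<in>S. card V ^ (r - 1))"
  proof (rule sum_mono)
    fix s assume "s \<in> S"
    then have "{s} \<subseteq> V" using assms by blast
    from card_supersets_le[OF V this, of r]
    show "card {e. e \<subseteq> V \<and> card e = r \<and> {s} \<subseteq> e} \<le> card V ^ (r - 1)" by simp
  qed
  finally show ?thesis by simp
qed

text \<open>All core pairs of a member of the family are covered, and richness upgrades each of them
  to a pair with edges avoiding any small set; the greedy choice would then produce
  \<open>H_graph\<close>. Its core is matched with \<open>C\<close> by the copy of \<open>F\<close>
  together with an arbitrary bijection from the extra vertices to the rest of
  \<open>C\<close>.\<close>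

lemma K_family_free_if_rich:
  fixes F :: "'a hypergraph" and G :: "'b hypergraph"
  assumes r: "2 \<le> r" and F: "r_graph r F" "num_verts F \<le> p" and G: "r_graph r G"
    and free: "\<not> contains_copy G (H_graph r F p)"
    and rich: "\<And>u v Z. u \<noteq> v \<Longrightarrow> covered G u v \<Longrightarrow> finite Z \<Longrightarrow> card Z \<le> pad_bound r F p
                \<Longrightarrow> \<exists>e\<in>edges G. {u, v} \<subseteq> e \<and> (e - {u, v}) \<inter> Z = {}"
  shows "free_of_family (K_family r F p) G"
  unfolding free_of_family_def
proof (intro ballI notI)
  fix H assume "H \<in> K_family r F p" and cH: "contains_copy G H"
  then obtain C where H: "r_graph r H" "C \<subseteq> verts H" "card C = p" "contains_copy (induced H C) F"
    and cov: "\<And>u v. u \<in> C \<Longrightarrow> v \<in> C \<Longrightarrow> u \<noteq> v \<Longrightarrow> covered H u v"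
    by (auto simp: K_family_def)
  obtain f where f: "inj_on f (verts H)" "f ` verts H \<subseteq> verts G" "\<And>e. e \<in> edges H \<Longrightarrow> f ` e \<in> edges G"
    using cH by (auto simp: contains_copy_def)
  obtain g where g: "inj_on g (verts F)" "g ` verts F \<subseteq> C" "\<And>e. e \<in> edges F \<Longrightarrow> g ` e \<in> edges H"
    using H(4) by (auto simp: contains_copy_def induced_def)
  have finF: "finite (verts F)" and finH: "finite (verts H)" using F H by (auto simp: r_graph_def)
  have finC: "finite C" using H finH finite_subset by blast
  have "card (C - g ` verts F) = p - num_verts F"
    using g finF H by (simp add: card_Diff_subset card_image num_verts_def)
  then obtain \<psi> where \<psi>: "bij_betw \<psi> {num_verts F + 1..p} (C - g ` verts F)"
    using finite_same_card_bij[of "{num_verts F + 1..p}" "C - g ` verts F"] finC by auto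
  define \<chi> where "\<chi> x = (case x of Orig a \<Rightarrow> g a | Extra i \<Rightarrow> \<psi> i)" for x
  have \<chi>_simps: "\<chi> (Orig a) = g a" "\<chi> (Extra i) = \<psi> i" for a i by (auto simp: \<chi>_def)
  have \<psi>C: "\<psi> i \<in> C - g ` verts F" if "i \<in> {num_verts F + 1..p}" for i
    using bij_betwE[OF \<psi>] that by blast
  have \<chi>C: "\<chi> ` H_core F p \<subseteq> C"
    using g(2) \<psi>C by (auto simp: H_core_def \<chi>_simps)
  have inj\<chi>: "inj_on \<chi> (H_core F p)"
    unfolding H_core_def
  proof (subst inj_on_Un, intro conjI)
    show "inj_on \<chi> (Orig ` verts F)" using g(1) by (auto simp: inj_on_def \<chi>_simps)
    show "inj_on \<chi> (Extra ` {num_verts F + 1..p})"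
      using \<psi> by (auto simp: inj_on_def bij_betw_def \<chi>_simps)
    show "\<chi> ` (Orig ` verts F - Extra ` {num_verts F + 1..p})
        \<inter> \<chi> ` (Extra ` {num_verts F + 1..p} - Orig ` verts F) = {}"
    proof -
      have "\<chi> x \<noteq> \<chi> y" if "x \<in> Orig ` verts F" "y \<in> Extra ` {num_verts F + 1..p}" for x y
      proof -
        obtain a i where ai: "x = Orig a" "a \<in> verts F" "y = Extra i" "i \<in> {num_verts F + 1..p}"
          using \<open>x \<in> _\<close> \<open>y \<in> _\<close> by (elim imageE)
        then have "\<chi> y \<notin> g ` verts F" using \<psi>C by (simp add: \<chi>_simps)
        moreover have "\<chi> x \<in> g ` verts F" using ai by (simp add: \<chi>_simps)
        ultimately show ?thesis by metis
      qed
      then show ?thesis by blast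
    qed
  qed
  have "contains_copy G (H_graph r F p)"
  proof (rule contains_H_graphI[OF r F G, of "f \<circ> \<chi>" "{}"])
    show "inj_on (f \<circ> \<chi>) (H_core F p)"
      using inj\<chi> \<chi>C H(2) f(1) by (intro comp_inj_on) (auto intro: inj_on_subset)
    show "(f \<circ> \<chi>) ` H_core F p \<subseteq> verts G"
    proof clarsimp
      fix x assume "x \<in> H_core F p"
      then have "\<chi> x \<in> verts H" using \<chi>C H(2) by blast
      then show "f (\<chi> x) \<in> verts G" using f(2) by blast
    qed
    show "(f \<circ> \<chi>) ` Orig ` e \<in> edges G" if "e \<in> edges F" for e
    proof -
      have "(f \<circ> \<chi>) ` Orig ` e = f ` g ` e" by (simp add: image_image \<chi>_simps)
      then show ?thesis using f(3) g(3) that by simp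
    qed
    show "\<exists>e\<in>edges G. (f \<circ> \<chi>) ` P \<subseteq> e \<and> (e - (f \<circ> \<chi>) ` P) \<inter> Z = {}"
      if P: "P \<in> uncovered_pairs F p - {}" and Z: "finite Z" "card Z \<le> pad_bound r F p" for P Z
    proof -
      obtain u v where uv: "u \<in> H_core F p" "v \<in> H_core F p" "u \<noteq> v" "P = {u, v}"
        using P unfolding Diff_empty uncovered_pairs_iff by blast
      have C: "\<chi> u \<in> C" "\<chi> v \<in> C" using \<chi>C uv by auto
      have ne: "\<chi> u \<noteq> \<chi> v" using inj\<chi> uv by (auto simp: inj_on_def)
      obtain d where d: "d \<in> edges H" "\<chi> u \<in> d" "\<chi> v \<in> d"
        using cov[OF C ne] by (auto simp: covered_def)
      have "f ` d \<in> edges G" "f (\<chi> u) \<in> f ` d" "f (\<chi> v) \<in> f ` d" using d f(3) by auto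
      then have "covered G (f (\<chi> u)) (f (\<chi> v))" unfolding covered_def by (intro bexI conjI)
      moreover have "f (\<chi> u) \<noteq> f (\<chi> v)" using f(1) ne C H(2) by (meson inj_on_def subsetD)
      ultimately have "\<exists>e\<in>edges G. {f (\<chi> u), f (\<chi> v)} \<subseteq> e \<and> (e - {f (\<chi> u), f (\<chi> v)}) \<inter> Z = {}"
        using rich Z by blast
      then show ?thesis using uv(4) by simp
    qed
  qed auto
  then show False using free by simp
qed

text \<open>The subhypergraph maximises \<open>|E'| - q \<cdot> |shadow|\<close>: if a covered pair were only covered by
  edges meeting a bounded set, deleting these few edges would uncover it and increase the
  functional.\<close>

lemma K_family_free_subgraph:
  fixes F :: "'a hypergraph" and G :: "'b hypergraph"
  assumes r: "2 \<le> r" and F: "r_graph r F" "num_verts F \<le> p" and G: "r_graph r G"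
    and free: "\<not> contains_copy G (H_graph r F p)" and ne: "verts G \<noteq> {}"
  obtains E' where "E' \<subseteq> edges G" "free_of_family (K_family r F p) (Hypergraph (verts G) E')"
    "real (card (edges G)) \<le> real (card E') + (real (pad_bound r F p) + 1) * real (num_verts G) ^ (r - 1)"
proof -
  define V n z where "V = verts G" and "n = real (num_verts G)" and "z = pad_bound r F p"
  have V: "finite V" using G by (simp add: V_def r_graph_def)
  have n: "0 < n" "n = real (card V)" using V ne by (auto simp: n_def V_def num_verts_def card_gt_0_iff)
  have E: "finite (edges G)" "\<And>e. e \<in> edges G \<Longrightarrow> e \<subseteq> V \<and> card e = r"
    using G by (auto simp: r_graph_def V_def intro: finite_subset[of _ "Pow (verts G)"])
  \<comment> \<open>The price of an ordered covered pair. For \<open>r \<ge> 3\<close> it exceeds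
    \<open>z * n ^ (r - 3)\<close>, which bounds the edges over a pair that meet a given set of
    \<open>z\<close> further vertices; yet all of the at most \<open>n ^ 2\<close> pairs together
    cost no more than \<open>(z + 1) * n ^ (r - 1)\<close>.\<close>
  define q where "q = (real z * n ^ (r - 2) + 1) / n"
  define sh where "sh E' = {(u, v). u \<noteq> v \<and> (\<exists>e\<in>E'. {u, v} \<subseteq> e)}" for E' :: "'b set set"
  have sh_sub: "sh E' \<subseteq> V \<times> V" if "E' \<subseteq> edges G" for E' using that E(2) unfolding sh_def by blast
  have sh_fin: "finite (sh E')" if "E' \<subseteq> edges G" for E'
    using sh_sub[OF that] V by (meson finite_SigmaI finite_subset)
  define \<Phi> where "\<Phi> E' = real (card E') - q * real (card (sh E'))" for E'
  obtain E' where E': "E' \<subseteq> edges G" and max: "\<And>D. D \<subseteq> edges G \<Longrightarrow> \<Phi> D \<le> \<Phi> E'"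
  proof -
    have fin: "finite (\<Phi> ` Pow (edges G))" using E(1) by simp
    have "Max (\<Phi> ` Pow (edges G)) \<in> \<Phi> ` Pow (edges G)" using fin by (intro Max_in) auto
    then obtain E' where "E' \<subseteq> edges G" "\<Phi> E' = Max (\<Phi> ` Pow (edges G))" by auto
    then show thesis using that Max_ge[OF fin] by (metis PowI imageI)
  qed
  have q: "0 < q" using n by (simp add: q_def add_nonneg_pos)
  have G': "r_graph r (Hypergraph V E')" using E' E V by (auto simp: r_graph_def)
  have "free_of_family (K_family r F p) (Hypergraph V E')"
  proof (rule K_family_free_if_rich[OF r F G'])
    show "\<not> contains_copy (Hypergraph V E') (H_graph r F p)"
    proof
      assume "contains_copy (Hypergraph V E') (H_graph r F p)"
      then obtain f where "inj_on f (verts (H_graph r F p))" "f ` verts (H_graph r F p) \<subseteq> verts G"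
        and "\<And>e. e \<in> edges (H_graph r F p) \<Longrightarrow> f ` e \<in> E'"
        unfolding contains_copy_def V_def hypergraph.sel by (elim exE conjE) metis
      then have "contains_copy G (H_graph r F p)"
        unfolding contains_copy_def using E' by (intro exI[of _ f]) (auto dest: subsetD)
      then show False using free by simp
    qed
  next
    fix u v and Z :: "'b set"
    assume uv: "u \<noteq> v" "covered (Hypergraph V E') u v" and Z: "finite Z" "card Z \<le> pad_bound r F p"
    show "\<exists>e\<in>edges (Hypergraph V E'). {u, v} \<subseteq> e \<and> (e - {u, v}) \<inter> Z = {}"
    proof (rule ccontr)
      assume "\<not> ?thesis"
      then have meet: "\<And>e. e \<in> E' \<Longrightarrow> {u, v} \<subseteq> e \<Longrightarrow> \<exists>w\<in>Z. w \<in> e \<and> w \<noteq> u \<and> w \<noteq> v" by fastforce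
      obtain d where d: "d \<in> E'" "{u, v} \<subseteq> d" using uv(2) by (auto simp: covered_def)
      have uvV: "{u, v} \<subseteq> V" using d E' E(2) by blast
      obtain w where w: "w \<in> d" "w \<noteq> u" "w \<noteq> v" using meet d by blast
      \<comment> \<open>The edge \<open>d\<close> has a third vertex in \<open>Z\<close>, so
        \<open>r = 2\<close> is impossible here and the exponent \<open>r - 3\<close> is not
        truncated.\<close>
      have r3: "3 \<le> r"
      proof -
        have "d \<subseteq> V" "card d = r" using d E' E(2) by blast+
        moreover have "finite d" using \<open>d \<subseteq> V\<close> V by (rule finite_subset)
        moreover have "{u, v, w} \<subseteq> d" using d w by simp
        ultimately show ?thesis using card_mono[of d "{u, v, w}"] uv(1) w by auto
      qed
      define D where "D = {e \<in> E'. {u, v} \<subseteq> e}"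
      have finE': "finite E'" using E' E(1) finite_subset by blast
      have "card D \<le> card (\<Union>w\<in>Z \<inter> V - {u, v}. {e. e \<subseteq> V \<and> card e = r \<and> {u, v, w} \<subseteq> e})"
      proof (rule card_mono)
        show "finite (\<Union>w\<in>Z \<inter> V - {u, v}. {e. e \<subseteq> V \<and> card e = r \<and> {u, v, w} \<subseteq> e})"
          using Z V by auto
        show "D \<subseteq> (\<Union>w\<in>Z \<inter> V - {u, v}. {e. e \<subseteq> V \<and> card e = r \<and> {u, v, w} \<subseteq> e})"
        proof
          fix e assume e: "e \<in> D"
          then have "e \<in> E'" "{u, v} \<subseteq> e" by (auto simp: D_def)
          moreover obtain w where "w \<in> Z" "w \<in> e" "w \<noteq> u" "w \<noteq> v" using meet calculation by blast
          moreover have "e \<subseteq> V \<and> card e = r" using E(2) E' calculation(1) by blast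
          ultimately show "e \<in> (\<Union>w\<in>Z \<inter> V - {u, v}. {e. e \<subseteq> V \<and> card e = r \<and> {u, v, w} \<subseteq> e})"
            by blast
        qed
      qed
      also have "\<dots> \<le> (\<Sum>w\<in>Z \<inter> V - {u, v}. card {e. e \<subseteq> V \<and> card e = r \<and> {u, v, w} \<subseteq> e})"
        using Z by (intro card_UN_le) auto
      also have "\<dots> \<le> (\<Sum>w\<in>Z \<inter> V - {u, v}. card V ^ (r - 3))"
      proof (rule sum_mono)
        fix w assume w: "w \<in> Z \<inter> V - {u, v}"
        then have "{u, v, w} \<subseteq> V" "card {u, v, w} = 3" using uv(1) uvV by auto
        with card_supersets_le[OF V this(1), of r]
        show "card {e. e \<subseteq> V \<and> card e = r \<and> {u, v, w} \<subseteq> e} \<le> card V ^ (r - 3)" by simp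
      qed
      also have "\<dots> \<le> z * card V ^ (r - 3)"
      proof -
        have "card (Z \<inter> V - {u, v}) \<le> z"
          using Z card_mono[of Z "Z \<inter> V - {u, v}"] unfolding z_def by force
        then show ?thesis by simp
      qed
      finally have "real (card D) \<le> real z * n ^ (r - 3)"
        unfolding n(2) using of_nat_mono by fastforce
      also have "\<dots> < q"
      proof -
        have "r - 2 = Suc (r - 3)" using r3 by simp
        then have "n ^ (r - 2) = n * n ^ (r - 3)" by simp
        then show ?thesis using n by (simp add: q_def field_simps)
      qed
      finally have Dq: "real (card D) < q" .
      have subD: "E' - D \<subseteq> edges G" using E' by blast
      have c1: "real (card (E' - D)) = real (card E') - real (card D)"
        using finE' by (simp add: D_def card_Diff_subset card_mono of_nat_diff)
      have "sh (E' - D) \<subset> sh E'"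
      proof
        show "sh (E' - D) \<subseteq> sh E'" by (auto simp: sh_def)
        have "(u, v) \<in> sh E'" "(u, v) \<notin> sh (E' - D)" using d uv(1) by (auto simp: sh_def D_def)
        then show "sh (E' - D) \<noteq> sh E'" by blast
      qed
      then have "card (sh (E' - D)) < card (sh E')" using sh_fin[OF E'] by (intro psubset_card_mono)
      then have "real (card (sh (E' - D))) + 1 \<le> real (card (sh E'))" by linarith
      then have "q * (real (card (sh (E' - D))) + 1) \<le> q * real (card (sh E'))"
        using q by (intro mult_left_mono) auto
      then have "\<Phi> E' < \<Phi> (E' - D)" using c1 Dq by (simp add: \<Phi>_def algebra_simps)
      then show False using max[OF subD] by simp
    qed
  qed
  moreover have "real (card (edges G)) \<le> real (card E') + (real z + 1) * n ^ (r - 1)"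
  proof -
    have "real (card (edges G)) - q * real (card (sh (edges G))) \<le> real (card E')"
    proof -
      have "0 \<le> q * real (card (sh E'))" using q by simp
      then show ?thesis using max[of "edges G"] by (simp add: \<Phi>_def)
    qed
    moreover have "q * real (card (sh (edges G))) \<le> (real z + 1) * n ^ (r - 1)"
    proof -
      have "card (sh (edges G)) \<le> card (V \<times> V)" using sh_sub[of "edges G"] V by (intro card_mono) auto
      then have "real (card (sh (edges G))) \<le> n * n"
        unfolding n(2) card_cartesian_product using of_nat_mono by fastforce
      then have "q * real (card (sh (edges G))) \<le> q * (n * n)" using q by (intro mult_left_mono) auto
      also have "\<dots> = (real z * n ^ (r - 2) + 1) * n" using n by (simp add: q_def)
      also have "\<dots> \<le> (real z * n ^ (r - 2) + n ^ (r - 2)) * n"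
      proof -
        have "1 \<le> n" using n by (cases "card V") auto
        then show ?thesis by (intro mult_right_mono add_left_mono) auto
      qed
      also have "\<dots> = (real z + 1) * (n ^ (r - 2) * n)" by (simp add: algebra_simps)
      also have "n ^ (r - 2) * n = n ^ (r - 1)"
      proof -
        have "r - 1 = Suc (r - 2)" using r by simp
        then show ?thesis by (simp only: power_Suc mult.commute)
      qed
      finally show ?thesis .
    qed
    ultimately show ?thesis by linarith
  qed
  ultimately show thesis using that E' unfolding V_def n_def z_def by blast
qed

text \<open>Any two of the \<open>m + 1\<close> core vertices lie in a common edge, but two of their
  images share a residue modulo \<open>m\<close>, and no edge of the Turan graph contains such a
  pair. This is the lower bound for the Turan number.\<close>

lemma turan_graph_H_graph_free:
  assumes "0 < m" "finite (verts F)" "num_verts F \<le> m + 1"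
  shows "\<not> contains_copy (turan_graph r n m) (H_graph r F (m + 1))"
proof
  let ?C = "H_core F (m + 1)"
  assume "contains_copy (turan_graph r n m) (H_graph r F (m + 1))"
  then obtain f where f: "inj_on f (verts (H_graph r F (m + 1)))"
    and fe: "\<And>e. e \<in> edges (H_graph r F (m + 1)) \<Longrightarrow> f ` e \<in> rainbow {..<n} (\<lambda>v. v mod m) r"
    using edges_turan_graph[OF assms(1), of r n] unfolding contains_copy_def by auto
  define g where "g x = f (Core x) mod m" for x
  have "g ` ?C \<subseteq> {..<m}" using assms(1) by (auto simp: g_def)
  then have "card (g ` ?C) \<le> m" using card_mono[of "{..<m}" "g ` ?C"] by simp
  then have "card (g ` ?C) < card ?C" using card_H_core[OF assms(2,3)] by simp
  then have "\<not> inj_on g ?C" by (rule pigeonhole)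
  then obtain x y where xy: "x \<in> ?C" "y \<in> ?C" "x \<noteq> y" "g x = g y" by (auto simp: inj_on_def)
  obtain e where e: "e \<in> edges (H_graph r F (m + 1))" "Core x \<in> e" "Core y \<in> e"
    using H_graph_covers_core[OF xy(1-3)] by blast
  have "Core x \<in> verts (H_graph r F (m + 1))" "Core y \<in> verts (H_graph r F (m + 1))"
    using xy by (auto simp: H_graph_def)
  then have "f (Core x) \<noteq> f (Core y)" using f xy(3) by (auto simp: inj_on_def)
  moreover have "inj_on (\<lambda>v. v mod m) (f ` e)" using fe[OF e(1)] by (simp add: rainbow_def)
  ultimately show False using e(2,3) xy(4) by (auto simp: inj_on_def g_def)
qed

section \<open>From stability to a colouring with few bad edges\<close>

lemma falling_eq: "falling m r = fact r * real (m choose r)"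
proof -
  have "real (m choose r) = (\<Prod>i = 0..<r. real m - real i) / fact r"
    unfolding binomial_gbinomial gbinomial_prod_rev ..
  also have "{0..<r} = {..<r}" by auto
  finally show ?thesis by (simp add: falling_def)
qed

definition bad_edges :: "('v \<Rightarrow> nat) \<Rightarrow> 'v set set \<Rightarrow> 'v set set" where
  "bad_edges c E = {e \<in> E. \<not> inj_on c e}"

lemma partite_coloring:
  assumes "m_partite m G" and G: "finite (verts G)" "\<And>e. e \<in> edges G \<Longrightarrow> e \<subseteq> verts G" and "0 < m"
  obtains c where "\<And>v. c v < m" "\<And>e. e \<in> edges G \<Longrightarrow> inj_on c e"
proof -
  obtain P where P: "is_partition (verts G) m P" and one: "\<And>e i. e \<in> edges G \<Longrightarrow> i < m \<Longrightarrow> card (e \<inter> P i) \<le> 1"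
    using assms(1) by (auto simp: m_partite_def)
  have Un: "(\<Union>i<m. P i) = verts G" using P by (simp add: is_partition_def)
  \<comment> \<open>Colours below \<open>m\<close> are also needed outside \<open>verts G\<close>:
    the lemma is applied to an induced subhypergraph, and the deleted vertices receive colour
    0.\<close>
  define c where "c v = (if v \<in> verts G then SOME i. i < m \<and> v \<in> P i else 0)" for v
  have c: "c v < m \<and> v \<in> P (c v)" if "v \<in> verts G" for v
  proof -
    have "\<exists>i. i < m \<and> v \<in> P i" using that Un by auto
    from someI_ex[OF this] show ?thesis using that by (simp add: c_def)
  qed
  show thesis
  proof (rule that)
    show "c v < m" for v using c[of v] assms(4) by (cases "v \<in> verts G") (auto simp: c_def)
    show "inj_on c e" if e: "e \<in> edges G" for e
    proof (rule inj_onI)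
      fix u v assume uv: "u \<in> e" "v \<in> e" "c u = c v"
      have V: "u \<in> verts G" "v \<in> verts G" using uv G(2)[OF e] by auto
      have "u \<in> e \<inter> P (c u)" "v \<in> e \<inter> P (c u)" using uv c[OF V(1)] c[OF V(2)] by auto
      moreover have "card (e \<inter> P (c u)) \<le> Suc 0" using one[OF e] c[OF V(1)] by simp
      moreover have "finite (e \<inter> P (c u))" using G(1) G(2)[OF e] by (auto intro: finite_subset)
      ultimately show "u = v" using card_le_Suc0_iff_eq by blast
    qed
  qed
qed

text \<open>Every bad edge was either lost in passing to a subgraph free of the family, or meets the
  set \<open>S\<close> deleted by stability. The first kind has order \<open>n ^ (r - 1)\<close>,
  the second at most \<open>card S * n ^ (r - 1)\<close> members; each gets half of
  \<open>\<epsilon>\<close>.\<close>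

lemma stable_coloring:
  fixes F :: "'a hypergraph" and \<epsilon> :: real
  assumes r: "2 \<le> r" "r \<le> m" and F: "r_graph r F" and stable: "m_stable r m F" and \<epsilon>: "0 < \<epsilon>"
  obtains \<delta> :: real and N :: nat where "0 < \<delta>"
    "\<And>G :: nat hypergraph. r_graph r G \<Longrightarrow> N \<le> num_verts G \<Longrightarrow>
       \<not> contains_copy G (H_graph r F (m + 1)) \<Longrightarrow>
       (real (m choose r) / real m ^ r - \<delta>) * real (num_verts G) ^ r \<le> real (num_edges G) \<Longrightarrow>
       \<exists>c. (\<forall>v. c v < m) \<and> real (card (bad_edges c (edges G))) \<le> \<epsilon> * real (num_verts G) ^ r"
proof -
  let ?D = "real (m choose r) / real m ^ r"
  have Fm: "num_verts F \<le> m + 1" using stable by (simp add: m_stable_def)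
  have "0 < \<epsilon> / 2" using \<epsilon> by simp
  then obtain \<delta>1 :: real and n1 :: nat where \<delta>1: "0 < \<delta>1" and st: "\<And>G :: nat hypergraph.
       r_graph r G \<Longrightarrow> n1 \<le> num_verts G \<Longrightarrow> free_of_family (K_family r F (m + 1)) G \<Longrightarrow>
       (falling m r / real m ^ r - \<delta>1) * real (num_verts G choose r) < real (num_edges G) \<Longrightarrow>
       \<exists>S \<subseteq> verts G. real (card S) \<le> \<epsilon> / 2 * real (num_verts G) \<and>
         m_partite m (induced G (verts G - S))"
    using stable unfolding m_stable_def by blast
  define z where "z = real (pad_bound r F (m + 1)) + 1"
  \<comment> \<open>Since \<open>(n / r) ^ r \<le> n choose r\<close>, the slack
    \<open>\<delta>1 * (n choose r)\<close> is at least \<open>3 * \<delta> * n ^ r\<close>: one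
    share for the deficit allowed to \<open>G\<close>, one for the lost edges, one for
    strictness.\<close>
  define \<delta> where "\<delta> = \<delta>1 / (3 * real r ^ r)"
  have \<delta>: "0 < \<delta>" using \<delta>1 r by (simp add: \<delta>_def)
  have z: "1 \<le> z" by (simp add: z_def)
  define N where "N = n1 + r + nat \<lceil>z / \<delta>\<rceil> + nat \<lceil>2 * z / \<epsilon>\<rceil>"
  show thesis
  proof (rule that[OF \<delta>, of N])
    fix G :: "nat hypergraph"
    assume G: "r_graph r G" and N: "N \<le> num_verts G" and free: "\<not> contains_copy G (H_graph r F (m + 1))"
      and many: "(?D - \<delta>) * real (num_verts G) ^ r \<le> real (num_edges G)"
    define n where "n = real (num_verts G)"
    have nN: "n1 \<le> num_verts G" "r \<le> num_verts G" "z / \<delta> \<le> n" "2 * z / \<epsilon> \<le> n"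
    proof -
      show "n1 \<le> num_verts G" "r \<le> num_verts G" using N by (auto simp: N_def)
      have "nat \<lceil>z / \<delta>\<rceil> \<le> num_verts G" "nat \<lceil>2 * z / \<epsilon>\<rceil> \<le> num_verts G"
        using N unfolding N_def by linarith+
      then show "z / \<delta> \<le> n" "2 * z / \<epsilon> \<le> n"
        unfolding n_def by (meson of_nat_mono order_trans real_nat_ceiling_ge)+
    qed
    have n0: "0 < n" using nN(2) r by (simp add: n_def)
    have V: "finite (verts G)" "verts G \<noteq> {}" "n = real (card (verts G))"
      using G n0 by (auto simp: r_graph_def n_def num_verts_def)
    have npow: "n ^ r = n * n ^ (r - 1)" using r by (cases r) auto
    obtain E' where E': "E' \<subseteq> edges G" "free_of_family (K_family r F (m + 1)) (Hypergraph (verts G) E')"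
      and lost: "real (card (edges G)) \<le> real (card E') + z * n ^ (r - 1)"
      using K_family_free_subgraph[OF r(1) F Fm G free V(2)] unfolding z_def n_def by blast
    let ?G' = "Hypergraph (verts G) E'"
    have G': "r_graph r ?G'" "num_verts ?G' = num_verts G"
      using G E'(1) by (auto simp: r_graph_def num_verts_def)
    have finE: "finite (edges G)" using G V(1)
      by (auto simp: r_graph_def intro: finite_subset[of _ "Pow (verts G)"])
    have zn1: "z * n ^ (r - 1) \<le> \<delta> * n ^ r"
    proof -
      have "z \<le> \<delta> * n" using nN(3) \<delta> by (simp add: field_simps)
      then have "z * n ^ (r - 1) \<le> \<delta> * n * n ^ (r - 1)" using n0 by (intro mult_right_mono) auto
      then show ?thesis by (simp add: npow)
    qed
    have zn2: "z * n ^ (r - 1) \<le> \<epsilon> / 2 * n ^ r"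
    proof -
      have "z \<le> \<epsilon> / 2 * n" using nN(4) \<epsilon> by (simp add: field_simps)
      then have "z * n ^ (r - 1) \<le> \<epsilon> / 2 * n * n ^ (r - 1)" using n0 by (intro mult_right_mono) auto
      then show ?thesis by (simp add: npow)
    qed
    have "(falling m r / real m ^ r - \<delta>1) * real (num_verts G choose r) < real (card E')"
    proof -
      have "fact r * real (num_verts G choose r) \<le> n ^ r"
      proof -
        have "fact r * (num_verts G choose r) \<le> num_verts G ^ r" 
          using binomial_fact_pow[of "num_verts G" r] by (simp only: mult.commute)
        then have "real (fact r * (num_verts G choose r)) \<le> real (num_verts G ^ r)" by (rule of_nat_mono)
        then show ?thesis by (simp add: n_def)
      qed
      then have "?D * (fact r * real (num_verts G choose r)) \<le> ?D * n ^ r" by (intro mult_left_mono) auto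
      moreover have "\<delta>1 * (n / real r) ^ r \<le> \<delta>1 * real (num_verts G choose r)"
        using binomial_ge_n_over_k_pow_k[OF nN(2), where 'a = real] \<delta>1 r
        by (intro mult_left_mono) (auto simp: n_def)
      moreover have "\<delta>1 * (n / real r) ^ r = 3 * \<delta> * n ^ r"
        using r by (simp add: \<delta>_def power_divide)
      moreover have "0 < \<delta> * n ^ r" using \<delta> n0 by simp
      moreover have "(?D - \<delta>) * n ^ r \<le> real (card E') + \<delta> * n ^ r"
        using many lost zn1 by (simp add: n_def num_edges_def)
      ultimately show ?thesis by (simp add: falling_eq algebra_simps)
    qed
    then have "\<exists>S \<subseteq> verts G. real (card S) \<le> \<epsilon> / 2 * n \<and> m_partite m (induced ?G' (verts G - S))"
      using st[OF G'(1) _ E'(2)] G'(2) nN(1) by (simp add: num_edges_def n_def)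
    then obtain S where S: "S \<subseteq> verts G" "real (card S) \<le> \<epsilon> / 2 * n" "m_partite m (induced ?G' (verts G - S))"
      by blast
    obtain c where c: "\<And>v. c v < m" and inj: "\<And>e. e \<in> edges (induced ?G' (verts G - S)) \<Longrightarrow> inj_on c e"
      using partite_coloring[OF S(3)] V(1) r by (auto simp: induced_def)
    let ?M = "{e. e \<subseteq> verts G \<and> card e = r \<and> e \<inter> S \<noteq> {}}"
    have "bad_edges c (edges G) \<subseteq> (edges G - E') \<union> ?M"
    proof
      fix e assume e: "e \<in> bad_edges c (edges G)"
      then have eG: "e \<in> edges G" "e \<subseteq> verts G" "card e = r" using G by (auto simp: bad_edges_def r_graph_def)
      show "e \<in> (edges G - E') \<union> ?M"
      proof (rule ccontr)
        assume "\<not> ?thesis"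
        then have "e \<in> edges (induced ?G' (verts G - S))" using eG by (auto simp: induced_def)
        then show False using inj e by (simp add: bad_edges_def)
      qed
    qed
    then have "card (bad_edges c (edges G)) \<le> card ((edges G - E') \<union> ?M)"
      using finE V(1) by (intro card_mono) auto
    also have "\<dots> \<le> card (edges G - E') + card ?M" by (rule card_Un_le)
    also have "card ?M \<le> card S * card (verts G) ^ (r - 1)" by (rule card_meeting_le[OF V(1) S(1)])
    finally have "card (bad_edges c (edges G))
        \<le> card (edges G - E') + card S * card (verts G) ^ (r - 1)" by simp
    then have "real (card (bad_edges c (edges G)))
        \<le> real (card (edges G - E') + card S * card (verts G) ^ (r - 1))"
      by (rule of_nat_mono)
    also have "\<dots> = real (card (edges G - E')) + real (card S) * n ^ (r - 1)" by (simp add: V(3))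
    also have "real (card (edges G - E')) = real (card (edges G)) - real (card E')"
      using E'(1) finE by (simp add: card_Diff_subset card_mono finite_subset of_nat_diff)
    also have "real (card (edges G)) - real (card E') \<le> \<epsilon> / 2 * n ^ r" using lost zn2 by linarith
    also have "real (card S) * n ^ (r - 1) \<le> \<epsilon> / 2 * n * n ^ (r - 1)"
      using S(2) n0 by (intro mult_right_mono) auto
    also have "\<epsilon> / 2 * n ^ r + \<epsilon> / 2 * n * n ^ (r - 1) = \<epsilon> * n ^ r" by (simp add: npow)
    finally have "real (card (bad_edges c (edges G))) \<le> \<epsilon> * n ^ r" by simp
    then show "\<exists>c. (\<forall>v. c v < m) \<and> real (card (bad_edges c (edges G))) \<le> \<epsilon> * real (num_verts G) ^ r"
      using c unfolding n_def by blast
  qed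
qed

section \<open>Excluding bad edges\<close>

text \<open>A set \<open>Z\<close> hitting every row would contain a different vertex for each row,
  hence more than \<open>z\<close> vertices.\<close>

lemma rows_robustly_transversal:
  fixes W :: "'v set"
  assumes R: "finite R" "z < card R"
    and inj: "inj_on (\<lambda>(\<rho>, t). h \<rho> t) (R \<times> {..<m})"
    and h: "\<And>\<rho> t. \<rho> \<in> R \<Longrightarrow> t < m \<Longrightarrow> h \<rho> t \<in> W \<and> c (h \<rho> t) = t"
  shows "robustly_transversal z c m W"
  unfolding robustly_transversal_def
proof (intro allI impI)
  fix Z :: "'v set" assume Z: "finite Z" "card Z \<le> z"
  have "\<exists>\<rho>\<in>R. \<forall>t<m. h \<rho> t \<notin> Z"
  proof (rule ccontr)
    assume "\<not> ?thesis"
    then have "\<forall>\<rho>\<in>R. \<exists>t. t < m \<and> h \<rho> t \<in> Z" by blast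
    then obtain \<tau> where \<tau>: "\<And>\<rho>. \<rho> \<in> R \<Longrightarrow> \<tau> \<rho> < m \<and> h \<rho> (\<tau> \<rho>) \<in> Z" by metis
    have "inj_on (\<lambda>\<rho>. h \<rho> (\<tau> \<rho>)) R"
    proof (rule inj_onI)
      fix \<rho> \<rho>' assume "\<rho> \<in> R" "\<rho>' \<in> R" "h \<rho> (\<tau> \<rho>) = h \<rho>' (\<tau> \<rho>')"
      then have "(\<rho>, \<tau> \<rho>) = (\<rho>', \<tau> \<rho>')" using inj_onD[OF inj, of "(\<rho>, \<tau> \<rho>)" "(\<rho>', \<tau> \<rho>')"] \<tau> by simp
      then show "\<rho> = \<rho>'" by simp
    qed
    moreover have "(\<lambda>\<rho>. h \<rho> (\<tau> \<rho>)) ` R \<subseteq> Z" using \<tau> by blast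
    ultimately have "card R \<le> card Z" using Z(1) by (rule card_inj_on_le)
    then show False using R Z by simp
  qed
  then obtain \<rho> where "\<rho> \<in> R" "\<forall>t<m. h \<rho> t \<notin> Z" by blast
  then show "\<exists>a. \<forall>t<m. a t \<in> W - Z \<and> c (a t) = t" using h by (intro exI[of _ "h \<rho>"]) simp
qed

lemma card_transversal_functions_ge:
  fixes \<eta> :: real
  assumes "0 \<le> \<eta>" and "\<And>t. t < m \<Longrightarrow> \<eta> * n \<le> real (card {v \<in> V. c v = t})" and "0 \<le> n"
  shows "\<eta> ^ m * n ^ m \<le> real (card (PiE {..<m} (\<lambda>t. {v \<in> V. c v = t})))"
proof -
  have "(\<Prod>t<m. \<eta> * n) \<le> (\<Prod>t<m. real (card {v \<in> V. c v = t}))"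
    using assms by (intro prod_mono) auto
  then show ?thesis by (simp add: card_PiE power_mult_distrib)
qed

text \<open>Here and in the next two lemmas all sets of the family have one common size, so a single
  count meets the size-by-size requirement of the union bound.\<close>

lemma card_link_le:
  fixes \<epsilon> n :: real
  assumes M: "finite M" "\<And>S. S \<in> M \<Longrightarrow> finite S \<and> card S = r"
    and few: "real (card {S \<in> M. u \<in> S}) \<le> \<epsilon> * n ^ (r - 1)" and "0 \<le> \<epsilon>" "0 \<le> n"
  shows "real (card {S. u \<notin> S \<and> insert u S \<in> M \<and> card S = s}) \<le> \<epsilon> * n ^ s"
proof (cases "\<exists>S. u \<notin> S \<and> insert u S \<in> M \<and> card S = s")
  case True
  then obtain S where S: "u \<notin> S" "insert u S \<in> M" "card S = s" by blast
  then have "s = r - 1" using M(2)[OF S(2)] by auto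
  moreover have "card {S. u \<notin> S \<and> insert u S \<in> M \<and> card S = s} \<le> card {S \<in> M. u \<in> S}"
  proof (rule card_inj_on_le[of "insert u"])
    show "inj_on (insert u) {S. u \<notin> S \<and> insert u S \<in> M \<and> card S = s}"
      by (rule inj_onI) (metis insert_ident mem_Collect_eq)
  qed (use M in auto)
  ultimately show ?thesis using few by simp
next
  case False
  then have empty: "{S. u \<notin> S \<and> insert u S \<in> M \<and> card S = s} = {}" by blast
  show ?thesis unfolding empty using assms(4,5) by simp
qed

lemma card_uniform_le:
  fixes \<epsilon> n :: real
  assumes M: "\<And>S. S \<in> M \<Longrightarrow> card S = r"
    and few: "real (card M) \<le> \<epsilon> * n ^ r" and "0 \<le> \<epsilon>" "0 \<le> n"
  shows "real (card {S \<in> M. card S = s}) \<le> \<epsilon> * n ^ s"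
proof (cases "s = r")
  case True
  then have "{S \<in> M. card S = s} = M" using M by blast
  then show ?thesis using few True by simp
next
  case False
  then have empty: "{S \<in> M. card S = s} = {}" using M by blast
  show ?thesis unfolding empty using assms(3,4) by simp
qed

lemma card_singletons_le:
  fixes \<epsilon> n :: real
  assumes "finite A" "real (card A) \<le> \<epsilon> * n" "0 \<le> \<epsilon>" "0 \<le> n"
  shows "real (card {S \<in> (\<lambda>w. {w}) ` A. card S = s}) \<le> \<epsilon> * n ^ s"
proof (cases "s = 1")
  case True
  have "card {S \<in> (\<lambda>w. {w}) ` A. card S = s} \<le> card A"
  proof (rule order_trans)
    show "card {S \<in> (\<lambda>w. {w}) ` A. card S = s} \<le> card ((\<lambda>w. {w}) ` A)"
      using assms(1) by (intro card_mono) auto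
    show "card ((\<lambda>w. {w}) ` A) \<le> card A" using assms(1) by (rule card_image_le)
  qed
  then show ?thesis using assms(2) True by simp
next
  case False
  then have empty: "{S \<in> (\<lambda>w. {w}) ` A. card S = s} = {}" by auto
  show ?thesis unfolding empty using assms(3,4) by simp
qed

text \<open>Four families are forbidden: the missing sets, the sets that \<open>u\<close> completes
  to missing ones, those that \<open>v\<close> does, and the singletons of \<open>e\<close>; hence
  \<open>4 * \<epsilon>\<close>. A system of \<open>L\<close> full transversals avoiding them stays
  complete when \<open>u\<close> or \<open>v\<close> is added, and is disjoint from
  \<open>e\<close>. \<open>L\<close> exceeds \<open>pad_bound\<close> by one so that some row
  escapes every set of that size.\<close>

lemma bad_edge_with_rich_ends:
  fixes F :: "'a hypergraph" and G :: "'b hypergraph" and \<epsilon> \<eta> :: real and m r :: nat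
  defines "L \<equiv> pad_bound r F (m + 1) + 1" and "n \<equiv> real (card (verts G))"
  assumes r: "2 \<le> r" "r \<le> m" and F: "r_graph r F" "num_verts F \<le> m + 1"
    and x: "x \<in> H_core F (m + 1)" "x \<in> f" "f = {x} \<or> f \<in> (`) Orig ` edges F"
    and only: "\<And>e. e \<in> edges F \<Longrightarrow> x \<in> Orig ` e \<Longrightarrow> Orig ` e = f"
    and G: "r_graph r G" and c: "\<And>v. c v < m"
    and \<eta>: "0 < \<eta>" and classes: "\<And>t. t < m \<Longrightarrow> \<eta> * n \<le> real (card {v \<in> verts G. c v = t})"
    and \<epsilon>: "0 < \<epsilon>" "real r \<le> \<epsilon> * n"
    and const: "(2 ^ (L * m) * real (L * m) ^ (L * m) + real (L * m) ^ 2) * (4 * \<epsilon>) < (\<eta> ^ m) ^ L"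
    and M: "M = rainbow (verts G) c r - edges G" "real (card M) \<le> \<epsilon> * n ^ r"
    and e: "e \<in> edges G" "u \<in> e" "v \<in> e" "u \<noteq> v" "c u = c v"
    and du: "real (card {S \<in> M. u \<in> S}) \<le> \<epsilon> * n ^ (r - 1)"
    and dv: "real (card {S \<in> M. v \<in> S}) \<le> \<epsilon> * n ^ (r - 1)"
  shows "contains_copy G (H_graph r F (m + 1))"
proof -
  let ?V = "verts G"
  have V: "finite ?V" using G by (simp add: r_graph_def)
  have eV: "e \<subseteq> ?V" "card e = r" using e(1) G by (auto simp: r_graph_def)
  have fe: "finite e" using eV(1) V by (rule finite_subset)
  have n: "0 \<le> n" by (simp add: n_def)
  have finM: "finite M" using V by (simp add: M(1) rainbow_def)
  have MV: "S \<subseteq> ?V" "card S = r" "finite S" if "S \<in> M" for S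
    using that V unfolding M(1) rainbow_def by (auto intro: finite_subset)
  define Lk where "Lk w = {S. w \<notin> S \<and> insert w S \<in> M}" for w
  define \<M> where "\<M> = (M \<union> Lk u) \<union> (Lk v \<union> (\<lambda>w. {w}) ` e)"
  define \<Omega> where "\<Omega> = PiE {..<m} (\<lambda>t. {v \<in> ?V. c v = t})"
  have cardS: "card {S \<in> \<M>. card S = s} \<le> (card {S \<in> M. card S = s} + card {S. u \<notin> S \<and> insert u S \<in> M \<and> card S = s})
      + (card {S. v \<notin> S \<and> insert v S \<in> M \<and> card S = s} + card {S \<in> (\<lambda>w. {w}) ` e. card S = s})" for s
  proof -
    have "{S \<in> \<M>. card S = s} = ({S \<in> M. card S = s} \<union> {S. u \<notin> S \<and> insert u S \<in> M \<and> card S = s})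
      \<union> ({S. v \<notin> S \<and> insert v S \<in> M \<and> card S = s} \<union> {S \<in> (\<lambda>w. {w}) ` e. card S = s})"
      unfolding \<M>_def Lk_def by blast
    then show ?thesis by (simp only:) (intro order_trans[OF card_Un_le] add_mono card_Un_le)
  qed
  have few: "real (card {S \<in> \<M>. card S = s}) \<le> (4 * \<epsilon>) * n ^ s" for s
  proof -
    have 1: "real (card {S \<in> M. card S = s}) \<le> \<epsilon> * n ^ s"
      using card_uniform_le[OF MV(2) M(2)] \<epsilon>(1) n by simp
    have 2: "real (card {S. u \<notin> S \<and> insert u S \<in> M \<and> card S = s}) \<le> \<epsilon> * n ^ s"
      using card_link_le[OF finM _ du] MV \<epsilon>(1) n by simp
    have 3: "real (card {S. v \<notin> S \<and> insert v S \<in> M \<and> card S = s}) \<le> \<epsilon> * n ^ s"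
      using card_link_le[OF finM _ dv] MV \<epsilon>(1) n by simp
    have 4: "real (card {S \<in> (\<lambda>w. {w}) ` e. card S = s}) \<le> \<epsilon> * n ^ s"
      using card_singletons_le[OF fe] eV(2) \<epsilon> n by simp
    show ?thesis using of_nat_mono[OF cardS[of s], where 'a = real] 1 2 3 4 by simp
  qed
  have \<M>V: "S \<subseteq> ?V \<and> S \<noteq> {}" if "S \<in> \<M>" for S
  proof -
    have "S \<subseteq> ?V \<and> S \<noteq> {}" if "insert w S \<in> M" for w
      using MV[OF that] r by (cases "S = {}") auto
    moreover have "S \<noteq> {}" if "S \<in> M" using MV[OF that] r by auto
    ultimately show ?thesis using that MV(1) eV(1) unfolding \<M>_def Lk_def by blast
  qed
  have large: "1 \<le> (4 * \<epsilon>) * n" using \<epsilon>(2) r by simp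
  have \<gamma>: "0 < \<eta> ^ m" using \<eta> by simp
  have card\<Omega>: "\<eta> ^ m * n ^ card {..<m} \<le> real (card \<Omega>)"
    using card_transversal_functions_ge[OF _ classes n] \<eta> by (simp add: \<Omega>_def)
  have \<Omega>sub: "\<Omega> \<subseteq> {..<m} \<rightarrow>\<^sub>E ?V" unfolding \<Omega>_def by (rule PiE_mono) blast
  have "card {..<L} = L" by simp
  then have const': "(2 ^ (card {..<L} * m) * real (card {..<L} * m) ^ (card {..<L} * m) + real (card {..<L} * m) ^ 2) * (4 * \<epsilon>)
      < (\<eta> ^ m) ^ card {..<L}" using const by simp
  have "\<exists>h. (\<forall>\<rho>\<in>{..<L}. h \<rho> \<in> \<Omega>) \<and> inj_on (\<lambda>(\<rho>, t). h \<rho> t) (Sigma {..<L} (\<lambda>_. {..<m})) \<and>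
      (\<forall>J\<subseteq>Sigma {..<L} (\<lambda>_. {..<m}). (\<lambda>(\<rho>, t). h \<rho> t) ` J \<notin> \<M>)"
  proof (rule union_bound_rows[where T = "\<lambda>_. {..<m}" and \<Omega> = "\<lambda>_. \<Omega>" and \<M> = \<M>,
        OF V finite_lessThan[of L] subset_refl \<Omega>sub card\<Omega>[unfolded n_def] \<M>V
          few[unfolded n_def] large[unfolded n_def] \<gamma> const'])
    fix h
    assume "\<And>\<rho>. \<rho> \<in> {..<L} \<Longrightarrow> h \<rho> \<in> \<Omega>" "inj_on (\<lambda>(\<rho>, t). h \<rho> t) (Sigma {..<L} (\<lambda>_. {..<m}))"
      "\<And>J. J \<subseteq> Sigma {..<L} (\<lambda>_. {..<m}) \<Longrightarrow> (\<lambda>(\<rho>, t). h \<rho> t) ` J \<notin> \<M>"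
    then show ?thesis by (intro exI[of _ h] conjI ballI allI impI)
  qed
  then obtain h where h\<Omega>: "\<And>\<rho>. \<rho> \<in> {..<L} \<Longrightarrow> h \<rho> \<in> \<Omega>"
    and inj: "inj_on (\<lambda>(\<rho>, t). h \<rho> t) (Sigma {..<L} (\<lambda>_. {..<m}))"
    and avoid: "\<And>J. J \<subseteq> Sigma {..<L} (\<lambda>_. {..<m}) \<Longrightarrow> (\<lambda>(\<rho>, t). h \<rho> t) ` J \<notin> \<M>"
    by blast
  define I where "I = {..<L} \<times> {..<m}"
  define W where "W = (\<lambda>(\<rho>, t). h \<rho> t) ` I"
  have h: "h \<rho> t \<in> ?V \<and> c (h \<rho> t) = t" if "\<rho> < L" "t < m" for \<rho> t
    using PiE_mem[OF h\<Omega>[unfolded \<Omega>_def], of \<rho> t] that by simp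
  have W: "W \<subseteq> ?V"
    unfolding W_def I_def using h by auto
  have avoidW: "S \<notin> \<M>" if S: "S \<subseteq> W" for S
  proof -
    have "S \<subseteq> (\<lambda>(\<rho>, t). h \<rho> t) ` I" using S unfolding W_def .
    then obtain J where J: "J \<subseteq> I" "S = (\<lambda>(\<rho>, t). h \<rho> t) ` J" by (rule subset_imageE)
    then show ?thesis using avoid by (simp add: I_def)
  qed
  have complete: "complete_on (edges G) c r (insert w W)" if w: "w \<in> {u, v}" for w
    unfolding complete_on_def
  proof (intro allI impI, rule ccontr)
    fix S assume S: "S \<subseteq> insert w W" "card S = r" "inj_on c S" and no: "S \<notin> edges G"
    have wV: "w \<in> ?V" using w e eV by blast
    have SV: "S \<subseteq> ?V" using S(1) W wV by blast
    then have SM: "S \<in> M" using S no by (simp add: M(1) rainbow_def)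
    show False
    proof (cases "w \<in> S")
      case True
      then have "insert w (S - {w}) = S" by blast
      then have "S - {w} \<in> Lk w" using SM by (simp add: Lk_def)
      then have "S - {w} \<in> \<M>" using w unfolding \<M>_def by blast
      moreover have "S - {w} \<subseteq> W" using S(1) by blast
      ultimately show False using avoidW by blast
    next
      case False
      then have "S \<subseteq> W" using S(1) by blast
      moreover have "S \<in> \<M>" using SM by (simp add: \<M>_def)
      ultimately show False using avoidW by blast
    qed
  qed
  have We: "W \<inter> e = {}"
  proof (rule ccontr)
    assume "W \<inter> e \<noteq> {}"
    then obtain w where "w \<in> W" "w \<in> e" by blast
    then have "{w} \<subseteq> W" "{w} \<in> \<M>" by (auto simp: \<M>_def)
    then show False using avoidW by blast
  qed
  have robust: "robustly_transversal (pad_bound r F (m + 1)) c m W"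
  proof (rule rows_robustly_transversal[of "{..<L}" _ h])
    show "pad_bound r F (m + 1) < card {..<L}" by (simp add: L_def)
    show "h \<rho> t \<in> W \<and> c (h \<rho> t) = t" if "\<rho> \<in> {..<L}" "t < m" for \<rho> t
    proof -
      have "(\<rho>, t) \<in> I" using that by (simp add: I_def)
      then have "h \<rho> t \<in> W" unfolding W_def by force
      then show ?thesis using h that by simp
    qed
  qed (use inj in simp_all)
  show ?thesis
    by (rule embed_bad_edge[OF r F x only G e c W We robust complete complete]) simp_all
qed

text \<open>The first \<open>m\<close> rows are drawn from link sets of \<open>w\<close>, the other
  \<open>L\<close> from all full transversals; both kinds have proportion at least
  \<open>\<gamma>\<close>. Sets that \<open>w\<close> completes to missing ones are not forbidden,
  as they may be numerous: only \<open>M\<close> and the singleton of \<open>w\<close> are, hence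
  \<open>2 * \<epsilon>\<close>.\<close>

lemma rich_link_embeds:
  fixes F :: "'a hypergraph" and G :: "'b hypergraph" and \<epsilon> \<eta> \<gamma> :: real and m r :: nat
  defines "L \<equiv> pad_bound r F (m + 1) + 1" and "n \<equiv> real (card (verts G))"
  assumes r: "2 \<le> r" "r \<le> m" and F: "r_graph r F" "num_verts F \<le> m + 1"
    and x: "x \<in> H_core F (m + 1)" "x \<in> f" "f = {x} \<or> f \<in> (`) Orig ` edges F"
    and only: "\<And>e. e \<in> edges F \<Longrightarrow> x \<in> Orig ` e \<Longrightarrow> Orig ` e = f"
    and G: "r_graph r G" and c: "\<And>v. c v < m"
    and \<eta>: "0 < \<eta>" and classes: "\<And>t. t < m \<Longrightarrow> \<eta> * n \<le> real (card {v \<in> verts G. c v = t})"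
    and \<epsilon>: "0 < \<epsilon>" "1 \<le> \<epsilon> * n" and \<gamma>: "0 < \<gamma>" "\<gamma> \<le> \<eta> ^ m"
    and const: "(2 ^ ((m + L) * m) * real ((m + L) * m) ^ ((m + L) * m) + real ((m + L) * m) ^ 2) * (2 * \<epsilon>)
                  < \<gamma> ^ (m + L)"
    and M: "M = rainbow (verts G) c r - edges G" "real (card M) \<le> \<epsilon> * n ^ r"
    and w: "w \<in> verts G"
    and T: "\<And>i. i < m \<Longrightarrow> T i \<subseteq> {..<m} \<and> card (T i) = r - 1 \<and> i \<in> T i"
    and N: "\<And>i. i < m \<Longrightarrow>
        N i \<subseteq> {g. g \<subseteq> verts G \<and> inj_on c g \<and> c ` g = T i \<and> insert w g \<in> edges G}"
    and cardN: "\<And>i. i < m \<Longrightarrow> \<gamma> * n ^ (r - 1) \<le> real (card (N i))"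
  shows "contains_copy G (H_graph r F (m + 1))"
proof -
  let ?V = "verts G"
  have V: "finite ?V" using G by (simp add: r_graph_def)
  have n: "0 \<le> n" by (simp add: n_def)
  have finM: "finite M" using V by (simp add: M(1) rainbow_def)
  have MV: "S \<subseteq> ?V" "card S = r" if "S \<in> M" for S
    using that unfolding M(1) rainbow_def by auto
  define \<M> where "\<M> = M \<union> (\<lambda>w. {w}) ` {w}"
  define P where "P S = PiE S (\<lambda>t. {v \<in> ?V. c v = t})" for S
  define R where "R = {..<m + L}"
  define T' where "T' \<rho> = (if \<rho> < m then T \<rho> else {..<m})" for \<rho>
  define \<Omega> where "\<Omega> \<rho> = (if \<rho> < m then {h \<in> P (T \<rho>). h ` T \<rho> \<in> N \<rho>} else P {..<m})" for \<rho>
  have few: "real (card {S \<in> \<M>. card S = s}) \<le> (2 * \<epsilon>) * n ^ s" for s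
  proof -
    have "{S \<in> \<M>. card S = s} = {S \<in> M. card S = s} \<union> {S \<in> (\<lambda>w. {w}) ` {w}. card S = s}"
      unfolding \<M>_def by blast
    then have "card {S \<in> \<M>. card S = s} \<le> card {S \<in> M. card S = s} + card {S \<in> (\<lambda>w. {w}) ` {w}. card S = s}"
      by (metis (no_types, lifting) card_Un_le)
    moreover have "real (card {S \<in> M. card S = s}) \<le> \<epsilon> * n ^ s"
      using card_uniform_le[OF MV(2) M(2)] \<epsilon>(1) n by simp
    moreover have "real (card {S \<in> (\<lambda>w. {w}) ` {w}. card S = s}) \<le> \<epsilon> * n ^ s"
      using card_singletons_le[of "{w}" \<epsilon> n] \<epsilon> n by simp
    ultimately show ?thesis by linarith
  qed
  have \<M>V: "S \<subseteq> ?V \<and> S \<noteq> {}" if "S \<in> \<M>" for S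
    using that MV[of S] w r unfolding \<M>_def by auto
  have large: "1 \<le> (2 * \<epsilon>) * n" using \<epsilon>(2) by simp
  have T'm: "T' \<rho> \<subseteq> {..<m}" for \<rho> using T[of \<rho>] by (auto simp: T'_def)
  have \<Omega>P: "\<Omega> \<rho> \<subseteq> P (T' \<rho>)" for \<rho> by (auto simp: \<Omega>_def T'_def)
  have P: "P S \<subseteq> S \<rightarrow>\<^sub>E ?V" for S unfolding P_def by (rule PiE_mono) blast
  have \<Omega>sub: "\<Omega> \<rho> \<subseteq> T' \<rho> \<rightarrow>\<^sub>E ?V" for \<rho> using \<Omega>P P by (rule order_trans)
  have card\<Omega>: "\<gamma> * n ^ card (T' \<rho>) \<le> real (card (\<Omega> \<rho>))" for \<rho>
  proof (cases "\<rho> < m")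
    case True
    \<comment> \<open>Choice functions and transversal sets correspond, so a dense collection of
      link sets is an equally dense family of rows.\<close>
    have bij: "bij_betw (\<lambda>f. f ` T \<rho>) (P (T \<rho>)) {g. g \<subseteq> ?V \<and> inj_on c g \<and> c ` g = T \<rho>}"
      unfolding P_def by (rule bij_betw_transversals)
    have "(\<lambda>f. f ` T \<rho>) ` \<Omega> \<rho> = N \<rho>"
    proof
      show "N \<rho> \<subseteq> (\<lambda>f. f ` T \<rho>) ` \<Omega> \<rho>"
      proof
        fix g assume g: "g \<in> N \<rho>"
        then have "g \<in> {g. g \<subseteq> ?V \<and> inj_on c g \<and> c ` g = T \<rho>}" using N[OF True] by blast
        then have "g \<in> (\<lambda>f. f ` T \<rho>) ` P (T \<rho>)" using bij_betw_imp_surj_on[OF bij] by simp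
        then obtain f where "f \<in> P (T \<rho>)" "g = f ` T \<rho>" by (rule imageE)
        then have "f \<in> \<Omega> \<rho>" using g True by (simp add: \<Omega>_def)
        then show "g \<in> (\<lambda>f. f ` T \<rho>) ` \<Omega> \<rho>" using \<open>g = f ` T \<rho>\<close> by (intro image_eqI[of _ _ f])
      qed
    qed (use True in \<open>auto simp: \<Omega>_def\<close>)
    moreover have "inj_on (\<lambda>f. f ` T \<rho>) (\<Omega> \<rho>)"
    proof (rule inj_on_subset[OF bij_betw_imp_inj_on[OF bij]])
      show "\<Omega> \<rho> \<subseteq> P (T \<rho>)" using \<Omega>P[of \<rho>] True by (simp add: T'_def)
    qed
    ultimately have "card (\<Omega> \<rho>) = card (N \<rho>)" by (metis card_image)
    then show ?thesis using cardN[OF True] T[OF True] True by (simp add: T'_def)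
  next
    case False
    have "\<gamma> * n ^ m \<le> \<eta> ^ m * n ^ m" using \<gamma> n by (intro mult_right_mono) auto
    also have "\<dots> \<le> real (card (P {..<m}))"
      using card_transversal_functions_ge[OF _ classes n] \<eta> by (simp add: P_def)
    finally show ?thesis using False by (simp add: \<Omega>_def T'_def)
  qed
  have finR: "finite R" and cR: "card R = m + L" by (auto simp: R_def)
  have const': "(2 ^ (card R * m) * real (card R * m) ^ (card R * m) + real (card R * m) ^ 2) * (2 * \<epsilon>)
      < \<gamma> ^ card R" using const unfolding cR .
  have "\<exists>h. (\<forall>\<rho>\<in>R. h \<rho> \<in> \<Omega> \<rho>) \<and> inj_on (\<lambda>(\<rho>, t). h \<rho> t) (Sigma R T') \<and>
      (\<forall>J\<subseteq>Sigma R T'. (\<lambda>(\<rho>, t). h \<rho> t) ` J \<notin> \<M>)"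
  proof (rule union_bound_rows[where R = R and T = T' and \<Omega> = \<Omega> and \<M> = \<M>,
        OF V finR T'm \<Omega>sub card\<Omega>[unfolded n_def] \<M>V few[unfolded n_def] large[unfolded n_def]
          \<gamma>(1) const'])
    fix h
    assume "\<And>\<rho>. \<rho> \<in> R \<Longrightarrow> h \<rho> \<in> \<Omega> \<rho>" "inj_on (\<lambda>(\<rho>, t). h \<rho> t) (Sigma R T')"
      "\<And>J. J \<subseteq> Sigma R T' \<Longrightarrow> (\<lambda>(\<rho>, t). h \<rho> t) ` J \<notin> \<M>"
    then show ?thesis by (intro exI[of _ h] conjI ballI allI impI)
  qed
  then obtain h where h\<Omega>: "\<And>\<rho>. \<rho> \<in> R \<Longrightarrow> h \<rho> \<in> \<Omega> \<rho>"
    and inj: "inj_on (\<lambda>(\<rho>, t). h \<rho> t) (Sigma R T')"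
    and avoid: "\<And>J. J \<subseteq> Sigma R T' \<Longrightarrow> (\<lambda>(\<rho>, t). h \<rho> t) ` J \<notin> \<M>"
    by blast
  define W where "W = (\<lambda>(\<rho>, t). h \<rho> t) ` Sigma R T'"
  have h: "h \<rho> t \<in> W \<and> h \<rho> t \<in> ?V \<and> c (h \<rho> t) = t" if "\<rho> \<in> R" "t \<in> T' \<rho>" for \<rho> t
  proof -
    have "h \<rho> \<in> P (T' \<rho>)" using h\<Omega>[OF that(1)] \<Omega>P by blast
    moreover have "h \<rho> t \<in> W"
      unfolding W_def using that by (intro image_eqI[of _ _ "(\<rho>, t)"]) simp_all
    ultimately show ?thesis using PiE_mem[of "h \<rho>" "T' \<rho>" _ t] that(2) unfolding P_def by blast
  qed
  have W: "W \<subseteq> ?V" unfolding W_def using h by auto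
  have avoidW: "S \<notin> \<M>" if S: "S \<subseteq> W" for S
  proof -
    have "S \<subseteq> (\<lambda>(\<rho>, t). h \<rho> t) ` Sigma R T'" using S unfolding W_def .
    then obtain J where J: "J \<subseteq> Sigma R T'" "S = (\<lambda>(\<rho>, t). h \<rho> t) ` J" by (rule subset_imageE)
    then show ?thesis using avoid by simp
  qed
  have complete: "complete_on (edges G) c r W"
    unfolding complete_on_def
  proof (intro allI impI, rule ccontr)
    fix S assume S: "S \<subseteq> W" "card S = r" "inj_on c S" and no: "S \<notin> edges G"
    then have "S \<in> \<M>" using W by (auto simp: \<M>_def M(1) rainbow_def)
    then show False using avoidW S(1) by blast
  qed
  have wW: "w \<notin> W" using avoidW[of "{w}"] by (auto simp: \<M>_def)
  have robust: "robustly_transversal (pad_bound r F (m + 1)) c m W"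
  \<comment> \<open>Only the last \<open>L\<close> rows are taken, because the first
    \<open>m\<close> use just \<open>r - 1\<close> colours each.\<close>
  proof (rule rows_robustly_transversal[of "{m..<m + L}" _ h])
    show "pad_bound r F (m + 1) < card {m..<m + L}" by (simp add: L_def)
    have sub: "{m..<m + L} \<times> {..<m} \<subseteq> Sigma R T'" by (auto simp: R_def T'_def)
    show "inj_on (\<lambda>(\<rho>, t). h \<rho> t) ({m..<m + L} \<times> {..<m})" by (rule inj_on_subset[OF inj sub])
    show "h \<rho> t \<in> W \<and> c (h \<rho> t) = t" if "\<rho> \<in> {m..<m + L}" "t < m" for \<rho> t
      using h[of \<rho> t] that by (simp add: R_def T'_def)
  qed simp
  have mR: "i \<in> R \<and> T' i = T i" if "i < m" for i using that by (simp add: R_def T'_def)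
  show ?thesis
  proof (rule embed_link[OF r F x only G W complete robust w wW T, where g = h])
    show "h i t \<in> W \<and> c (h i t) = t" if "i < m" "t \<in> T i" for i t
      using h[of i t] mR[OF that(1)] that(2) by simp
    show "insert w (h i ` T i) \<in> edges G" if i: "i < m" for i
    proof -
      have "h i ` T i \<in> N i" using h\<Omega>[of i] mR[OF i] i by (simp add: \<Omega>_def)
      then show ?thesis using N[OF i] by blast
    qed
    show "h i ` T i \<inter> h j ` T j = {}" if ij: "i < m" "j < m" "i \<noteq> j" for i j
    proof (rule ccontr)
      assume "h i ` T i \<inter> h j ` T j \<noteq> {}"
      then obtain a b where ab: "a \<in> T i" "b \<in> T j" "h i a = h j b" by blast
      then have "(i, a) = (j, b)"
        using inj_onD[OF inj, of "(i, a)" "(j, b)"] mR[OF ij(1)] mR[OF ij(2)] by simp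
      then show False using ij(3) by simp
    qed
  qed
qed

section \<open>Finding a vertex whose link meets every class often\<close>

lemma sum_degrees:
  assumes "finite V" "finite M" "\<And>e. e \<in> M \<Longrightarrow> e \<subseteq> V \<and> card e = r"
  shows "(\<Sum>v\<in>V. card {e \<in> M. v \<in> e}) = r * card M"
proof -
  have "(\<Sum>v\<in>V. card {e \<in> M. v \<in> e}) = (\<Sum>v\<in>V. \<Sum>e\<in>{e \<in> M. v \<in> e}. 1)" by simp
  also have "\<dots> = (\<Sum>e\<in>M. \<Sum>v\<in>{v \<in> V. v \<in> e}. 1)"
    using assms(1,2) by (rule sum.swap_restrict)
  also have "\<dots> = (\<Sum>e\<in>M. r)"
  proof (rule sum.cong[OF refl])
    fix e assume "e \<in> M"
    then have "{v \<in> V. v \<in> e} = e" "card e = r" using assms(3) by blast+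
    then show "(\<Sum>v\<in>{v \<in> V. v \<in> e}. 1) = r" by simp
  qed
  finally show ?thesis by simp
qed

definition link :: "'v set set \<Rightarrow> 'v \<Rightarrow> 'v set set" where
  "link E x = {g. x \<notin> g \<and> insert x g \<in> E}"

lemma finite_link: "finite E \<Longrightarrow> finite (link E x)"
proof -
  assume "finite E"
  moreover have "link E x \<subseteq> (\<lambda>e. e - {x}) ` E"
  proof
    fix g assume "g \<in> link E x"
    then show "g \<in> (\<lambda>e. e - {x}) ` E"
      by (intro image_eqI[of _ _ "insert x g"]) (auto simp: link_def)
  qed
  ultimately show ?thesis by (meson finite_imageI finite_subset)
qed

text \<open>Bad edges are split by whether they contain \<open>x\<close> and, if so, by whether the
  rest is already non-transversal. Only the last summand depends on \<open>i\<close>, and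
  \<open>i = c x\<close> gives back \<open>c\<close>; comparing colours for \<open>x\<close> thus
  means comparing last summands.\<close>

lemma card_bad_edges_recolor:
  assumes E: "finite E"
  shows "card (bad_edges (c(x := i)) E)
    = card {e \<in> E. x \<notin> e \<and> \<not> inj_on c e} + card {g \<in> link E x. \<not> inj_on c g}
      + card {g \<in> link E x. inj_on c g \<and> i \<in> c ` g}"
proof -
  let ?c = "c(x := i)"
  let ?A = "{e \<in> E. x \<notin> e \<and> \<not> inj_on c e}"
  let ?B1 = "{g \<in> link E x. \<not> inj_on c g}" and ?B2 = "{g \<in> link E x. inj_on c g \<and> i \<in> c ` g}"
  have out: "inj_on ?c e \<longleftrightarrow> inj_on c e" if "x \<notin> e" for e
    using that by (intro inj_on_cong) auto
  have img: "?c ` g = c ` g" if "x \<notin> g" for g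
    using that by (intro image_cong) auto
  have ins: "inj_on ?c (insert x g) \<longleftrightarrow> inj_on c g \<and> i \<notin> c ` g" if "x \<notin> g" for g
    using that by (simp add: inj_on_insert out img del: fun_upd_apply) simp
  have "bad_edges ?c E = ?A \<union> insert x ` (?B1 \<union> ?B2)"
  proof
    show "bad_edges ?c E \<subseteq> ?A \<union> insert x ` (?B1 \<union> ?B2)"
    proof
      fix e assume e: "e \<in> bad_edges ?c E"
      then have eE: "e \<in> E" "\<not> inj_on ?c e" by (auto simp: bad_edges_def)
      show "e \<in> ?A \<union> insert x ` (?B1 \<union> ?B2)"
      proof (cases "x \<in> e")
        case True
        define g where "g = e - {x}"
        have g: "x \<notin> g" "e = insert x g" using True by (auto simp: g_def)
        then have "g \<in> ?B1 \<union> ?B2" using eE ins[OF g(1)] by (auto simp: link_def)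
        then show ?thesis using g(2) by blast
      next
        case False
        then show ?thesis using eE out by simp
      qed
    qed
    show "?A \<union> insert x ` (?B1 \<union> ?B2) \<subseteq> bad_edges ?c E"
    proof
      fix e assume "e \<in> ?A \<union> insert x ` (?B1 \<union> ?B2)"
      then consider "e \<in> ?A" | g where "g \<in> ?B1 \<union> ?B2" "e = insert x g" by blast
      then show "e \<in> bad_edges ?c E"
      proof cases
        case 1 then show ?thesis using out by (simp add: bad_edges_def)
      next
        case 2
        then have g: "x \<notin> g" "insert x g \<in> E" "\<not> (inj_on c g \<and> i \<notin> c ` g)" by (auto simp: link_def)
        then show ?thesis using ins[OF g(1)] 2(2) by (simp add: bad_edges_def)
      qed
    qed
  qed
  moreover have "?A \<inter> insert x ` (?B1 \<union> ?B2) = {}" by blast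
  moreover have fin: "finite ?A" "finite ?B1" "finite ?B2" using E finite_link[OF E] by auto
  ultimately have "card (bad_edges ?c E) = card ?A + card (insert x ` (?B1 \<union> ?B2))"
    by (simp add: card_Un_disjoint)
  also have "card (insert x ` (?B1 \<union> ?B2)) = card (?B1 \<union> ?B2)"
  proof (rule card_image, rule inj_onI)
    fix g h assume "g \<in> ?B1 \<union> ?B2" "h \<in> ?B1 \<union> ?B2" "insert x g = insert x h"
    then show "g = h" by (auto simp: link_def)
  qed
  also have "\<dots> = card ?B1 + card ?B2" using fin by (intro card_Un_disjoint) auto
  finally show ?thesis by (simp only: add.assoc)
qed

lemma small_constant:
  fixes A B k :: real
  assumes "0 \<le> A" "0 < B" "0 < k"
  obtains \<epsilon> where "0 < \<epsilon>" "\<And>\<delta>. \<delta> \<le> \<epsilon> \<Longrightarrow> A * (k * \<delta>) < B"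
proof -
  define \<epsilon> where "\<epsilon> = B / (k * (A + 1))"
  have \<epsilon>: "0 < \<epsilon>" using assms by (simp add: \<epsilon>_def)
  have "A * (k * \<delta>) < B" if "\<delta> \<le> \<epsilon>" for \<delta>
  proof -
    have "A * (k * \<delta>) \<le> A * (k * \<epsilon>)" using that assms by (intro mult_left_mono) auto
    also have "\<dots> < (A + 1) * (k * \<epsilon>)" using \<epsilon> assms by simp
    also have "\<dots> = B" using assms by (simp add: \<epsilon>_def)
    finally show ?thesis .
  qed
  then show thesis using that \<epsilon> by blast
qed

text \<open>Optimality of \<open>c\<close> enters only through recolouring single vertices. If fewer
  sets were missing than edges bad, the bound on bad edges would also bound the missing sets; this
  keeps the set \<open>X\<close> of vertices in many missing sets below a small multiple of
  \<open>n\<close>.\<close>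

lemma few_bad_edges_le_missing:
  fixes F :: "'a hypergraph" and \<eta> :: real
  assumes r: "2 \<le> r" "r \<le> m" and F: "r_graph r F"
    and deg: "num_verts F \<le> m \<or> (num_verts F = m + 1 \<and> (\<exists>v\<in>verts F. vertex_degree F v = 1))"
    and \<eta>: "0 < \<eta>"
  obtains \<epsilon> :: real and N :: nat where "0 < \<epsilon>"
    "\<And>(G :: 'b hypergraph) c. r_graph r G \<Longrightarrow> N \<le> card (verts G) \<Longrightarrow>
       \<not> contains_copy G (H_graph r F (m + 1)) \<Longrightarrow> (\<And>v. c v < m) \<Longrightarrow>
       (\<And>t. t < m \<Longrightarrow> \<eta> * real (card (verts G)) \<le> real (card {v \<in> verts G. c v = t})) \<Longrightarrow>
       (\<And>x i. x \<in> verts G \<Longrightarrow> i < m \<Longrightarrow>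
          card (bad_edges c (edges G)) \<le> card (bad_edges (c(x := i)) (edges G))) \<Longrightarrow>
       real (card (bad_edges c (edges G))) \<le> \<epsilon> * real (card (verts G)) ^ r \<Longrightarrow>
       card (bad_edges c (edges G)) \<le> card (rainbow (verts G) c r - edges G)"
proof -
  have Fm: "num_verts F \<le> m + 1" using deg by auto
  obtain x0 f where x0: "x0 \<in> H_core F (m + 1)" "x0 \<in> f" "f = {x0} \<or> f \<in> (`) Orig ` edges F"
    and only: "\<And>e. e \<in> edges F \<Longrightarrow> x0 \<in> Orig ` e \<Longrightarrow> Orig ` e = f"
    using H_core_low_degree_vertex[OF r(2) F deg] by blast
  define L where "L = pad_bound r F (m + 1) + 1"
  define K1 where "K1 = L * m"
  define K2 where "K2 = (m + L) * m"
  have "0 \<le> 2 ^ K1 * real K1 ^ K1 + real K1 ^ 2" "0 < (\<eta> ^ m) ^ L" "0 < (4 :: real)" using \<eta> by auto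
  then obtain \<epsilon>2 where \<epsilon>2: "0 < \<epsilon>2"
    and const1: "\<And>\<delta>. \<delta> \<le> \<epsilon>2 \<Longrightarrow> (2 ^ K1 * real K1 ^ K1 + real K1 ^ 2) * (4 * \<delta>) < (\<eta> ^ m) ^ L"
    by (rule small_constant) blast
  \<comment> \<open>Double counting gives
    \<open>card X * (\<epsilon>2 * n ^ (r - 1)) \<le> r * card M\<close>. Since \<open>X\<close>
    meets every bad edge and \<open>card M < card B\<close>, dividing by \<open>r\<close> shows that
    some vertex of \<open>X\<close> lies in more than \<open>\<epsilon>3 * n ^ (r - 1)\<close> bad
    edges.\<close>
  define \<epsilon>3 where "\<epsilon>3 = \<epsilon>2 / real r"
  have \<epsilon>3: "0 < \<epsilon>3" using \<epsilon>2 r by (simp add: \<epsilon>3_def)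
  \<comment> \<open>Half of \<open>\<epsilon>3\<close> goes to bad edges with a second vertex in
    \<open>X\<close>; \<open>2 ^ m\<close> bounds the colour sets among which the link sets are
    distributed. The term \<open>\<eta> ^ m\<close> is a lower bound for the proportion of full
    transversals.\<close>
  define \<gamma> where "\<gamma> = min (\<eta> ^ m) (\<epsilon>3 / 2 / 2 ^ m)"
  have \<gamma>: "0 < \<gamma>" "\<gamma> \<le> \<eta> ^ m" "\<gamma> \<le> \<epsilon>3 / 2 / 2 ^ m" using \<eta> \<epsilon>3 by (auto simp: \<gamma>_def)
  have "0 \<le> 2 ^ K2 * real K2 ^ K2 + real K2 ^ 2" "0 < \<gamma> ^ (m + L)" "0 < (2 :: real)" using \<gamma> by auto
  then obtain \<epsilon>4 where \<epsilon>4: "0 < \<epsilon>4"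
    and const2: "\<And>\<delta>. \<delta> \<le> \<epsilon>4 \<Longrightarrow> (2 ^ K2 * real K2 ^ K2 + real K2 ^ 2) * (2 * \<delta>) < \<gamma> ^ (m + L)"
    by (rule small_constant) blast
  \<comment> \<open>The last term forces \<open>card X \<le> \<epsilon>3 / 2 * n\<close>, so that
    edges through a given vertex with a second vertex in \<open>X\<close> can be neglected.\<close>
  define \<epsilon> where "\<epsilon> = min (min \<epsilon>2 \<epsilon>4) (\<epsilon>2 * \<epsilon>3 / (2 * real r))"
  have \<epsilon>: "0 < \<epsilon>" "\<epsilon> \<le> \<epsilon>2" "\<epsilon> \<le> \<epsilon>4" "\<epsilon> \<le> \<epsilon>2 * \<epsilon>3 / (2 * real r)"
    using \<epsilon>2 \<epsilon>3 \<epsilon>4 r by (auto simp: \<epsilon>_def)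
  define N where "N = 1 + nat \<lceil>real r / \<epsilon>2\<rceil> + nat \<lceil>1 / \<epsilon>4\<rceil>"
  show thesis
  proof (rule that[OF \<epsilon>(1), of N])
    fix G :: "'b hypergraph" and c
    assume G: "r_graph r G" and N: "N \<le> card (verts G)" and free: "\<not> contains_copy G (H_graph r F (m + 1))"
      and c: "\<And>v. c v < m"
      and classes: "\<And>t. t < m \<Longrightarrow> \<eta> * real (card (verts G)) \<le> real (card {v \<in> verts G. c v = t})"
      and opt: "\<And>x i. x \<in> verts G \<Longrightarrow> i < m \<Longrightarrow>
          card (bad_edges c (edges G)) \<le> card (bad_edges (c(x := i)) (edges G))"
      and few: "real (card (bad_edges c (edges G))) \<le> \<epsilon> * real (card (verts G)) ^ r"
    define V E n B M where "V = verts G" and "E = edges G" and "n = real (card V)"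
      and "B = bad_edges c E" and "M = rainbow V c r - E"
    have V: "finite V" using G by (simp add: r_graph_def V_def)
    have E: "e \<subseteq> V" "card e = r" if "e \<in> E" for e using that G by (auto simp: r_graph_def V_def E_def)
    have finE: "finite E" using E V by (intro finite_subset[of E "Pow V"]) auto
    have B: "finite B" "B \<subseteq> E" using finE by (auto simp: B_def bad_edges_def)
    have finM: "finite M" using V by (simp add: M_def rainbow_def)
    have MV: "e \<subseteq> V \<and> card e = r" if "e \<in> M" for e using that by (simp add: M_def rainbow_def)
    have Nn: "real r \<le> \<epsilon>2 * n" "1 \<le> \<epsilon>4 * n" "0 < n"
    proof -
      have "nat \<lceil>real r / \<epsilon>2\<rceil> \<le> card V" "nat \<lceil>1 / \<epsilon>4\<rceil> \<le> card V" "1 \<le> card V"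
        using N unfolding N_def V_def by linarith+
      then have "real r / \<epsilon>2 \<le> n" "1 / \<epsilon>4 \<le> n" "0 < n"
        unfolding n_def using real_nat_ceiling_ge[of "real r / \<epsilon>2"] real_nat_ceiling_ge[of "1 / \<epsilon>4"]
        by linarith+
      then show "real r \<le> \<epsilon>2 * n" "1 \<le> \<epsilon>4 * n" "0 < n" using \<epsilon>2 \<epsilon>4 by (simp_all add: field_simps)
    qed
    have npow: "n ^ r = n * n ^ (r - 1)" "n ^ (r - 1) = n * n ^ (r - 2)"
    proof -
      obtain k where "r = Suc (Suc k)" using r(1) by (metis add_2_eq_Suc le_Suc_ex)
      then show "n ^ r = n * n ^ (r - 1)" "n ^ (r - 1) = n * n ^ (r - 2)" by simp_all
    qed
    have "card B \<le> card M"
    proof (rule ccontr)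
      assume "\<not> card B \<le> card M"
      then have MB: "card M < card B" by simp
      have fewM: "real (card M) \<le> \<epsilon> * n ^ r" using MB few by (simp add: B_def E_def n_def V_def)
      define X where "X = {v \<in> V. \<epsilon>2 * n ^ (r - 1) < real (card {S \<in> M. v \<in> S})}"
      have X: "X \<subseteq> V" "finite X" using V by (auto simp: X_def)
      have badX: "u \<in> X \<or> v \<in> X" if e: "e \<in> E" "u \<in> e" "v \<in> e" "u \<noteq> v" "c u = c v" for e u v
      proof (rule ccontr)
        assume no: "\<not> (u \<in> X \<or> v \<in> X)"
        have uv: "u \<in> V" "v \<in> V" using e E by auto
        have du: "real (card {S \<in> M. u \<in> S}) \<le> \<epsilon>2 * n ^ (r - 1)"
          and dv: "real (card {S \<in> M. v \<in> S}) \<le> \<epsilon>2 * n ^ (r - 1)" using no uv by (auto simp: X_def)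
        have M2: "real (card M) \<le> \<epsilon>2 * n ^ r"
        proof -
          have "\<epsilon> * n ^ r \<le> \<epsilon>2 * n ^ r" using \<epsilon>(2) Nn(3) by (intro mult_right_mono) auto
          then show ?thesis using fewM by linarith
        qed
        have "contains_copy G (H_graph r F (m + 1))"
          by (rule bad_edge_with_rich_ends[OF r F Fm x0 only G c \<eta> classes \<epsilon>2
                Nn(1)[unfolded n_def V_def] const1[OF order_refl, unfolded K1_def L_def]
                M_def[unfolded V_def E_def] M2[unfolded n_def V_def] e(1)[unfolded E_def] e(2-5)
                du[unfolded n_def V_def] dv[unfolded n_def V_def]])
        then show False using free by simp
      qed
      have cardX: "real (card X) * (\<epsilon>2 * n ^ (r - 1)) \<le> real r * real (card M)"
      proof -
        have "real (card X) * (\<epsilon>2 * n ^ (r - 1)) \<le> (\<Sum>v\<in>X. real (card {S \<in> M. v \<in> S}))"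
          by (rule sum_bounded_below) (simp add: X_def less_imp_le)
        also have "\<dots> \<le> (\<Sum>v\<in>V. real (card {S \<in> M. v \<in> S}))"
          using X V by (intro sum_mono2) auto
        also have "\<dots> = real (\<Sum>v\<in>V. card {S \<in> M. v \<in> S})" by simp
        also have "\<dots> = real r * real (card M)" using sum_degrees[OF V finM MV] by simp
        finally show ?thesis .
      qed
      have BX: "\<exists>x\<in>X. x \<in> e" if "e \<in> B" for e
      proof -
        have "e \<in> E" "\<not> inj_on c e" using that by (auto simp: B_def bad_edges_def)
        then obtain u v where "u \<in> e" "v \<in> e" "u \<noteq> v" "c u = c v" by (auto simp: inj_on_def)
        then show ?thesis using badX \<open>e \<in> E\<close> by blast
      qed
      have "\<exists>x\<in>X. \<epsilon>3 * n ^ (r - 1) < real (card {e \<in> B. x \<in> e})"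
      proof (rule ccontr)
        assume "\<not> ?thesis"
        then have le: "\<And>x. x \<in> X \<Longrightarrow> real (card {e \<in> B. x \<in> e}) \<le> \<epsilon>3 * n ^ (r - 1)" by force
        have "B \<subseteq> (\<Union>x\<in>X. {e \<in> B. x \<in> e})" using BX by blast
        then have "card B \<le> card (\<Union>x\<in>X. {e \<in> B. x \<in> e})"
          using X B by (intro card_mono) auto
        also have "\<dots> \<le> (\<Sum>x\<in>X. card {e \<in> B. x \<in> e})" by (rule card_UN_le[OF X(2)])
        finally have "real (card B) \<le> real (\<Sum>x\<in>X. card {e \<in> B. x \<in> e})" by (rule of_nat_mono)
        also have "\<dots> = (\<Sum>x\<in>X. real (card {e \<in> B. x \<in> e}))" by simp
        also have "\<dots> \<le> real (card X) * (\<epsilon>3 * n ^ (r - 1))" using le by (rule sum_bounded_above)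
        also have "\<dots> = real (card X) * (\<epsilon>2 * n ^ (r - 1)) / real r" by (simp add: \<epsilon>3_def)
        also have "\<dots> \<le> real (card M)" using cardX r by (simp add: field_simps)
        finally show False using MB by simp
      qed
      then obtain x where x: "x \<in> X" "\<epsilon>3 * n ^ (r - 1) < real (card {e \<in> B. x \<in> e})" by blast
      have xV: "x \<in> V" using x X by blast
      define \<L> where "\<L> i = {g \<in> link E x. inj_on c g \<and> i \<in> c ` g}" for i
      have fin\<L>: "finite (\<L> i)" for i using finite_link[OF finE] by (simp add: \<L>_def)
      have smallX: "real (card X) * n ^ (r - 2) \<le> \<epsilon>3 / 2 * n ^ (r - 1)"
      proof -
        have pos: "0 < \<epsilon>2 * n" using \<epsilon>2 Nn by simp
        have "(real (card X) * n ^ (r - 2)) * (\<epsilon>2 * n) = real (card X) * (\<epsilon>2 * n ^ (r - 1))"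
          by (simp only: npow(2) mult_ac)
        also have "\<dots> \<le> real r * (\<epsilon> * n ^ r)"
          using cardX mult_left_mono[OF fewM, of "real r"] by simp
        also have "\<dots> \<le> real r * (\<epsilon>2 * \<epsilon>3 / (2 * real r) * n ^ r)"
          using \<epsilon>(4) Nn(3) by (intro mult_left_mono mult_right_mono) auto
        also have "\<dots> = (\<epsilon>3 / 2 * n ^ (r - 1)) * (\<epsilon>2 * n)" using r by (simp add: npow(1))
        finally show ?thesis using pos by (rule mult_right_le_imp_le)
      qed
      \<comment> \<open>Removing \<open>x\<close> from a bad edge leaves either a transversal set
        that repeats the colour of \<open>x\<close>, or a set with a monochromatic pair, which by
        \<open>badX\<close> contains another vertex of \<open>X\<close>. At most
        \<open>card X * n ^ (r - 2)\<close> edges are of the second kind.\<close>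
      have own: "\<epsilon>3 / 2 * n ^ (r - 1) \<le> real (card (\<L> (c x)))"
      proof -
        let ?Y = "\<Union>y\<in>X - {x}. {e. e \<subseteq> V \<and> card e = r \<and> {x, y} \<subseteq> e}"
        have "{e \<in> B. x \<in> e} \<subseteq> ?Y \<union> insert x ` \<L> (c x)"
        proof
          fix e assume e: "e \<in> {e \<in> B. x \<in> e}"
          then have eE: "e \<in> E" "x \<in> e" "\<not> inj_on c e" by (auto simp: B_def bad_edges_def)
          define g where "g = e - {x}"
          have g: "x \<notin> g" "e = insert x g" using eE(2) by (auto simp: g_def)
          show "e \<in> ?Y \<union> insert x ` \<L> (c x)"
          proof (cases "inj_on c g")
            case True
            then have "c x \<in> c ` g" using eE(3) g by (simp add: inj_on_insert)
            then have "g \<in> \<L> (c x)" using True g eE(1) by (simp add: \<L>_def link_def)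
            then show ?thesis using g(2) by blast
          next
            case False
            then obtain u v where uv: "u \<in> g" "v \<in> g" "u \<noteq> v" "c u = c v" by (auto simp: inj_on_def)
            then have "u \<in> X \<or> v \<in> X" using badX[OF eE(1)] g(2) by simp
            then obtain y where "y \<in> X" "y \<in> g" using uv by blast
            then have "y \<in> X - {x}" "{x, y} \<subseteq> e" using g by auto
            then show ?thesis using E[OF eE(1)] by blast
          qed
        qed
        moreover have "finite ?Y" using X V by auto
        ultimately have "card {e \<in> B. x \<in> e} \<le> card (?Y \<union> insert x ` \<L> (c x))"
          using fin\<L> by (intro card_mono) auto
        also have "\<dots> \<le> card ?Y + card (insert x ` \<L> (c x))" by (rule card_Un_le)
        also have "card (insert x ` \<L> (c x)) \<le> card (\<L> (c x))" using fin\<L> by (rule card_image_le)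
        also have "card ?Y \<le> card X * card V ^ (r - 2)"
        proof -
          have "card ?Y \<le> (\<Sum>y\<in>X - {x}. card {e. e \<subseteq> V \<and> card e = r \<and> {x, y} \<subseteq> e})"
            using X by (intro card_UN_le) auto
          also have "\<dots> \<le> (\<Sum>y\<in>X - {x}. card V ^ (r - 2))"
          proof (rule sum_mono)
            fix y assume y: "y \<in> X - {x}"
            then have "{x, y} \<subseteq> V" "card {x, y} = 2" using xV X by auto
            with card_supersets_le[OF V this(1), of r]
            show "card {e. e \<subseteq> V \<and> card e = r \<and> {x, y} \<subseteq> e} \<le> card V ^ (r - 2)" by simp
          qed
          also have "\<dots> = card (X - {x}) * card V ^ (r - 2)" by simp
          also have "\<dots> \<le> card X * card V ^ (r - 2)"
            using X by (intro mult_le_mono1 card_mono) auto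
          finally show ?thesis .
        qed
        finally have "card {e \<in> B. x \<in> e} \<le> card X * card V ^ (r - 2) + card (\<L> (c x))" by simp
        then have "real (card {e \<in> B. x \<in> e}) \<le> real (card X * card V ^ (r - 2) + card (\<L> (c x)))"
          by (rule of_nat_mono)
        also have "\<dots> = real (card X) * n ^ (r - 2) + real (card (\<L> (c x)))" by (simp add: n_def)
        finally show ?thesis using x(2) smallX by linarith
      qed
      have others: "\<epsilon>3 / 2 * n ^ (r - 1) \<le> real (card (\<L> i))" if i: "i < m" for i
      proof -
        \<comment> \<open>Writing \<open>c\<close> as \<open>c(x := c x)\<close> makes the
          recolouring formula apply on both sides, and the first two summands cancel.\<close>
        have "card (bad_edges (c(x := c x)) E) \<le> card (bad_edges (c(x := i)) E)"
          using opt[of x i] xV i by (simp add: V_def E_def)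
        then have "card (\<L> (c x)) \<le> card (\<L> i)"
          unfolding card_bad_edges_recolor[OF finE] \<L>_def by simp
        then show ?thesis using own by linarith
      qed
      \<comment> \<open>A row has a fixed colour set, so the link sets through class
        \<open>i\<close> are sorted by theirs; one of the at most \<open>2 ^ m\<close> colour sets
        carries the share \<open>\<gamma>\<close>.\<close>
      have exT: "\<exists>T. T \<subseteq> {..<m} \<and> card T = r - 1 \<and> i \<in> T \<and>
          \<gamma> * n ^ (r - 1) \<le> real (card {g \<in> \<L> i. c ` g = T})" if i: "i < m" for i
      proof (rule ccontr)
        assume no: "\<not> ?thesis"
        let ?\<T> = "{T. T \<subseteq> {..<m} \<and> card T = r - 1 \<and> i \<in> T}"
        have fin\<T>: "finite ?\<T>" by simp
        have "\<L> i \<subseteq> (\<Union>T\<in>?\<T>. {g \<in> \<L> i. c ` g = T})"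
        proof
          fix g assume g: "g \<in> \<L> i"
          then have gl: "x \<notin> g" "insert x g \<in> E" "inj_on c g" "i \<in> c ` g" by (auto simp: \<L>_def link_def)
          have "finite g" using E(1)[OF gl(2)] V by (meson finite_subset insert_subset)
          then have "card g = r - 1" using E(2)[OF gl(2)] gl(1) by simp
          then have "c ` g \<in> ?\<T>" using gl(3,4) c by (auto simp: card_image)
          then show "g \<in> (\<Union>T\<in>?\<T>. {g \<in> \<L> i. c ` g = T})" using g by blast
        qed
        then have "card (\<L> i) \<le> card (\<Union>T\<in>?\<T>. {g \<in> \<L> i. c ` g = T})"
          using fin\<T> fin\<L> by (intro card_mono) auto
        also have "\<dots> \<le> (\<Sum>T\<in>?\<T>. card {g \<in> \<L> i. c ` g = T})" by (rule card_UN_le[OF fin\<T>])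
        finally have "real (card (\<L> i)) \<le> real (\<Sum>T\<in>?\<T>. card {g \<in> \<L> i. c ` g = T})"
          by (rule of_nat_mono)
        also have "\<dots> = (\<Sum>T\<in>?\<T>. real (card {g \<in> \<L> i. c ` g = T}))" by simp
        finally have le: "real (card (\<L> i)) \<le> (\<Sum>T\<in>?\<T>. real (card {g \<in> \<L> i. c ` g = T}))" .
        have pos: "0 < \<epsilon>3 / 2 * n ^ (r - 1)" using \<epsilon>3 Nn(3) by simp
        have ne: "?\<T> \<noteq> {}"
        proof
          assume empty: "?\<T> = {}"
          show False using le others[OF i] pos unfolding empty by simp
        qed
        have "(\<Sum>T\<in>?\<T>. real (card {g \<in> \<L> i. c ` g = T})) < (\<Sum>T\<in>?\<T>. \<gamma> * n ^ (r - 1))"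
          using no fin\<T> ne by (intro sum_strict_mono) (auto simp: not_le)
        also have "\<dots> = real (card ?\<T>) * (\<gamma> * n ^ (r - 1))" by simp
        also have "\<dots> \<le> 2 ^ m * (\<epsilon>3 / 2 / 2 ^ m * n ^ (r - 1))"
        proof (intro mult_mono)
          have "card ?\<T> \<le> card (Pow {..<m})" by (intro card_mono) auto
          then have "card ?\<T> \<le> 2 ^ m" by (simp add: card_Pow)
          then show "real (card ?\<T>) \<le> 2 ^ m" using of_nat_mono[of "card ?\<T>" "2 ^ m", where 'a = real] by simp
        qed (use \<gamma> Nn(3) in auto)
        also have "\<dots> = \<epsilon>3 / 2 * n ^ (r - 1)" by simp
        finally show False using le others[OF i] by linarith
      qed
      define T where "T i = (SOME T. T \<subseteq> {..<m} \<and> card T = r - 1 \<and> i \<in> T \<and>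
          \<gamma> * n ^ (r - 1) \<le> real (card {g \<in> \<L> i. c ` g = T}))" for i
      have Tspec: "T i \<subseteq> {..<m} \<and> card (T i) = r - 1 \<and> i \<in> T i \<and>
          \<gamma> * n ^ (r - 1) \<le> real (card {g \<in> \<L> i. c ` g = T i})" if "i < m" for i
        unfolding T_def by (rule someI_ex[OF exT[OF that]])
      have T: "T i \<subseteq> {..<m} \<and> card (T i) = r - 1 \<and> i \<in> T i" if "i < m" for i
        using Tspec[OF that] by simp
      have cardT: "\<gamma> * n ^ (r - 1) \<le> real (card {g \<in> \<L> i. c ` g = T i})" if "i < m" for i
        using Tspec[OF that] by simp
      have sub: "{g \<in> \<L> i. c ` g = T i} \<subseteq> {g. g \<subseteq> verts G \<and> inj_on c g \<and> c ` g = T i \<and> insert x g \<in> edges G}" for i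
        using E(1) unfolding \<L>_def link_def V_def E_def by blast
      have M4: "real (card M) \<le> \<epsilon>4 * n ^ r"
      proof -
        have "\<epsilon> * n ^ r \<le> \<epsilon>4 * n ^ r" using \<epsilon>(3) Nn(3) by (intro mult_right_mono) auto
        then show ?thesis using fewM by linarith
      qed
      have "contains_copy G (H_graph r F (m + 1))"
        by (rule rich_link_embeds[OF r F Fm x0 only G c \<eta> classes \<epsilon>4 Nn(2)[unfolded n_def V_def] \<gamma>(1,2)
              const2[OF order_refl, unfolded K2_def L_def] M_def[unfolded V_def E_def] M4[unfolded n_def V_def]
              xV[unfolded V_def] T sub cardT[unfolded n_def V_def]])
      then show False using free by simp
    qed
    then show "card (bad_edges c (edges G)) \<le> card (rainbow (verts G) c r - edges G)"
      by (simp add: B_def M_def V_def E_def)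
  qed
qed

lemma turan_upper_bound:
  fixes F :: "'a hypergraph"
  assumes r: "2 \<le> r" "r \<le> m" and F: "r_graph r F"
    and deg: "num_verts F \<le> m \<or> (num_verts F = m + 1 \<and> (\<exists>v\<in>verts F. vertex_degree F v = 1))"
    and stable: "m_stable r m F"
  obtains N where "\<And>G :: nat hypergraph. r_graph r G \<Longrightarrow> N \<le> num_verts G \<Longrightarrow>
    \<not> contains_copy G (H_graph r F (m + 1)) \<Longrightarrow>
    num_edges G \<le> num_edges (turan_graph r (num_verts G) m)"
proof -
  let ?H = "H_graph r F (m + 1)"
  define D where "D = real (m choose r) / real m ^ r"
  have D: "0 \<le> D" by (simp add: D_def)
  obtain \<eta> \<xi> :: real where \<eta>: "0 < \<eta>" "0 < \<xi>" and small: "\<And>(V :: nat set) c j.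
       finite V \<Longrightarrow> c ` V \<subseteq> {..<m} \<Longrightarrow> j < m \<Longrightarrow>
       real (card {v \<in> V. c v = j}) < \<eta> * real (card V) \<Longrightarrow>
       real (card (rainbow V c r)) \<le> (D - \<xi>) * real (card V) ^ r"
  proof (rule rainbow_small_class[OF r, where 'v = nat])
    fix \<eta> \<xi> :: real
    assume "0 < \<eta>" "0 < \<xi>" "\<And>(V :: nat set) c j. finite V \<Longrightarrow> c ` V \<subseteq> {..<m} \<Longrightarrow> j < m \<Longrightarrow>
       real (card {v \<in> V. c v = j}) < \<eta> * real (card V) \<Longrightarrow>
       real (card (rainbow V c r)) \<le> (real (m choose r) / real m ^ r - \<xi>) * real (card V) ^ r"
    then show thesis unfolding D_def[symmetric] by (rule that)
  qed
  obtain \<epsilon>1 :: real and N1 where \<epsilon>1: "0 < \<epsilon>1" and bad: "\<And>(G :: nat hypergraph) c.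
       r_graph r G \<Longrightarrow> N1 \<le> card (verts G) \<Longrightarrow> \<not> contains_copy G ?H \<Longrightarrow> (\<And>v. c v < m) \<Longrightarrow>
       (\<And>t. t < m \<Longrightarrow> \<eta> * real (card (verts G)) \<le> real (card {v \<in> verts G. c v = t})) \<Longrightarrow>
       (\<And>x i. x \<in> verts G \<Longrightarrow> i < m \<Longrightarrow>
          card (bad_edges c (edges G)) \<le> card (bad_edges (c(x := i)) (edges G))) \<Longrightarrow>
       real (card (bad_edges c (edges G))) \<le> \<epsilon>1 * real (card (verts G)) ^ r \<Longrightarrow>
       card (bad_edges c (edges G)) \<le> card (rainbow (verts G) c r - edges G)"
  proof (rule few_bad_edges_le_missing[OF r F deg \<eta>(1), where 'b = nat], goal_cases)
    case 1
    show ?case by (rule 1(1)[OF 1(2,3)])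
  qed
  define \<epsilon> where "\<epsilon> = min \<epsilon>1 (\<xi> / 4)"
  have \<epsilon>: "0 < \<epsilon>" "\<epsilon> \<le> \<epsilon>1" "\<epsilon> \<le> \<xi> / 4" using \<epsilon>1 \<eta> by (auto simp: \<epsilon>_def)
  obtain \<delta> :: real and N2 where \<delta>: "0 < \<delta>" and col: "\<And>G :: nat hypergraph.
       r_graph r G \<Longrightarrow> N2 \<le> num_verts G \<Longrightarrow> \<not> contains_copy G ?H \<Longrightarrow>
       (D - \<delta>) * real (num_verts G) ^ r \<le> real (num_edges G) \<Longrightarrow>
       \<exists>c. (\<forall>v. c v < m) \<and> real (card (bad_edges c (edges G))) \<le> \<epsilon> * real (num_verts G) ^ r"
    unfolding D_def
  proof (rule stable_coloring[OF r F stable \<epsilon>(1)], goal_cases)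
    case 1
    show ?case by (rule 1(1)[OF 1(2,3)])
  qed
  \<comment> \<open>The deficit \<open>\<mu>\<close> and the bad edges together cost at most
    \<open>\<xi> / 2\<close> in density, so the transversal count exceeds
    \<open>(D - \<xi>) * n ^ r\<close> and no class can be small.\<close>
  define \<mu> where "\<mu> = min \<delta> (\<xi> / 4)"
  have \<mu>: "0 < \<mu>" "\<mu> \<le> \<delta>" "\<mu> \<le> \<xi> / 4" using \<delta> \<eta> by (auto simp: \<mu>_def)
  \<comment> \<open>From here on the error term in the lower bound for the Turan graph is at most
    \<open>\<mu> * n ^ r\<close>.\<close>
  define N3 where "N3 = nat \<lceil>D * real r * real m / \<mu>\<rceil>"
  show thesis
  proof (rule that[of "1 + N1 + N2 + N3"], rule ccontr)
    fix G :: "nat hypergraph"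
    assume G: "r_graph r G" and N: "1 + N1 + N2 + N3 \<le> num_verts G" and free: "\<not> contains_copy G ?H"
      and "\<not> num_edges G \<le> num_edges (turan_graph r (num_verts G) m)"
    then have many: "num_edges (turan_graph r (num_verts G) m) < num_edges G" by simp
    define V E n where "V = verts G" and "E = edges G" and "n = real (num_verts G)"
    have V: "finite V" using G by (simp add: r_graph_def V_def)
    have nV: "n = real (card V)" "num_verts G = card V" by (simp_all add: n_def V_def num_verts_def)
    have E: "e \<subseteq> V" "card e = r" if "e \<in> E" for e using that G by (auto simp: r_graph_def V_def E_def)
    have finE: "finite E" using E V by (intro finite_subset[of E "Pow V"]) auto
    have n0: "0 < n" using N by (simp add: n_def)
    have npow: "n ^ r = n * n ^ (r - 1)" using r by (cases r) auto
    have "D * real r * real m / \<mu> \<le> n"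
    proof -
      have "N3 \<le> num_verts G" using N by linarith
      then show ?thesis unfolding n_def N3_def
        using real_nat_ceiling_ge[of "D * real r * real m / \<mu>"] by linarith
    qed
    then have "D * real r * real m \<le> \<mu> * n" using \<mu>(1) by (simp add: field_simps)
    then have "D * real r * real m * n ^ (r - 1) \<le> \<mu> * n * n ^ (r - 1)"
      using n0 by (intro mult_right_mono) auto
    then have "D * real r * real m * n ^ (r - 1) \<le> \<mu> * n ^ r" by (simp add: npow)
    moreover have "D * n ^ r - D * real r * real m * n ^ (r - 1)
        \<le> real (num_edges (turan_graph r (num_verts G) m))"
      unfolding D_def n_def using r by (intro num_edges_turan_graph_ge) auto
    ultimately have dense: "D * n ^ r - \<mu> * n ^ r \<le> real (card E)"
      using many by (simp add: num_edges_def E_def)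
    have "\<mu> * n ^ r \<le> \<delta> * n ^ r" using \<mu>(2) n0 by (intro mult_right_mono) auto
    then have "(D - \<delta>) * n ^ r \<le> real (card E)" using dense by (simp add: left_diff_distrib)
    then obtain c0 where c0: "\<forall>v. c0 v < m" "real (card (bad_edges c0 E)) \<le> \<epsilon> * n ^ r"
      using col[OF G _ free] N by (auto simp: num_edges_def E_def n_def)
    \<comment> \<open>Minimality among all colourings with \<open>m\<close> colours yields both the
      optimality under recolouring one vertex and, by comparison with \<open>c0\<close>, the bound
      on bad edges.\<close>
    obtain c where c: "\<forall>v. c v < m"
      and least: "\<And>c'. \<forall>v. c' v < m \<Longrightarrow> card (bad_edges c E) \<le> card (bad_edges c' E)"
      using ex_has_least_nat[of "\<lambda>c. \<forall>v. c v < m" c0 "\<lambda>c. card (bad_edges c E)"] c0(1) by blast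
    have cV: "c ` V \<subseteq> {..<m}" using c by auto
    have few: "real (card (bad_edges c E)) \<le> \<epsilon> * n ^ r"
      using of_nat_mono[OF least[OF c0(1)], where 'a = real] c0(2) by linarith
    have split: "E = bad_edges c E \<union> (rainbow V c r \<inter> E)" "bad_edges c E \<inter> (rainbow V c r \<inter> E) = {}"
      using E by (auto simp: bad_edges_def rainbow_def)
    have finR: "finite (rainbow V c r)" using V by (simp add: rainbow_def)
    have "finite (bad_edges c E)" using finE by (simp add: bad_edges_def)
    then have cardE: "card E = card (bad_edges c E) + card (rainbow V c r \<inter> E)"
      using split finR card_Un_disjoint[of "bad_edges c E" "rainbow V c r \<inter> E"] by simp
    have "card (rainbow V c r \<inter> E) \<le> card (rainbow V c r)" using finR by (intro card_mono) auto
    then have "real (card E) \<le> real (card (bad_edges c E)) + real (card (rainbow V c r))"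
      using cardE by simp
    moreover have "\<epsilon> * n ^ r \<le> \<xi> / 4 * n ^ r" "\<mu> * n ^ r \<le> \<xi> / 4 * n ^ r"
      using \<epsilon>(3) \<mu>(3) n0 by (intro mult_right_mono; simp)+
    moreover have "0 < \<xi> * n ^ r" using \<eta>(2) n0 by simp
    ultimately have big: "(D - \<xi>) * n ^ r < real (card (rainbow V c r))"
      using few dense by (simp add: left_diff_distrib)
    have classes: "\<eta> * real (card V) \<le> real (card {v \<in> V. c v = t})" if "t < m" for t
      using small[OF V cV that] big unfolding nV(1) by fastforce
    have "card (bad_edges c E) \<le> card (rainbow V c r - E)"
      unfolding V_def E_def
    proof (rule bad[OF G _ free])
      show "N1 \<le> card (verts G)" using N nV(2) by (simp add: V_def)
      show "c v < m" for v using c by simp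
      show "\<eta> * real (card (verts G)) \<le> real (card {v \<in> verts G. c v = t})" if "t < m" for t
        using classes[OF that] by (simp add: V_def)
      show "card (bad_edges c (edges G)) \<le> card (bad_edges (c(x := i)) (edges G))" if "i < m" for x i
        using least[of "c(x := i)"] c that by (simp add: E_def)
      have "\<epsilon> * n ^ r \<le> \<epsilon>1 * n ^ r" using \<epsilon>(2) n0 by (intro mult_right_mono) auto
      then show "real (card (bad_edges c (edges G))) \<le> \<epsilon>1 * real (card (verts G)) ^ r"
        using few by (simp add: E_def nV(1) V_def)
    qed
    \<comment> \<open>The bad edges are traded for at least as many missing transversal sets, so
      \<open>card E\<close> is at most the number of all transversal sets.\<close>
    then have "card E \<le> card (rainbow V c r - E) + card (rainbow V c r \<inter> E)" using cardE by simp
    also have "\<dots> = card (rainbow V c r)"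
      using card_Int_Diff[OF finR, of E] by simp
    also have "\<dots> \<le> num_edges (turan_graph r (card V) m)"
      using card_rainbow_le_turan[OF V cV] r by simp
    finally show False using many nV(2) by (simp add: num_edges_def E_def)
  qed
qed

theorem theorem6p3:
  fixes F :: "'a hypergraph" and m r :: nat
  assumes "2 \<le> r" and "r \<le> m"
    and "r_graph r F"
    and "num_verts F \<le> m \<or>
         (num_verts F = m + 1 \<and> (\<exists>v\<in>verts F. vertex_degree F v = 1))"
    and "m_stable r m F"
  shows "\<exists>n\<^sub>2::nat. \<forall>n\<ge>n\<^sub>2.
           turan_number r n (H_graph r F (m + 1)) = num_edges (turan_graph r n m)"
proof -
  let ?H = "H_graph r F (m + 1)"
  obtain N where upper: "\<And>G :: nat hypergraph. r_graph r G \<Longrightarrow> N \<le> num_verts G \<Longrightarrow>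
      \<not> contains_copy G ?H \<Longrightarrow> num_edges G \<le> num_edges (turan_graph r (num_verts G) m)"
    using turan_upper_bound[OF assms] by blast
  have "turan_number r n ?H = num_edges (turan_graph r n m)" if "N \<le> n" for n
    unfolding turan_number_def
  \<comment> \<open>The upper bound does double duty: it also makes the set of edge numbers finite,
    as \<open>Max\<close> requires. The Turan graph attains it.\<close>
  proof (rule Max_eqI)
    let ?S = "{num_edges G | G :: nat hypergraph. r_graph r G \<and> num_verts G = n \<and> \<not> contains_copy G ?H}"
    show le: "y \<le> num_edges (turan_graph r n m)" if "y \<in> ?S" for y
      using that upper \<open>N \<le> n\<close> by auto
    then have "?S \<subseteq> {..num_edges (turan_graph r n m)}" by blast
    then show "finite ?S" by (rule finite_subset) simp
    have "r_graph r (turan_graph r n m)" "num_verts (turan_graph r n m) = n"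
      by (auto simp: turan_graph_def complete_partite_def r_graph_def num_verts_def)
    moreover have "\<not> contains_copy (turan_graph r n m) ?H"
      using assms by (intro turan_graph_H_graph_free) (auto simp: r_graph_def)
    ultimately show "num_edges (turan_graph r n m) \<in> ?S" by blast
  qed
  then show ?thesis by blast
qed

end
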